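(* Let $\mathcal{E}$ be a strongly deflation-exact category with kernels. There is a $t$-structure on $\mathbf{D}(\mathcal{E})$ given by $$\mathbf{D}^{\leq0}(\mathcal{E})=\{X^\bullet\in\mathbf{D}(\mathcal{E})\mid\tau^{\geq1}X^\bullet\cong0\},\qquad \mathbf{D}^{\geq0}(\mathcal{E})=\{X^\bullet\in\mathbf{D}(\mathcal{E})\mid\tau^{\leq-1}X^\bullet\cong0\}.$$
   Context: All categories are essentially small and additive. A \emph{conflation category} is an additive category with a chosen class, closed under isomorphisms, of kernel-cokernel pairs called \emph{conflations}; the kernel part of a conflation is an \emph{inflation}, the cokernel part a \emph{deflation}. It is \emph{deflation-exact} if (R0) every map $X\to 0$ is a deflation, (R1) compositions of deflations are deflations, (R2) pullbacks of deflations along arbitrary morphisms exist and are deflations; \emph{strongly deflation-exact} if moreover (R3): whenever $i\colon A\to B$ and $p\colon B\to C$ are morphisms such that $p$ has a kernel and $p\circ i$ is a deflation, $p$ is a deflation. ``With kernels'' means every morphism has a kernel (not necessarily an inflation). A complex $X^\bullet$ in $\mathcal{E}$ is \emph{acyclic} if for every $n$ the differential $d^{n-1}$ factors as $X^{n-1} \to \ker(d^n) \to X^n$ where the first map is a deflation which is the cokernel of $d^{n-2}$ and the second map is an inflation which is the kernel of $d^n$. $\mathbf{D}(\mathcal{E})$ is the Verdier quotient of the homotopy category $\mathbf{K}(\mathcal{E})$ by the thick closure of the acyclic complexes. For a complex $C^\bullet$, let $d^{n-1}=i^{n-1}\circ p^{n-1}$ with $p^{n-1}\colon C^{n-1}\to\ker(d^n)$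 and $i^{n-1}\colon\ker(d^n)\to C^n$ the kernel of $d^n$. Then $\tau^{\leq n}C^\bullet$ is $\cdots\to C^{n-2}\to C^{n-1}\xrightarrow{p^{n-1}}\ker(d^n)\to0\to\cdots$ with $\ker(d^n)$ in degree $n$, and $\tau^{\geq n+1}C^\bullet$ is $\cdots\to0\to\ker(d^n)\xrightarrow{i^{n-1}}C^n\to C^{n+1}\to\cdots$ with $C^n$ in degree $n$ and $\ker(d^n)$ in degree $n-1$. The isomorphisms $\cong 0$ are taken in $\mathbf{D}(\mathcal{E})$; equivalently $X^\bullet\in\mathbf{D}^{\leq0}(\mathcal{E})$ (resp. $\mathbf{D}^{\geq0}(\mathcal{E})$) iff $\ker d^{i-1}\to X^{i-1}\to\ker d^i$ is a conflation for all $i\geq1$ (resp. for all $i\leq-1$). *)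

theory Defs
  imports "HOL-Algebra.Group" "HOL.Hull"
begin

section \<open>Categories and additive categories\<close>

text \<open>Arrows carry their domain and codomain, so hom-sets are disjoint. A category whose objects
  and arrows are elements of HOL types is automatically small. Composition is written in the
  usual order: \<open>g \<cdot>\<^bsub>C\<^esub> f\<close> is \<open>g\<close> after \<open>f\<close>; it is only meaningful if \<open>Dom C g = Cod C f\<close>.\<close>

record ('o, 'a) cat =
  Obj :: "'o set"
  Arr :: "'a set"
  Dom :: "'a \<Rightarrow> 'o"
  Cod :: "'a \<Rightarrow> 'o"
  Ide :: "'o \<Rightarrow> 'a"
  Comp :: "'a \<Rightarrow> 'a \<Rightarrow> 'a"  (infixr \<open>\<cdot>\<index>\<close> 70)

definition Hom :: "('o, 'a, 'z) cat_scheme \<Rightarrow> 'o \<Rightarrow> 'o \<Rightarrow> 'a set" where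
  "Hom C X Y = {f \<in> Arr C. Dom C f = X \<and> Cod C f = Y}"

locale category =
  fixes C :: "('o, 'a, 'z) cat_scheme"
  assumes Dom_Obj: "f \<in> Arr C \<Longrightarrow> Dom C f \<in> Obj C"
    and Cod_Obj: "f \<in> Arr C \<Longrightarrow> Cod C f \<in> Obj C"
    and Ide_Hom: "X \<in> Obj C \<Longrightarrow> Ide C X \<in> Hom C X X"
    and Comp_Hom: "\<lbrakk>f \<in> Hom C X Y; g \<in> Hom C Y Z\<rbrakk> \<Longrightarrow> g \<cdot>\<^bsub>C\<^esub> f \<in> Hom C X Z"
    and Comp_Ide: "f \<in> Hom C X Y \<Longrightarrow> f \<cdot>\<^bsub>C\<^esub> Ide C X = f"
    and Ide_Comp: "f \<in> Hom C X Y \<Longrightarrow> Ide C Y \<cdot>\<^bsub>C\<^esub> f = f"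
    and Comp_assoc: "\<lbrakk>f \<in> Hom C W X; g \<in> Hom C X Y; h \<in> Hom C Y Z\<rbrakk>
          \<Longrightarrow> (h \<cdot>\<^bsub>C\<^esub> g) \<cdot>\<^bsub>C\<^esub> f = h \<cdot>\<^bsub>C\<^esub> (g \<cdot>\<^bsub>C\<^esub> f)"

definition iso_arr :: "('o, 'a, 'z) cat_scheme \<Rightarrow> 'a \<Rightarrow> bool" where
  "iso_arr C f \<longleftrightarrow> f \<in> Arr C \<and>
     (\<exists>g \<in> Hom C (Cod C f) (Dom C f).
        g \<cdot>\<^bsub>C\<^esub> f = Ide C (Dom C f) \<and> f \<cdot>\<^bsub>C\<^esub> g = Ide C (Cod C f))"

definition isomorphic :: "('o, 'a, 'z) cat_scheme \<Rightarrow> 'o \<Rightarrow> 'o \<Rightarrow> bool" where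
  "isomorphic C X Y \<longleftrightarrow> (\<exists>f \<in> Hom C X Y. iso_arr C f)"

definition zero_obj :: "('o, 'a, 'z) cat_scheme \<Rightarrow> 'o \<Rightarrow> bool" where
  "zero_obj C Z \<longleftrightarrow> Z \<in> Obj C \<and>
     (\<forall>X \<in> Obj C. (\<exists>!f. f \<in> Hom C X Z) \<and> (\<exists>!f. f \<in> Hom C Z X))"

definition isomorphic_to_zero :: "('o, 'a, 'z) cat_scheme \<Rightarrow> 'o \<Rightarrow> bool" where
  "isomorphic_to_zero C X \<longleftrightarrow> (\<exists>Z. zero_obj C Z \<and> isomorphic C X Z)"

text \<open>\<open>Zero C X Y\<close> is the zero element of the group \<open>Hom C X Y\<close>.\<close>

record ('o, 'a) addcat = "('o, 'a) cat" +
  Add :: "'a \<Rightarrow> 'a \<Rightarrow> 'a"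
  Zero :: "'o \<Rightarrow> 'o \<Rightarrow> 'a"

definition hom_group :: "('o, 'a, 'z) addcat_scheme \<Rightarrow> 'o \<Rightarrow> 'o \<Rightarrow> 'a monoid" where
  "hom_group C X Y = \<lparr>carrier = Hom C X Y, monoid.mult = Add C, one = Zero C X Y\<rparr>"

definition Neg :: "('o, 'a, 'z) addcat_scheme \<Rightarrow> 'a \<Rightarrow> 'a" where
  "Neg C f = inv\<^bsub>hom_group C (Dom C f) (Cod C f)\<^esub> f"

text \<open>\<open>S\<close> is a biproduct of \<open>A\<close> and \<open>B\<close> with injections \<open>i\<^sub>1, i\<^sub>2\<close> and projections \<open>p\<^sub>1, p\<^sub>2\<close>.\<close>

definition is_biproduct ::
  "('o, 'a, 'z) addcat_scheme \<Rightarrow> 'o \<Rightarrow> 'o \<Rightarrow> 'o \<times> 'a \<times> 'a \<times> 'a \<times> 'a \<Rightarrow> bool" where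
  "is_biproduct C A B = (\<lambda>(S, i\<^sub>1, i\<^sub>2, p\<^sub>1, p\<^sub>2).
     i\<^sub>1 \<in> Hom C A S \<and> i\<^sub>2 \<in> Hom C B S \<and> p\<^sub>1 \<in> Hom C S A \<and> p\<^sub>2 \<in> Hom C S B \<and>
     p\<^sub>1 \<cdot>\<^bsub>C\<^esub> i\<^sub>1 = Ide C A \<and> p\<^sub>2 \<cdot>\<^bsub>C\<^esub> i\<^sub>2 = Ide C B \<and>
     p\<^sub>2 \<cdot>\<^bsub>C\<^esub> i\<^sub>1 = Zero C A B \<and> p\<^sub>1 \<cdot>\<^bsub>C\<^esub> i\<^sub>2 = Zero C B A \<and>
     Add C (i\<^sub>1 \<cdot>\<^bsub>C\<^esub> p\<^sub>1) (i\<^sub>2 \<cdot>\<^bsub>C\<^esub> p\<^sub>2) = Ide C S)"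

locale additive_category = category C for C :: "('o, 'a, 'z) addcat_scheme" +
  assumes Hom_comm_group: "\<lbrakk>X \<in> Obj C; Y \<in> Obj C\<rbrakk> \<Longrightarrow> comm_group (hom_group C X Y)"
    and Comp_Add: "\<lbrakk>f \<in> Hom C X Y; f' \<in> Hom C X Y; g \<in> Hom C Y Z\<rbrakk>
          \<Longrightarrow> g \<cdot>\<^bsub>C\<^esub> Add C f f' = Add C (g \<cdot>\<^bsub>C\<^esub> f) (g \<cdot>\<^bsub>C\<^esub> f')"
    and Add_Comp: "\<lbrakk>f \<in> Hom C X Y; g \<in> Hom C Y Z; g' \<in> Hom C Y Z\<rbrakk>
          \<Longrightarrow> Add C g g' \<cdot>\<^bsub>C\<^esub> f = Add C (g \<cdot>\<^bsub>C\<^esub> f) (g' \<cdot>\<^bsub>C\<^esub> f)"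
    and ex_zero_obj: "\<exists>Z. zero_obj C Z"
    and ex_biproduct: "\<lbrakk>A \<in> Obj C; B \<in> Obj C\<rbrakk> \<Longrightarrow> \<exists>b. is_biproduct C A B b"

definition is_kernel :: "('o, 'a, 'z) addcat_scheme \<Rightarrow> 'a \<Rightarrow> 'a \<Rightarrow> bool" where
  "is_kernel C k f \<longleftrightarrow> f \<in> Arr C \<and> k \<in> Arr C \<and> Cod C k = Dom C f \<and>
     f \<cdot>\<^bsub>C\<^esub> k = Zero C (Dom C k) (Cod C f) \<and>
     (\<forall>g \<in> Arr C. Cod C g = Dom C f \<and> f \<cdot>\<^bsub>C\<^esub> g = Zero C (Dom C g) (Cod C f) \<longrightarrow>
        (\<exists>!h. h \<in> Hom C (Dom C g) (Dom C k) \<and> k \<cdot>\<^bsub>C\<^esub> h = g))"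

definition is_cokernel :: "('o, 'a, 'z) addcat_scheme \<Rightarrow> 'a \<Rightarrow> 'a \<Rightarrow> bool" where
  "is_cokernel C c f \<longleftrightarrow> f \<in> Arr C \<and> c \<in> Arr C \<and> Dom C c = Cod C f \<and>
     c \<cdot>\<^bsub>C\<^esub> f = Zero C (Dom C f) (Cod C c) \<and>
     (\<forall>g \<in> Arr C. Dom C g = Cod C f \<and> g \<cdot>\<^bsub>C\<^esub> f = Zero C (Dom C f) (Cod C g) \<longrightarrow>
        (\<exists>!h. h \<in> Hom C (Cod C c) (Cod C g) \<and> h \<cdot>\<^bsub>C\<^esub> c = g))"

definition has_kernels :: "('o, 'a, 'z) addcat_scheme \<Rightarrow> bool" where
  "has_kernels C \<longleftrightarrow> (\<forall>f \<in> Arr C. \<exists>k. is_kernel C k f)"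

text \<open>The pullback of \<open>p : B \<rightarrow> D\<close> along \<open>f : A \<rightarrow> D\<close> consists of \<open>p' : P \<rightarrow> A\<close> and \<open>f' : P \<rightarrow> B\<close>
  with \<open>f p' = p f'\<close>.\<close>

definition is_pullback :: "('o, 'a, 'z) cat_scheme \<Rightarrow> 'a \<Rightarrow> 'a \<Rightarrow> 'a \<Rightarrow> 'a \<Rightarrow> bool" where
  "is_pullback C p f p' f' \<longleftrightarrow>
     p \<in> Arr C \<and> f \<in> Arr C \<and> Cod C p = Cod C f \<and>
     p' \<in> Arr C \<and> f' \<in> Arr C \<and> Dom C p' = Dom C f' \<and>
     Cod C p' = Dom C f \<and> Cod C f' = Dom C p \<and> f \<cdot>\<^bsub>C\<^esub> p' = p \<cdot>\<^bsub>C\<^esub> f' \<and>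
     (\<forall>u \<in> Arr C. \<forall>v \<in> Arr C.
        Dom C u = Dom C v \<and> Cod C u = Dom C f \<and> Cod C v = Dom C p \<and>
        f \<cdot>\<^bsub>C\<^esub> u = p \<cdot>\<^bsub>C\<^esub> v \<longrightarrow>
        (\<exists>!h. h \<in> Hom C (Dom C u) (Dom C p') \<and> p' \<cdot>\<^bsub>C\<^esub> h = u \<and> f' \<cdot>\<^bsub>C\<^esub> h = v))"

text \<open>Choices that are unique up to isomorphism. They are meaningful as soon as the category is
  additive (respectively, the kernel exists).\<close>

definition zero_object :: "('o, 'a, 'z) cat_scheme \<Rightarrow> 'o" where
  "zero_object C = (SOME Z. zero_obj C Z)"

definition biprod :: "('o, 'a, 'z) addcat_scheme \<Rightarrow> 'o \<Rightarrow> 'o \<Rightarrow> 'o \<times> 'a \<times> 'a \<times> 'a \<times> 'a" where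
  "biprod C A B = (SOME b. is_biproduct C A B b)"

definition ker_arr :: "('o, 'a, 'z) addcat_scheme \<Rightarrow> 'a \<Rightarrow> 'a" where
  "ker_arr C f = (SOME k. is_kernel C k f)"


section \<open>Strongly deflation-exact categories\<close>

record ('o, 'a) conflcat = "('o, 'a) addcat" +
  Conf :: "('a \<times> 'a) set"

definition inflation :: "('o, 'a, 'z) conflcat_scheme \<Rightarrow> 'a \<Rightarrow> bool" where
  "inflation C i \<longleftrightarrow> (\<exists>p. (i, p) \<in> Conf C)"

definition deflation :: "('o, 'a, 'z) conflcat_scheme \<Rightarrow> 'a \<Rightarrow> bool" where
  "deflation C p \<longleftrightarrow> (\<exists>i. (i, p) \<in> Conf C)"

definition kernel_cokernel_pair :: "('o, 'a, 'z) addcat_scheme \<Rightarrow> 'a \<Rightarrow> 'a \<Rightarrow> bool" where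
  "kernel_cokernel_pair C i p \<longleftrightarrow> is_kernel C i p \<and> is_cokernel C p i"

definition pair_iso :: "('o, 'a, 'z) cat_scheme \<Rightarrow> 'a \<times> 'a \<Rightarrow> 'a \<times> 'a \<Rightarrow> bool" where
  "pair_iso C = (\<lambda>(i, p) (i', p').
     \<exists>a b c. iso_arr C a \<and> iso_arr C b \<and> iso_arr C c \<and>
       a \<in> Hom C (Dom C i) (Dom C i') \<and> b \<in> Hom C (Cod C i) (Cod C i') \<and>
       c \<in> Hom C (Cod C p) (Cod C p') \<and>
       b \<cdot>\<^bsub>C\<^esub> i = i' \<cdot>\<^bsub>C\<^esub> a \<and> c \<cdot>\<^bsub>C\<^esub> p = p' \<cdot>\<^bsub>C\<^esub> b)"

locale conflation_category = additive_category C for C :: "('o, 'a, 'z) conflcat_scheme" +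
  assumes Conf_pair: "(i, p) \<in> Conf C \<Longrightarrow> kernel_cokernel_pair C i p"
    and Conf_iso: "\<lbrakk>(i, p) \<in> Conf C; kernel_cokernel_pair C i' p'; pair_iso C (i, p) (i', p')\<rbrakk>
          \<Longrightarrow> (i', p') \<in> Conf C"

locale deflation_exact_category = conflation_category +
  assumes R0: "\<lbrakk>zero_obj C Z; f \<in> Hom C X Z\<rbrakk> \<Longrightarrow> deflation C f"
    and R1: "\<lbrakk>deflation C p; deflation C q; Dom C q = Cod C p\<rbrakk> \<Longrightarrow> deflation C (q \<cdot>\<^bsub>C\<^esub> p)"
    and R2_ex: "\<lbrakk>deflation C p; f \<in> Arr C; Cod C f = Cod C p\<rbrakk>
          \<Longrightarrow> \<exists>p' f'. is_pullback C p f p' f'"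
    and R2: "\<lbrakk>deflation C p; is_pullback C p f p' f'\<rbrakk> \<Longrightarrow> deflation C p'"

locale strongly_deflation_exact_category = deflation_exact_category +
  assumes R3: "\<lbrakk>i \<in> Hom C A B; p \<in> Hom C B D; \<exists>k. is_kernel C k p; deflation C (p \<cdot>\<^bsub>C\<^esub> i)\<rbrakk>
          \<Longrightarrow> deflation C p"


section \<open>Categories with shift and triangles\<close>

text \<open>\<open>Sh\<close> and \<open>ShA\<close> are the shift functor \<open>[1]\<close> on objects and on arrows; a triangle
  \<open>X \<rightarrow> Y \<rightarrow> Z \<rightarrow> X[1]\<close> is the triple of its arrows. The records only collect the data of a
  triangulated category, not its axioms.\<close>

record ('o, 'a) shiftcat = "('o, 'a) addcat" +
  Sh :: "'o \<Rightarrow> 'o"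
  ShA :: "'a \<Rightarrow> 'a"

record ('o, 'a) tricat = "('o, 'a) shiftcat" +
  Tri :: "('a \<times> 'a \<times> 'a) set"

definition candidate_triangle :: "('o, 'a, 'z) shiftcat_scheme \<Rightarrow> 'a \<times> 'a \<times> 'a \<Rightarrow> bool" where
  "candidate_triangle C = (\<lambda>(u, v, w). u \<in> Arr C \<and> v \<in> Arr C \<and> w \<in> Arr C \<and>
     Dom C v = Cod C u \<and> Dom C w = Cod C v \<and> Cod C w = Sh C (Dom C u))"

definition triangle_iso ::
  "('o, 'a, 'z) shiftcat_scheme \<Rightarrow> 'a \<times> 'a \<times> 'a \<Rightarrow> 'a \<times> 'a \<times> 'a \<Rightarrow> bool" where
  "triangle_iso C = (\<lambda>(u, v, w) (u', v', w').
     \<exists>a b c. iso_arr C a \<and> iso_arr C b \<and> iso_arr C c \<and>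
       a \<in> Hom C (Dom C u) (Dom C u') \<and> b \<in> Hom C (Dom C v) (Dom C v') \<and>
       c \<in> Hom C (Dom C w) (Dom C w') \<and>
       b \<cdot>\<^bsub>C\<^esub> u = u' \<cdot>\<^bsub>C\<^esub> a \<and> c \<cdot>\<^bsub>C\<^esub> v = v' \<cdot>\<^bsub>C\<^esub> b \<and> ShA C a \<cdot>\<^bsub>C\<^esub> w = w' \<cdot>\<^bsub>C\<^esub> c)"

text \<open>Equip \<open>C\<close> with all triangles that are isomorphic to one in \<open>S\<close>.\<close>

definition with_triangles ::
  "('o, 'a) shiftcat \<Rightarrow> ('a \<times> 'a \<times> 'a) set \<Rightarrow> ('o, 'a) tricat" where
  "with_triangles C S = shiftcat.extend C
     (tricat.fields {t. candidate_triangle C t \<and> (\<exists>t' \<in> S. triangle_iso C t t')})"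

text \<open>Full subcategories closed under isomorphisms are given by their sets of objects.\<close>

definition iso_closed :: "('o, 'a, 'z) cat_scheme \<Rightarrow> 'o set \<Rightarrow> bool" where
  "iso_closed C N \<longleftrightarrow> N \<subseteq> Obj C \<and> (\<forall>X \<in> N. \<forall>Y \<in> Obj C. isomorphic C X Y \<longrightarrow> Y \<in> N)"

text \<open>Thick subcategories: full triangulated subcategories closed under direct summands.
  Closure under \<open>[1]\<close>, \<open>[-1]\<close> and cones gives the two-out-of-three property for triangles.\<close>

definition thick :: "('o, 'a, 'z) tricat_scheme \<Rightarrow> 'o set \<Rightarrow> bool" where
  "thick T N \<longleftrightarrow> iso_closed T N \<and>
     (\<forall>Z. zero_obj T Z \<longrightarrow> Z \<in> N) \<and>
     (\<forall>X \<in> Obj T. Sh T X \<in> N \<longleftrightarrow> X \<in> N) \<and>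
     (\<forall>u v w. (u, v, w) \<in> Tri T \<and> Dom T u \<in> N \<and> Cod T u \<in> N \<longrightarrow> Cod T v \<in> N) \<and>
     (\<forall>A B S i\<^sub>1 i\<^sub>2 p\<^sub>1 p\<^sub>2. is_biproduct T A B (S, i\<^sub>1, i\<^sub>2, p\<^sub>1, p\<^sub>2) \<and> S \<in> N \<longrightarrow> A \<in> N \<and> B \<in> N)"

definition thick_closure :: "('o, 'a, 'z) tricat_scheme \<Rightarrow> 'o set \<Rightarrow> 'o set" where
  "thick_closure T S = thick T hull S"


section \<open>Verdier quotients\<close>

text \<open>The quotient of \<open>T\<close> by \<open>N\<close> is the localization of \<open>T\<close> at the arrows with cone in \<open>N\<close>,
  constructed by the calculus of fractions: an arrow \<open>X \<rightarrow> Y\<close> is a triple \<open>(X, Y, F)\<close> where \<open>F\<close> is an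
  equivalence class of roofs \<open>(s, f)\<close>, i.e. \<open>X \<leftarrow>s\<midarrow> Z \<midarrow>f\<rightarrow> Y\<close> with the cone of \<open>s\<close> in \<open>N\<close>.\<close>

definition denominators :: "('o, 'a, 'z) tricat_scheme \<Rightarrow> 'o set \<Rightarrow> 'a set" where
  "denominators T N = {s \<in> Arr T. \<exists>v w. (s, v, w) \<in> Tri T \<and> Cod T v \<in> N}"

definition roofs :: "('o, 'a, 'z) tricat_scheme \<Rightarrow> 'o set \<Rightarrow> 'o \<Rightarrow> 'o \<Rightarrow> ('a \<times> 'a) set" where
  "roofs T N X Y = {(s, f). s \<in> denominators T N \<and> f \<in> Arr T \<and>
     Dom T s = Dom T f \<and> Cod T s = X \<and> Cod T f = Y}"

definition roof_equiv :: "('o, 'a, 'z) tricat_scheme \<Rightarrow> 'o set \<Rightarrow> 'a \<times> 'a \<Rightarrow> 'a \<times> 'a \<Rightarrow> bool" where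
  "roof_equiv T N = (\<lambda>(s, f) (t, g).
     \<exists>u \<in> Arr T. \<exists>v \<in> Arr T. Dom T u = Dom T v \<and> Cod T u = Dom T s \<and> Cod T v = Dom T t \<and>
       s \<cdot>\<^bsub>T\<^esub> u = t \<cdot>\<^bsub>T\<^esub> v \<and> f \<cdot>\<^bsub>T\<^esub> u = g \<cdot>\<^bsub>T\<^esub> v \<and> s \<cdot>\<^bsub>T\<^esub> u \<in> denominators T N)"

definition roof_class ::
  "('o, 'a, 'z) tricat_scheme \<Rightarrow> 'o set \<Rightarrow> 'o \<Rightarrow> 'o \<Rightarrow> 'a \<times> 'a \<Rightarrow> ('a \<times> 'a) set" where
  "roof_class T N X Y r = {r' \<in> roofs T N X Y. roof_equiv T N r r'}"

definition roof_comp ::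
  "('o, 'a, 'z) tricat_scheme \<Rightarrow> 'o set \<Rightarrow> 'a \<times> 'a \<Rightarrow> 'a \<times> 'a \<Rightarrow> ('a \<times> 'a) set" where
  "roof_comp T N = (\<lambda>(t, g) (s, f).
     {(s \<cdot>\<^bsub>T\<^esub> t', g \<cdot>\<^bsub>T\<^esub> h) | t' h. t' \<in> denominators T N \<and> h \<in> Arr T \<and> Dom T t' = Dom T h \<and>
        Cod T t' = Dom T s \<and> Cod T h = Dom T t \<and> f \<cdot>\<^bsub>T\<^esub> t' = t \<cdot>\<^bsub>T\<^esub> h})"

text \<open>Operations on classes are unions over all representatives; sums are formed with a common
  denominator.\<close>

definition quotient_shiftcat ::
  "('o, 'a, 'z) tricat_scheme \<Rightarrow> 'o set \<Rightarrow> ('o, 'o \<times> 'o \<times> ('a \<times> 'a) set) shiftcat" where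
  "quotient_shiftcat T N =
    \<lparr>Obj = Obj T,
     Arr = {(X, Y, roof_class T N X Y r) | X Y r. X \<in> Obj T \<and> Y \<in> Obj T \<and> r \<in> roofs T N X Y},
     Dom = (\<lambda>(X, Y, F). X),
     Cod = (\<lambda>(X, Y, F). Y),
     Ide = (\<lambda>X. (X, X, roof_class T N X X (Ide T X, Ide T X))),
     Comp = (\<lambda>(Y', Z, G) (X, Y, F).
       (X, Z, \<Union>r' \<in> G. \<Union>r \<in> F. \<Union>q \<in> roof_comp T N r' r. roof_class T N X Z q)),
     Add = (\<lambda>(X, Y, F) (X', Y', G).
       (X, Y, \<Union>{roof_class T N X Y (s, Add T f g) | s f g. (s, f) \<in> F \<and> (s, g) \<in> G})),
     Zero = (\<lambda>X Y. (X, Y, roof_class T N X Y (Ide T X, Zero T X Y))),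
     Sh = Sh T,
     ShA = (\<lambda>(X, Y, F).
       (Sh T X, Sh T Y, \<Union>(s, f) \<in> F. roof_class T N (Sh T X) (Sh T Y) (ShA T s, ShA T f)))\<rparr>"

definition quotient_functor ::
  "('o, 'a, 'z) tricat_scheme \<Rightarrow> 'o set \<Rightarrow> 'a \<Rightarrow> 'o \<times> 'o \<times> ('a \<times> 'a) set" where
  "quotient_functor T N f =
     (Dom T f, Cod T f, roof_class T N (Dom T f) (Cod T f) (Ide T (Dom T f), f))"

definition verdier_quotient ::
  "('o, 'a, 'z) tricat_scheme \<Rightarrow> 'o set \<Rightarrow> ('o, 'o \<times> 'o \<times> ('a \<times> 'a) set) tricat" where
  "verdier_quotient T N = with_triangles (quotient_shiftcat T N)
     {(quotient_functor T N u, quotient_functor T N v, quotient_functor T N w) | u v w.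
        (u, v, w) \<in> Tri T}"


section \<open>Complexes and the homotopy category\<close>

text \<open>Cohomological indexing: \<open>Dif X n : Ter X n \<rightarrow> Ter X (n + 1)\<close>.\<close>

record ('o, 'a) cpx =
  Ter :: "int \<Rightarrow> 'o"
  Dif :: "int \<Rightarrow> 'a"

definition is_complex :: "('o, 'a, 'z) addcat_scheme \<Rightarrow> ('o, 'a) cpx \<Rightarrow> bool" where
  "is_complex E X \<longleftrightarrow>
     (\<forall>n. Dif X n \<in> Hom E (Ter X n) (Ter X (n + 1)) \<and>
          Dif X (n + 1) \<cdot>\<^bsub>E\<^esub> Dif X n = Zero E (Ter X n) (Ter X (n + 2)))"

definition chain_maps ::
  "('o, 'a, 'z) addcat_scheme \<Rightarrow> ('o, 'a) cpx \<Rightarrow> ('o, 'a) cpx \<Rightarrow> (int \<Rightarrow> 'a) set" where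
  "chain_maps E X Y = {f. \<forall>n. f n \<in> Hom E (Ter X n) (Ter Y n) \<and>
     f (n + 1) \<cdot>\<^bsub>E\<^esub> Dif X n = Dif Y n \<cdot>\<^bsub>E\<^esub> f n}"

definition homotopic ::
  "('o, 'a, 'z) addcat_scheme \<Rightarrow> ('o, 'a) cpx \<Rightarrow> ('o, 'a) cpx \<Rightarrow>
     (int \<Rightarrow> 'a) \<Rightarrow> (int \<Rightarrow> 'a) \<Rightarrow> bool" where
  "homotopic E X Y f g \<longleftrightarrow>
     (\<exists>h. \<forall>n. h n \<in> Hom E (Ter X n) (Ter Y (n - 1)) \<and>
        f n = Add E (g n)
          (Add E (Dif Y (n - 1) \<cdot>\<^bsub>E\<^esub> h n) (h (n + 1) \<cdot>\<^bsub>E\<^esub> Dif X n)))"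

definition htpy_class ::
  "('o, 'a, 'z) addcat_scheme \<Rightarrow> ('o, 'a) cpx \<Rightarrow> ('o, 'a) cpx \<Rightarrow>
     (int \<Rightarrow> 'a) \<Rightarrow> (int \<Rightarrow> 'a) set" where
  "htpy_class E X Y f = {g \<in> chain_maps E X Y. homotopic E X Y f g}"

definition shift_cpx :: "('o, 'a, 'z) addcat_scheme \<Rightarrow> ('o, 'a) cpx \<Rightarrow> ('o, 'a) cpx" where
  "shift_cpx E X = \<lparr>Ter = (\<lambda>n. Ter X (n + 1)), Dif = (\<lambda>n. Neg E (Dif X (n + 1)))\<rparr>"

type_synonym ('o, 'a) htpy_arr = "('o, 'a) cpx \<times> ('o, 'a) cpx \<times> (int \<Rightarrow> 'a) set"

definition homotopy_shiftcat ::
  "('o, 'a, 'z) addcat_scheme \<Rightarrow> (('o, 'a) cpx, ('o, 'a) htpy_arr) shiftcat" where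
  "homotopy_shiftcat E =
    \<lparr>Obj = {X. is_complex E X},
     Arr = {(X, Y, htpy_class E X Y f) | X Y f.
              is_complex E X \<and> is_complex E Y \<and> f \<in> chain_maps E X Y},
     Dom = (\<lambda>(X, Y, F). X),
     Cod = (\<lambda>(X, Y, F). Y),
     Ide = (\<lambda>X. (X, X, htpy_class E X X (\<lambda>n. Ide E (Ter X n)))),
     Comp = (\<lambda>(Y', Z, G) (X, Y, F).
       (X, Z, \<Union>g \<in> G. \<Union>f \<in> F. htpy_class E X Z (\<lambda>n. g n \<cdot>\<^bsub>E\<^esub> f n))),
     Add = (\<lambda>(X, Y, F) (X', Y', G).
       (X, Y, \<Union>f \<in> F. \<Union>g \<in> G. htpy_class E X Y (\<lambda>n. Add E (f n) (g n)))),
     Zero = (\<lambda>X Y. (X, Y, htpy_class E X Y (\<lambda>n. Zero E (Ter X n) (Ter Y n)))),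
     Sh = shift_cpx E,
     ShA = (\<lambda>(X, Y, F). (shift_cpx E X, shift_cpx E Y,
       \<Union>f \<in> F. htpy_class E (shift_cpx E X) (shift_cpx E Y) (\<lambda>n. f (n + 1))))\<rparr>"

text \<open>The cone of \<open>f : X \<rightarrow> Y\<close> has terms \<open>X (n + 1) \<oplus> Y n\<close> and differential given by the matrix
  with rows \<open>(-d, 0)\<close> and \<open>(f, d)\<close>.\<close>

definition cone_biprod ::
  "('o, 'a, 'z) addcat_scheme \<Rightarrow> ('o, 'a) cpx \<Rightarrow> ('o, 'a) cpx \<Rightarrow> int \<Rightarrow>
     'o \<times> 'a \<times> 'a \<times> 'a \<times> 'a" where
  "cone_biprod E X Y n = biprod E (Ter X (n + 1)) (Ter Y n)"

definition cone ::
  "('o, 'a, 'z) addcat_scheme \<Rightarrow> ('o, 'a) cpx \<Rightarrow> ('o, 'a) cpx \<Rightarrow> (int \<Rightarrow> 'a) \<Rightarrow>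
     ('o, 'a) cpx" where
  "cone E X Y f =
    \<lparr>Ter = (\<lambda>n. fst (cone_biprod E X Y n)),
     Dif = (\<lambda>n.
       let (S, i\<^sub>1, i\<^sub>2, p\<^sub>1, p\<^sub>2) = cone_biprod E X Y n;
           (S', j\<^sub>1, j\<^sub>2, q\<^sub>1, q\<^sub>2) = cone_biprod E X Y (n + 1)
       in Add E (j\<^sub>1 \<cdot>\<^bsub>E\<^esub> Neg E (Dif X (n + 1)) \<cdot>\<^bsub>E\<^esub> p\<^sub>1)
            (Add E (j\<^sub>2 \<cdot>\<^bsub>E\<^esub> f (n + 1) \<cdot>\<^bsub>E\<^esub> p\<^sub>1) (j\<^sub>2 \<cdot>\<^bsub>E\<^esub> Dif Y n \<cdot>\<^bsub>E\<^esub> p\<^sub>2)))\<rparr>"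

definition cone_in ::
  "('o, 'a, 'z) addcat_scheme \<Rightarrow> ('o, 'a) cpx \<Rightarrow> ('o, 'a) cpx \<Rightarrow> int \<Rightarrow> 'a" where
  "cone_in E X Y n = (case cone_biprod E X Y n of (S, i\<^sub>1, i\<^sub>2, p\<^sub>1, p\<^sub>2) \<Rightarrow> i\<^sub>2)"

definition cone_out ::
  "('o, 'a, 'z) addcat_scheme \<Rightarrow> ('o, 'a) cpx \<Rightarrow> ('o, 'a) cpx \<Rightarrow> int \<Rightarrow> 'a" where
  "cone_out E X Y n = (case cone_biprod E X Y n of (S, i\<^sub>1, i\<^sub>2, p\<^sub>1, p\<^sub>2) \<Rightarrow> p\<^sub>1)"

definition standard_triangle ::
  "('o, 'a, 'z) addcat_scheme \<Rightarrow> ('o, 'a) cpx \<Rightarrow> ('o, 'a) cpx \<Rightarrow> (int \<Rightarrow> 'a) \<Rightarrow>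
     ('o, 'a) htpy_arr \<times> ('o, 'a) htpy_arr \<times> ('o, 'a) htpy_arr" where
  "standard_triangle E X Y f =
     ((X, Y, htpy_class E X Y f),
      (Y, cone E X Y f, htpy_class E Y (cone E X Y f) (cone_in E X Y)),
      (cone E X Y f, shift_cpx E X, htpy_class E (cone E X Y f) (shift_cpx E X) (cone_out E X Y)))"

definition homotopy_category ::
  "('o, 'a, 'z) addcat_scheme \<Rightarrow> (('o, 'a) cpx, ('o, 'a) htpy_arr) tricat" where
  "homotopy_category E = with_triangles (homotopy_shiftcat E)
     {standard_triangle E X Y f | X Y f.
        is_complex E X \<and> is_complex E Y \<and> f \<in> chain_maps E X Y}"


section \<open>The derived category\<close>

definition acyclic_complex :: "('o, 'a, 'z) conflcat_scheme \<Rightarrow> ('o, 'a) cpx \<Rightarrow> bool" where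
  "acyclic_complex E X \<longleftrightarrow> is_complex E X \<and>
     (\<forall>n. \<exists>p i. deflation E p \<and> is_cokernel E p (Dif X (n - 2)) \<and>
        inflation E i \<and> is_kernel E i (Dif X n) \<and>
        Cod E p = Dom E i \<and> Dif X (n - 1) = i \<cdot>\<^bsub>E\<^esub> p)"

type_synonym ('o, 'a) derived_arr =
  "('o, 'a) cpx \<times> ('o, 'a) cpx \<times> (('o, 'a) htpy_arr \<times> ('o, 'a) htpy_arr) set"

definition derived_category ::
  "('o, 'a, 'z) conflcat_scheme \<Rightarrow> (('o, 'a) cpx, ('o, 'a) derived_arr) tricat" where
  "derived_category E = verdier_quotient (homotopy_category E)
     (thick_closure (homotopy_category E) {X. acyclic_complex E X})"


section \<open>Truncations\<close>

text \<open>\<open>trunc_le E n X\<close> has \<open>ker (Dif X n)\<close> in degree \<open>n\<close>. The arrow \<open>trunc_arr E n X\<close> is the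
  factorization of \<open>Dif X (n - 1)\<close> through that kernel.\<close>

definition trunc_arr :: "('o, 'a, 'z) addcat_scheme \<Rightarrow> int \<Rightarrow> ('o, 'a) cpx \<Rightarrow> 'a" where
  "trunc_arr E n X =
     (THE p. p \<in> Hom E (Ter X (n - 1)) (Dom E (ker_arr E (Dif X n))) \<and>
        ker_arr E (Dif X n) \<cdot>\<^bsub>E\<^esub> p = Dif X (n - 1))"

definition trunc_le :: "('o, 'a, 'z) addcat_scheme \<Rightarrow> int \<Rightarrow> ('o, 'a) cpx \<Rightarrow> ('o, 'a) cpx" where
  "trunc_le E n X =
    (let T = (\<lambda>m. if m < n then Ter X m
                  else if m = n then Dom E (ker_arr E (Dif X n)) else zero_object E)
     in \<lparr>Ter = T,
         Dif = (\<lambda>m. if m < n - 1 then Dif X m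
                    else if m = n - 1 then trunc_arr E n X else Zero E (T m) (T (m + 1)))\<rparr>)"

text \<open>\<open>trunc_ge E m X\<close> has \<open>ker (Dif X (m - 1))\<close> in degree \<open>m - 2\<close>, and agrees with \<open>X\<close> in
  degrees \<open>m - 1\<close> and above.\<close>

definition trunc_ge :: "('o, 'a, 'z) addcat_scheme \<Rightarrow> int \<Rightarrow> ('o, 'a) cpx \<Rightarrow> ('o, 'a) cpx" where
  "trunc_ge E m X =
    (let n = m - 1;
         T = (\<lambda>j. if j \<ge> n then Ter X j
                  else if j = n - 1 then Dom E (ker_arr E (Dif X n)) else zero_object E)
     in \<lparr>Ter = T,
         Dif = (\<lambda>j. if j \<ge> n then Dif X j
                    else if j = n - 1 then ker_arr E (Dif X n) else Zero E (T j) (T (j + 1)))\<rparr>)"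

definition D_le0 :: "('o, 'a, 'z) conflcat_scheme \<Rightarrow> ('o, 'a) cpx set" where
  "D_le0 E = {X \<in> Obj (derived_category E).
     isomorphic_to_zero (derived_category E) (trunc_ge E 1 X)}"

definition D_ge0 :: "('o, 'a, 'z) conflcat_scheme \<Rightarrow> ('o, 'a) cpx set" where
  "D_ge0 E = {X \<in> Obj (derived_category E).
     isomorphic_to_zero (derived_category E) (trunc_le E (-1) X)}"


section \<open>t-structures\<close>

text \<open>\<open>U\<close> and \<open>V\<close> are the object sets of the strictly full subcategories in degrees \<open>\<le> 0\<close> and
  \<open>\<ge> 0\<close>. The subcategory \<open>V[-1]\<close> in degrees \<open>\<ge> 1\<close> is \<open>{Y. Y[1] \<in> V}\<close>.\<close>

locale t_structure =
  fixes T :: "('o, 'a, 'z) tricat_scheme" and U V :: "'o set"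
  assumes U_iso_closed: "iso_closed T U"
    and V_iso_closed: "iso_closed T V"
    and U_shift: "X \<in> U \<Longrightarrow> Sh T X \<in> U"
    and V_shift: "\<lbrakk>Y \<in> Obj T; Sh T Y \<in> V\<rbrakk> \<Longrightarrow> Y \<in> V"
    and Hom_zero: "\<lbrakk>X \<in> U; Y \<in> Obj T; Sh T Y \<in> V\<rbrakk> \<Longrightarrow> Hom T X Y = {Zero T X Y}"
    and truncation: "X \<in> Obj T \<Longrightarrow>
          \<exists>u v w. (u, v, w) \<in> Tri T \<and> Dom T u \<in> U \<and> Cod T u = X \<and>
            Cod T v \<in> Obj T \<and> Sh T (Cod T v) \<in> V"

end

theory Submission
  imports Defs "HOL-Algebra.FiniteProduct" "HOL-Algebra.Multiplicative_Group" "HOL-Library.Function_Algebras"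
begin

text \<open>The deflations are the coverings of a topology on \<open>E\<close>. Call a complex exact at \<open>n\<close> if every
  morphism into the \<open>n\<close>-th term that is killed by the differential lifts to the \<open>(n - 1)\<close>-st term after
  restriction along a deflation, that is, if the \<open>n\<close>-th cohomology sheaf vanishes. Because of (R3) and
  the existence of kernels, a complex is acyclic iff it is exact everywhere. Exactness at \<open>n\<close> passes to
  retracts and cones in the homotopy category, so the acyclic complexes are already thick, and the
  denominators are the chain maps that induce isomorphisms on cohomology sheaves.

  A chain map \<open>f : X \<rightarrow> Y\<close> to an acyclic complex becomes null-homotopic on its cocone, and the projection
  of the cocone to \<open>X\<close> is a quasi-isomorphism. This gives the calculus of fractions, and it shows that a
  complex vanishes in the derived category iff it is acyclic. Hence the two halves of the t-structure
  are the complexes that are exact in degrees \<open>\<ge> 1\<close>, respectively \<open>\<le> -1\<close>.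

  Orthogonality: a complex that is exact in degrees \<open>\<ge> 1\<close> is quasi-isomorphic to its truncation \<open>\<tau>\<^sup>\<le>\<^sup>0\<close>,
  and a map from that truncation to \<open>Y\<close> factors through \<open>\<tau>\<^sup>\<le>\<^sup>0 Y\<close>, which is acyclic if \<open>Y\<close> is
  exact in degrees \<open>\<le> 0\<close>. The truncation triangle is the standard triangle of \<open>\<tau>\<^sup>\<le>\<^sup>0 X \<rightarrow> X\<close>.\<close>

section \<open>Categories\<close>

text \<open>Sheaves are never formed. A section of a cohomology sheaf is represented by a cocycle
  \<open>x : A \<rightarrow> Ter X n\<close>, and every sheaf statement is unfolded into one about
  such generalized elements; each step may cost a further cover, which (R1) composes with the
  earlier ones. This replaces cohomology objects, whose formation would call for cokernels. The map
  induced on the \<open>n\<close>-th sheaves is split into \<open>H_surj\<close> and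
  \<open>H_inj\<close> because the two halves occur in different degrees: exactness of a cone at
  \<open>n\<close> combines surjectivity at \<open>n\<close> with injectivity at
  \<open>n + 1\<close>, and the inclusion of a truncation is injective in all degrees while its
  surjectivity is shown up to the cut. Cocones drive the localization because the roofs of the
  quotient carry their denominators on the source side. Since the quotient consists of concrete
  classes of roofs with operations defined by unions, even its category laws rest on Ore squares and
  equalizing denominators.\<close>

context category
begin

abbreviation arr where "arr f \<equiv> f \<in> Arr C"
abbreviation dom where "dom f \<equiv> Dom C f"
abbreviation cod where "cod f \<equiv> Cod C f"

lemma HomD: "f \<in> Hom C X Y \<Longrightarrow> arr f \<and> dom f = X \<and> cod f = Y"
  by (simp add: Hom_def)

lemma HomI: "arr f \<Longrightarrow> f \<in> Hom C (dom f) (cod f)"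
  by (simp add: Hom_def)

lemma Hom_Obj: "f \<in> Hom C X Y \<Longrightarrow> X \<in> Obj C \<and> Y \<in> Obj C"
  using Dom_Obj Cod_Obj by (auto simp: Hom_def)

lemma Ide_Arr [simp]: "X \<in> Obj C \<Longrightarrow> arr (Ide C X)"
  and Dom_Ide [simp]: "X \<in> Obj C \<Longrightarrow> dom (Ide C X) = X"
  and Cod_Ide [simp]: "X \<in> Obj C \<Longrightarrow> cod (Ide C X) = X"
  using Ide_Hom[of X] by (auto simp: Hom_def)

lemma Comp_typing:
  assumes "arr f" "arr g" "dom g = cod f"
  shows Comp_Arr [simp]: "arr (g \<cdot>\<^bsub>C\<^esub> f)"
    and Dom_Comp [simp]: "dom (g \<cdot>\<^bsub>C\<^esub> f) = dom f"
    and Cod_Comp [simp]: "cod (g \<cdot>\<^bsub>C\<^esub> f) = cod g"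
  using Comp_Hom[of f "dom f" "cod f" g "cod g"] assms by (auto simp: Hom_def)

lemma Comp_Ide_eq [simp]: "\<lbrakk>arr f; dom f = X\<rbrakk> \<Longrightarrow> f \<cdot>\<^bsub>C\<^esub> Ide C X = f"
  using Comp_Ide[of f X "cod f"] by (simp add: Hom_def)

lemma Ide_Comp_eq [simp]: "\<lbrakk>arr f; cod f = Y\<rbrakk> \<Longrightarrow> Ide C Y \<cdot>\<^bsub>C\<^esub> f = f"
  using Ide_Comp[of f "dom f" Y] by (simp add: Hom_def)

lemma Comp_assoc_eq [simp]:
  "\<lbrakk>arr f; arr g; arr h; dom g = cod f; dom h = cod g\<rbrakk>
    \<Longrightarrow> (h \<cdot>\<^bsub>C\<^esub> g) \<cdot>\<^bsub>C\<^esub> f = h \<cdot>\<^bsub>C\<^esub> (g \<cdot>\<^bsub>C\<^esub> f)"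
  using Comp_assoc[of f "dom f" "cod f" g "cod g" h "cod h"] by (simp add: Hom_def)

lemma Arr_Obj [simp]: "arr f \<Longrightarrow> dom f \<in> Obj C" "arr f \<Longrightarrow> cod f \<in> Obj C"
  using Dom_Obj Cod_Obj by auto

text \<open>The simplifier brackets composites to the right, so an equation between composites of
  two arrows does not match inside a longer composite. This supplies the precomposed equation;
  \<open>precomp_eq\<close> does the same when the right-hand side is a single arrow.\<close>

lemma Comp_cong_left:
  assumes "a \<cdot>\<^bsub>C\<^esub> b = c \<cdot>\<^bsub>C\<^esub> d" "arr a" "arr b" "arr c" "arr d" "arr x"
    "dom a = cod b" "dom c = cod d" "cod x = dom b"
  shows "a \<cdot>\<^bsub>C\<^esub> (b \<cdot>\<^bsub>C\<^esub> x) = c \<cdot>\<^bsub>C\<^esub> (d \<cdot>\<^bsub>C\<^esub> x)"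
proof -
  have d: "dom d = dom b"
    using Dom_Comp[of b a] Dom_Comp[of d c] assms by simp
  have "a \<cdot>\<^bsub>C\<^esub> (b \<cdot>\<^bsub>C\<^esub> x) = (a \<cdot>\<^bsub>C\<^esub> b) \<cdot>\<^bsub>C\<^esub> x" using assms(2-) by simp
  also have "\<dots> = (c \<cdot>\<^bsub>C\<^esub> d) \<cdot>\<^bsub>C\<^esub> x" by (simp only: assms(1))
  also have "\<dots> = c \<cdot>\<^bsub>C\<^esub> (d \<cdot>\<^bsub>C\<^esub> x)" using assms d by simp
  finally show ?thesis .
qed

lemma precomp_eq:
  assumes "x \<cdot>\<^bsub>C\<^esub> a = y" "arr x" "arr a" "arr c" "dom x = cod a" "cod c = dom a"
  shows "x \<cdot>\<^bsub>C\<^esub> (a \<cdot>\<^bsub>C\<^esub> c) = y \<cdot>\<^bsub>C\<^esub> c"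
  using Comp_assoc_eq[of c a x] assms(2-) unfolding assms(1) by simp

lemma iso_arr_Ide: "X \<in> Obj C \<Longrightarrow> iso_arr C (Ide C X)"
  by (auto simp: iso_arr_def Hom_def intro!: bexI[of _ "Ide C X"])

lemma isomorphicE:
  assumes "isomorphic C X Y"
  obtains f g where "f \<in> Hom C X Y" "g \<in> Hom C Y X" "g \<cdot>\<^bsub>C\<^esub> f = Ide C X" "f \<cdot>\<^bsub>C\<^esub> g = Ide C Y"
  using assms by (auto simp: isomorphic_def iso_arr_def Hom_def)

lemma isomorphicI:
  assumes "f \<in> Hom C X Y" "g \<in> Hom C Y X" "g \<cdot>\<^bsub>C\<^esub> f = Ide C X" "f \<cdot>\<^bsub>C\<^esub> g = Ide C Y"
  shows "isomorphic C X Y"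
  using assms by (auto simp: isomorphic_def iso_arr_def Hom_def intro!: bexI[of _ f] bexI[of _ g])

lemma isomorphic_sym: "isomorphic C X Y \<Longrightarrow> isomorphic C Y X"
  by (auto elim!: isomorphicE intro: isomorphicI)

text \<open>Both endomorphisms agree after \<open>g : Z \<rightarrow> X\<close>, since
  \<open>Z\<close> has only one arrow to \<open>X\<close>, and precomposing with \<open>f\<close>
  removes \<open>g\<close>. Applied to the identity and the zero endomorphism, this turns the
  vanishing of an object into an equation of arrows.\<close>

lemma isomorphic_to_zero_endo_unique:
  assumes "isomorphic_to_zero C X" "a \<in> Hom C X X" "b \<in> Hom C X X"
  shows "a = b"
proof -
  obtain Z where Z: "zero_obj C Z" and "isomorphic C X Z"
    using assms by (auto simp: isomorphic_to_zero_def)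
  then obtain f g where f: "f \<in> Hom C X Z" and g: "g \<in> Hom C Z X" and gf: "g \<cdot>\<^bsub>C\<^esub> f = Ide C X"
    by (auto elim: isomorphicE)
  have X: "X \<in> Obj C" using assms Hom_Obj by blast
  have uniq: "h = h'" if "h \<in> Hom C Z X" "h' \<in> Hom C Z X" for h h'
    using Z X that by (auto simp: zero_obj_def)
  have "a \<cdot>\<^bsub>C\<^esub> g = b \<cdot>\<^bsub>C\<^esub> g" using uniq Comp_Hom assms g by blast
  hence "(a \<cdot>\<^bsub>C\<^esub> g) \<cdot>\<^bsub>C\<^esub> f = (b \<cdot>\<^bsub>C\<^esub> g) \<cdot>\<^bsub>C\<^esub> f" by simp
  thus ?thesis using assms f g gf by (simp add: Hom_def)
qed

end

section \<open>Additive categories\<close>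

context additive_category
begin

abbreviation comp (infixr \<open>\<star>\<close> 70) where "g \<star> f \<equiv> g \<cdot>\<^bsub>C\<^esub> f"

lemma Zero_Hom: "\<lbrakk>X \<in> Obj C; Y \<in> Obj C\<rbrakk> \<Longrightarrow> Zero C X Y \<in> Hom C X Y"
  using comm_group.axioms(2)[OF Hom_comm_group, THEN group.axioms(1), THEN monoid.one_closed, of X Y]
  by (simp add: hom_group_def)

lemma Add_Hom: "\<lbrakk>f \<in> Hom C X Y; g \<in> Hom C X Y\<rbrakk> \<Longrightarrow> Add C f g \<in> Hom C X Y"
  using comm_group.axioms(2)[OF Hom_comm_group, THEN group.axioms(1), THEN monoid.m_closed, of X Y f g]
    Hom_Obj[of f X Y]
  by (simp add: hom_group_def)

lemma Neg_Hom: "f \<in> Hom C X Y \<Longrightarrow> Neg C f \<in> Hom C X Y"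
  using comm_group.axioms(2)[OF Hom_comm_group, THEN group.inv_closed, of X Y f] Hom_Obj[of f X Y]
  by (simp add: hom_group_def Neg_def Hom_def)

lemma Zero_typing [simp]:
  assumes "X \<in> Obj C" "Y \<in> Obj C"
  shows "arr (Zero C X Y)" "dom (Zero C X Y) = X" "cod (Zero C X Y) = Y"
  using Zero_Hom[OF assms] by (auto simp: Hom_def)

lemma Add_typing [simp]:
  assumes "arr f" "arr g" "dom g = dom f" "cod g = cod f"
  shows "arr (Add C f g)" "dom (Add C f g) = dom f" "cod (Add C f g) = cod f"
  using Add_Hom[of f "dom f" "cod f" g] assms by (auto simp: Hom_def)

lemma Neg_typing [simp]:
  assumes "arr f"
  shows "arr (Neg C f)" "dom (Neg C f) = dom f" "cod (Neg C f) = cod f"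
  using Neg_Hom[of f "dom f" "cod f"] assms by (auto simp: Hom_def)

lemma Add_assoc:
  "\<lbrakk>f \<in> Hom C X Y; g \<in> Hom C X Y; h \<in> Hom C X Y\<rbrakk> \<Longrightarrow> Add C (Add C f g) h = Add C f (Add C g h)"
  using comm_group.axioms(2)[OF Hom_comm_group, THEN group.axioms(1), THEN monoid.m_assoc, of X Y f g h]
    Hom_Obj[of f X Y]
  by (simp add: hom_group_def)

lemma Add_commute: "\<lbrakk>f \<in> Hom C X Y; g \<in> Hom C X Y\<rbrakk> \<Longrightarrow> Add C f g = Add C g f"
  using comm_monoid.m_comm[OF comm_group.axioms(1)[OF Hom_comm_group], of X Y f g] Hom_Obj[of f X Y]
  by (simp add: hom_group_def)

lemma Zero_Add [simp]: "\<lbrakk>arr f; dom f = X; cod f = Y\<rbrakk> \<Longrightarrow> Add C (Zero C X Y) f = f"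
  using comm_group.axioms(2)[OF Hom_comm_group, THEN group.axioms(1), THEN monoid.l_one, of X Y f]
  by (auto simp: hom_group_def Hom_def)

lemma Add_Zero [simp]: "\<lbrakk>arr f; dom f = X; cod f = Y\<rbrakk> \<Longrightarrow> Add C f (Zero C X Y) = f"
  using comm_group.axioms(2)[OF Hom_comm_group, THEN group.axioms(1), THEN monoid.r_one, of X Y f]
  by (auto simp: hom_group_def Hom_def)

lemma Add_Neg [simp]: "arr f \<Longrightarrow> Add C f (Neg C f) = Zero C (dom f) (cod f)"
  using comm_group.axioms(2)[OF Hom_comm_group, THEN group.r_inv, of "dom f" "cod f" f]
  by (auto simp: hom_group_def Hom_def Neg_def)

lemma Neg_Add [simp]: "arr f \<Longrightarrow> Add C (Neg C f) f = Zero C (dom f) (cod f)"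
  using comm_group.axioms(2)[OF Hom_comm_group, THEN group.l_inv, of "dom f" "cod f" f]
  by (auto simp: hom_group_def Hom_def Neg_def)

lemma Neg_unique:
  assumes "f \<in> Hom C X Y" "g \<in> Hom C X Y" "Add C f g = Zero C X Y"
  shows "g = Neg C f"
proof -
  have "g = Add C (Add C (Neg C f) f) g" using assms by (simp add: Hom_def)
  also have "\<dots> = Add C (Neg C f) (Add C f g)" using Add_assoc assms Neg_Hom by blast
  also have "\<dots> = Neg C f" using assms by (simp add: Hom_def)
  finally show ?thesis .
qed

lemma Neg_Neg [simp]: "arr f \<Longrightarrow> Neg C (Neg C f) = f"
  using Neg_unique[of "Neg C f" "dom f" "cod f" f] by (simp add: Hom_def)

lemma Neg_Zero [simp]: "\<lbrakk>X \<in> Obj C; Y \<in> Obj C\<rbrakk> \<Longrightarrow> Neg C (Zero C X Y) = Zero C X Y"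
  using Neg_unique[of "Zero C X Y" X Y "Zero C X Y"] by (simp add: Hom_def)

lemma Comp_Add_eq [simp]:
  "\<lbrakk>arr f; arr f'; arr g; dom f' = dom f; cod f' = cod f; dom g = cod f\<rbrakk>
    \<Longrightarrow> g \<star> Add C f f' = Add C (g \<star> f) (g \<star> f')"
  using Comp_Add[of f "dom f" "cod f" f' g "cod g"] by (simp add: Hom_def)

lemma Add_Comp_eq [simp]:
  "\<lbrakk>arr f; arr g'; arr g; dom g' = dom g; cod g' = cod g; dom g = cod f\<rbrakk>
    \<Longrightarrow> Add C g g' \<star> f = Add C (g \<star> f) (g' \<star> f)"
  using Add_Comp[of f "dom f" "cod f" g "cod g" g'] by (simp add: Hom_def)

text \<open>Cancellation of one summand. It turns bilinearity of composition into the absorption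
  laws \<open>Comp_Zero\<close> and \<open>Zero_Comp\<close>.\<close>

lemma Add_idem_Zero:
  assumes "f \<in> Hom C X Y" "Add C f f = f"
  shows "f = Zero C X Y"
proof -
  have "Add C (Add C f f) (Neg C f) = Add C f (Add C f (Neg C f))"
    using Add_assoc assms Neg_Hom by blast
  thus ?thesis using assms by (simp add: Hom_def)
qed

lemma Comp_Zero [simp]:
  assumes "arr g" "dom g = Y" "X \<in> Obj C"
  shows "g \<star> Zero C X Y = Zero C X (cod g)"
proof (rule Add_idem_Zero)
  have Y: "Y \<in> Obj C" using assms by auto
  show "g \<star> Zero C X Y \<in> Hom C X (cod g)" using assms Y by (simp add: Hom_def)
  show "Add C (g \<star> Zero C X Y) (g \<star> Zero C X Y) = g \<star> Zero C X Y"
    using Comp_Add_eq[of "Zero C X Y" "Zero C X Y" g] assms Y by simp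
qed

lemma Zero_Comp [simp]:
  assumes "arr f" "cod f = Y" "Z \<in> Obj C"
  shows "Zero C Y Z \<star> f = Zero C (dom f) Z"
proof (rule Add_idem_Zero)
  have Y: "Y \<in> Obj C" using assms by auto
  show "Zero C Y Z \<star> f \<in> Hom C (dom f) Z" using assms Y by (simp add: Hom_def)
  show "Add C (Zero C Y Z \<star> f) (Zero C Y Z \<star> f) = Zero C Y Z \<star> f"
    using Add_Comp_eq[of f "Zero C Y Z" "Zero C Y Z"] assms Y by simp
qed

lemma Comp_Neg [simp]:
  assumes "arr f" "arr g" "dom g = cod f"
  shows "g \<star> Neg C f = Neg C (g \<star> f)"
  using assms Comp_Add_eq[of f "Neg C f" g]
  by (intro Neg_unique[of _ "dom f" "cod g"]) (auto simp: Hom_def)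

lemma Neg_Comp [simp]:
  assumes "arr f" "arr g" "dom g = cod f"
  shows "Neg C g \<star> f = Neg C (g \<star> f)"
  using assms Add_Comp_eq[of f "Neg C g" g]
  by (intro Neg_unique[of _ "dom f" "cod g"]) (auto simp: Hom_def)

text \<open>Equations between sums in a group of morphisms are proved in the free abelian group
  \<open>nat \<Rightarrow> int\<close> on the summands, where the simplifier knows the group laws.\<close>

lemma linear_combinations:
  fixes n :: nat
  assumes "X \<in> Obj C" "Y \<in> Obj C" and a: "\<And>i. i < n \<Longrightarrow> a i \<in> Hom C X Y"
  obtains \<phi> :: "(nat \<Rightarrow> int) \<Rightarrow> 'a" and e :: "nat \<Rightarrow> nat \<Rightarrow> int"
  where "\<And>u. \<phi> u \<in> Hom C X Y" "\<And>u v. Add C (\<phi> u) (\<phi> v) = \<phi> (u + v)"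
    "\<And>u. Neg C (\<phi> u) = \<phi> (- u)" "\<phi> 0 = Zero C X Y" "\<And>i. i < n \<Longrightarrow> \<phi> (e i) = a i"
proof -
  define G where "G = hom_group C X Y"
  interpret G: comm_group G using Hom_comm_group assms by (simp add: G_def)
  have carrier: "carrier G = Hom C X Y" and mult: "monoid.mult G = Add C" and one: "\<one>\<^bsub>G\<^esub> = Zero C X Y"
    by (simp_all add: G_def hom_group_def)
  \<comment> \<open>The group is written multiplicatively: this product of powers is the integral
    combination of the \<open>a i\<close> with coefficients \<open>u i\<close>, and
    \<open>e i\<close> below is the \<open>i\<close>-th unit vector.\<close>
  define \<phi> where "\<phi> u = (\<Otimes>\<^bsub>G\<^esub>i\<in>{..<n}. a i [^]\<^bsub>G\<^esub> (u i :: int))" for u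
  define e where "e i = (\<lambda>j. if j = i then 1 else 0 :: int)" for i :: nat
  have a': "a i \<in> carrier G" if "i < n" for i using a that carrier by simp
  have closed: "\<phi> u \<in> carrier G" for u
    unfolding \<phi>_def by (rule G.finprod_closed) (auto intro: a')
  have add: "Add C (\<phi> u) (\<phi> v) = \<phi> (u + v)" for u v
  proof -
    have "\<phi> (u + v) = (\<Otimes>\<^bsub>G\<^esub>i\<in>{..<n}. a i [^]\<^bsub>G\<^esub> u i \<otimes>\<^bsub>G\<^esub> a i [^]\<^bsub>G\<^esub> v i)"
      unfolding \<phi>_def by (rule G.finprod_cong') (auto simp: G.int_pow_mult a' intro!: a')
    also have "\<dots> = \<phi> u \<otimes>\<^bsub>G\<^esub> \<phi> v"
      unfolding \<phi>_def by (rule G.finprod_multf) (auto intro: a')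
    finally show ?thesis by (simp add: mult)
  qed
  have zero: "\<phi> 0 = Zero C X Y"
    unfolding \<phi>_def by (simp add: one[symmetric])
  have unit: "\<phi> (e i) = a i" if "i < n" for i
  proof -
    have "\<phi> (e i) = (\<Otimes>\<^bsub>G\<^esub>j\<in>{..<n}. if i = j then a j else \<one>\<^bsub>G\<^esub>)"
      unfolding \<phi>_def e_def by (rule G.finprod_cong') (auto simp: a' intro!: a')
    also have "\<dots> = a i" using G.finprod_singleton[of i "{..<n}" a] that a' by auto
    finally show ?thesis .
  qed
  have neg: "Neg C (\<phi> u) = \<phi> (- u)" for u
    using Neg_unique[of "\<phi> u" X Y "\<phi> (- u)"] closed carrier add zero by simp
  show ?thesis using that[of \<phi> e] closed carrier add neg zero unit by simp
qed

text \<open>The form in which the free group is used: each summand is some \<open>\<phi> u\<close>,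
  so an identity of sums reduces to one between functions \<open>nat \<Rightarrow> int\<close>.
  Nonemptiness of \<open>A\<close> guarantees that \<open>X\<close> and \<open>Y\<close> are
  objects.\<close>

lemma generated_by_summands:
  assumes "finite A" "A \<noteq> {}" "A \<subseteq> Hom C X Y"
  shows "\<exists>\<phi> :: (nat \<Rightarrow> int) \<Rightarrow> 'a. (\<forall>u v. Add C (\<phi> u) (\<phi> v) = \<phi> (u + v)) \<and>
    (\<forall>u. Neg C (\<phi> u) = \<phi> (- u)) \<and> \<phi> 0 = Zero C X Y \<and> A \<subseteq> range \<phi>"
proof -
  obtain xs where xs: "set xs = A" using finite_list assms(1) by blast
  have XY: "X \<in> Obj C" "Y \<in> Obj C" using assms Hom_Obj by blast+
  have "xs ! i \<in> Hom C X Y" if "i < length xs" for i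
    using assms xs that nth_mem by blast
  then obtain \<phi> :: "(nat \<Rightarrow> int) \<Rightarrow> 'a" and e :: "nat \<Rightarrow> nat \<Rightarrow> int"
  where \<phi>: "\<And>u. \<phi> u \<in> Hom C X Y" "\<And>u v. Add C (\<phi> u) (\<phi> v) = \<phi> (u + v)"
    "\<And>u. Neg C (\<phi> u) = \<phi> (- u)" "\<phi> 0 = Zero C X Y" "\<And>i. i < length xs \<Longrightarrow> \<phi> (e i) = xs ! i"
    using linear_combinations[OF XY, where n = "length xs" and a = "(!) xs"] by metis
  have "A \<subseteq> range \<phi>"
    unfolding xs[symmetric] using \<phi>(5) by (metis in_set_conv_nth rangeI subsetI)
  then show ?thesis using \<phi>(2-4) by blast
qed

text \<open>With \<open>a\<close> and \<open>b\<close> the two halves of a boundary this gives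
  symmetry of homotopy, and \<open>Add_sum_trans\<close> gives transitivity. The halves stay
  separate so that each is again of the form demanded of a homotopy.\<close>

lemma Add_sum_sym:
  assumes "g \<in> Hom C X Y" "a \<in> Hom C X Y" "b \<in> Hom C X Y" "f = Add C g (Add C a b)"
  shows "g = Add C f (Add C (Neg C a) (Neg C b))"
proof -
  obtain \<phi> :: "(nat \<Rightarrow> int) \<Rightarrow> 'a" where \<phi>: "\<And>u v. Add C (\<phi> u) (\<phi> v) = \<phi> (u + v)"
    "\<And>u. Neg C (\<phi> u) = \<phi> (- u)" and "{g, a, b} \<subseteq> range \<phi>"
    using generated_by_summands[of "{g, a, b}" X Y] assms(1-3) by auto
  then obtain g' a' b' where "g = \<phi> g'" "a = \<phi> a'" "b = \<phi> b'" by auto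
  then show ?thesis using \<phi> assms(4) by simp
qed

lemma Add_sum_trans:
  assumes "k \<in> Hom C X Y" "a \<in> Hom C X Y" "b \<in> Hom C X Y" "a' \<in> Hom C X Y" "b' \<in> Hom C X Y"
    "f = Add C g (Add C a b)" "g = Add C k (Add C a' b')"
  shows "f = Add C k (Add C (Add C a' a) (Add C b' b))"
proof -
  obtain \<phi> :: "(nat \<Rightarrow> int) \<Rightarrow> 'a" where \<phi>: "\<And>u v. Add C (\<phi> u) (\<phi> v) = \<phi> (u + v)"
    "\<And>u. Neg C (\<phi> u) = \<phi> (- u)" and "{k, a, b, a', b'} \<subseteq> range \<phi>"
    using generated_by_summands[of "{k, a, b, a', b'}" X Y] assms(1-5) by auto
  then obtain r s t u v where "k = \<phi> r" "a = \<phi> s" "b = \<phi> t" "a' = \<phi> u" "b' = \<phi> v" by auto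
  then show ?thesis using \<phi> assms(6,7) by (simp add: ac_simps)
qed

lemma Add_Neg_eq:
  assumes "u \<in> Hom C A B" "v \<in> Hom C A B" "w \<in> Hom C A B" "u = Add C v w"
  shows "Add C u (Neg C v) = w"
proof -
  obtain \<phi> :: "(nat \<Rightarrow> int) \<Rightarrow> 'a" where \<phi>: "\<And>u v. Add C (\<phi> u) (\<phi> v) = \<phi> (u + v)"
    "\<And>u. Neg C (\<phi> u) = \<phi> (- u)" and "{v, w} \<subseteq> range \<phi>"
    using generated_by_summands[of "{v, w}" A B] assms(2,3) by auto
  then obtain v' w' where "v = \<phi> v'" "w = \<phi> w'" by auto
  then show ?thesis using \<phi> assms(4) by simp
qed

lemma Add_eq_swap:
  assumes "u \<in> Hom C A B" "v \<in> Hom C A B" "Add C u (Neg C v) = w"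
  shows "u = Add C v w"
proof -
  obtain \<phi> :: "(nat \<Rightarrow> int) \<Rightarrow> 'a" where \<phi>: "\<And>u v. Add C (\<phi> u) (\<phi> v) = \<phi> (u + v)"
    "\<And>u. Neg C (\<phi> u) = \<phi> (- u)" and "{u, v} \<subseteq> range \<phi>"
    using generated_by_summands[of "{u, v}" A B] assms(1,2) by auto
  then obtain u' v' where "u = \<phi> u'" "v = \<phi> v'" by auto
  then show ?thesis using \<phi> assms(3) by auto
qed

lemma Neg_eq_Zero_iff:
  assumes "arr u" "dom u = A" "cod u = B"
  shows "Neg C u = Zero C A B \<longleftrightarrow> u = Zero C A B"
proof
  assume "Neg C u = Zero C A B"
  then have "Neg C (Neg C u) = Neg C (Zero C A B)" by simp
  then show "u = Zero C A B" using assms Arr_Obj[of u] by simp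
next
  assume "u = Zero C A B"
  then show "Neg C u = Zero C A B" using assms Arr_Obj[of u] by simp
qed

lemma Neg_Add_distrib [simp]:
  assumes "arr u" "arr v" "dom v = dom u" "cod v = cod u"
  shows "Neg C (Add C u v) = Add C (Neg C u) (Neg C v)"
proof -
  obtain \<phi> :: "(nat \<Rightarrow> int) \<Rightarrow> 'a" where \<phi>: "\<And>u v. Add C (\<phi> u) (\<phi> v) = \<phi> (u + v)"
    "\<And>u. Neg C (\<phi> u) = \<phi> (- u)" and "{u, v} \<subseteq> range \<phi>"
    using generated_by_summands[of "{u, v}" "dom u" "cod u"] assms by (auto simp: Hom_def)
  then obtain u' v' where "u = \<phi> u'" "v = \<phi> v'" by auto
  then show ?thesis using \<phi> by simp
qed

lemma Add_cancel:
  assumes "p \<in> Hom C A B" "q \<in> Hom C A B"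
  shows "Add C (Neg C q) (Add C p q) = p" "Add C (Neg C p) (Add C p q) = q"
    "Add C (Neg C (Add C p q)) p = Neg C q" "Add C p (Neg C (Add C p q)) = Neg C q"
proof -
  obtain \<phi> :: "(nat \<Rightarrow> int) \<Rightarrow> 'a" where \<phi>: "\<And>u v. Add C (\<phi> u) (\<phi> v) = \<phi> (u + v)"
    "\<And>u. Neg C (\<phi> u) = \<phi> (- u)" and "{p, q} \<subseteq> range \<phi>"
    using generated_by_summands[of "{p, q}" A B] assms by auto
  then obtain u' v' where "p = \<phi> u'" "q = \<phi> v'" by auto
  then show "Add C (Neg C q) (Add C p q) = p" "Add C (Neg C p) (Add C p q) = q"
    "Add C (Neg C (Add C p q)) p = Neg C q" "Add C p (Neg C (Add C p q)) = Neg C q"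
    using \<phi> by simp_all
qed

lemma Add_eq_Zero:
  assumes "u \<in> Hom C A B" "v \<in> Hom C A B" "Add C u v = Zero C A B"
  shows "u = Neg C v"
  using Neg_unique[of v A B u] Add_commute[of u A B v] assms by simp

lemma Add_eq_Add:
  assumes "p \<in> Hom C A B" "q \<in> Hom C A B" "r \<in> Hom C A B" "s \<in> Hom C A B" "Add C p q = Add C r s"
  shows "q = Add C (Add C (Neg C p) r) s"
  using Add_cancel(2)[OF assms(1,2)] Add_assoc[of "Neg C p" A B r s] assms Neg_Hom by simp

end

section \<open>Calculus of right fractions\<close>

text \<open>Composition of classes is a union over all representatives and all completions to a
  roof. Once the choices are irrelevant and at least one exists, the union collapses to a single
  class.\<close>

lemma UN3_constant:
  assumes "a \<in> A" "b \<in> B" "c \<in> R a b" "\<And>a b c. \<lbrakk>a \<in> A; b \<in> B; c \<in> R a b\<rbrakk> \<Longrightarrow> f c = K"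
  shows "(\<Union>a \<in> A. \<Union>b \<in> B. \<Union>c \<in> R a b. f c) = K"
  using assms by fastforce

text \<open>Collects the properties of denominators from which roofs get a well-defined associative
  composition. Cancellation \<open>den_cancel\<close> is among them because
  \<open>roof_equiv\<close> asks only that the common composite be a denominator, not that its
  factors \<open>u\<close> and \<open>v\<close> be.\<close>

locale right_fractions = category T for T :: "('o, 'a, 'z) tricat_scheme" +
  fixes N :: "'o set"
  assumes den_Ide: "X \<in> Obj T \<Longrightarrow> Ide T X \<in> denominators T N"
    and den_Comp: "\<lbrakk>s \<in> denominators T N; t \<in> denominators T N; Dom T t = Cod T s\<rbrakk>
      \<Longrightarrow> t \<cdot>\<^bsub>T\<^esub> s \<in> denominators T N"
    and den_cancel: "\<lbrakk>s \<in> denominators T N; u \<in> Arr T; Dom T s = Cod T u; s \<cdot>\<^bsub>T\<^esub> u \<in> denominators T N\<rbrakk>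
      \<Longrightarrow> u \<in> denominators T N"
    and Ore: "\<lbrakk>t \<in> denominators T N; f \<in> Arr T; Cod T t = Cod T f\<rbrakk>
      \<Longrightarrow> \<exists>t' \<in> denominators T N. \<exists>h \<in> Arr T. Dom T t' = Dom T h \<and> Cod T t' = Dom T f \<and>
            Cod T h = Dom T t \<and> f \<cdot>\<^bsub>T\<^esub> t' = t \<cdot>\<^bsub>T\<^esub> h"
    and equalize: "\<lbrakk>t \<in> denominators T N; h \<in> Arr T; h' \<in> Arr T; Dom T h' = Dom T h;
        Cod T h = Dom T t; Cod T h' = Dom T t; t \<cdot>\<^bsub>T\<^esub> h = t \<cdot>\<^bsub>T\<^esub> h'\<rbrakk>
      \<Longrightarrow> \<exists>u \<in> denominators T N. Cod T u = Dom T h \<and> h \<cdot>\<^bsub>T\<^esub> u = h' \<cdot>\<^bsub>T\<^esub> u"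
begin

abbreviation comp\<^sub>T (infixr \<open>\<bullet>\<close> 70) where "g \<bullet> f \<equiv> g \<cdot>\<^bsub>T\<^esub> f"
abbreviation "S \<equiv> denominators T N"
abbreviation "D \<equiv> quotient_shiftcat T N"

lemma den_Arr [simp]: "s \<in> S \<Longrightarrow> s \<in> Arr T"
  by (simp add: denominators_def)

lemma roofs_iff: "(s, f) \<in> roofs T N X Y \<longleftrightarrow>
    s \<in> S \<and> arr f \<and> dom s = dom f \<and> cod s = X \<and> cod f = Y"
  by (simp add: roofs_def)

text \<open>As \<open>s \<bullet> u = t \<bullet> v\<close> is a denominator, cancelling
  \<open>s\<close> and \<open>t\<close> shows that \<open>u\<close> and \<open>v\<close> are
  denominators too. Equivalence thus means a common refinement by denominators, a form that can be
  iterated.\<close>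

lemma roof_equiv_iff:
  assumes "s \<in> S" "t \<in> S"
  shows "roof_equiv T N (s, f) (t, g) \<longleftrightarrow> (\<exists>u \<in> S. \<exists>v \<in> S. dom u = dom v \<and>
    cod u = dom s \<and> cod v = dom t \<and> s \<bullet> u = t \<bullet> v \<and> f \<bullet> u = g \<bullet> v)"
proof
  assume "roof_equiv T N (s, f) (t, g)"
  then obtain u v where uv: "arr u" "arr v" "dom u = dom v" "cod u = dom s"
    "cod v = dom t" "s \<bullet> u = t \<bullet> v" "f \<bullet> u = g \<bullet> v" "s \<bullet> u \<in> S"
    by (auto simp: roof_equiv_def)
  then have "u \<in> S" "v \<in> S" using assms den_cancel by metis+
  with uv show "\<exists>u \<in> S. \<exists>v \<in> S. dom u = dom v \<and> cod u = dom s \<and> cod v = dom t \<and>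
    s \<bullet> u = t \<bullet> v \<and> f \<bullet> u = g \<bullet> v" by blast
next
  assume "\<exists>u \<in> S. \<exists>v \<in> S. dom u = dom v \<and> cod u = dom s \<and> cod v = dom t \<and>
    s \<bullet> u = t \<bullet> v \<and> f \<bullet> u = g \<bullet> v"
  then show "roof_equiv T N (s, f) (t, g)"
    using assms den_Comp by (fastforce simp: roof_equiv_def)
qed

lemma roof_equivI:
  assumes "s \<in> S" "t \<in> S" "u \<in> S" "v \<in> S" "dom u = dom v" "cod u = dom s" "cod v = dom t"
    "s \<bullet> u = t \<bullet> v" "f \<bullet> u = g \<bullet> v"
  shows "roof_equiv T N (s, f) (t, g)"
  using assms roof_equiv_iff by blast

lemma roof_equivE:
  assumes "roof_equiv T N (s, f) (t, g)" "s \<in> S" "t \<in> S"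
  obtains u v where "u \<in> S" "v \<in> S" "dom u = dom v" "cod u = dom s" "cod v = dom t"
    "s \<bullet> u = t \<bullet> v" "f \<bullet> u = g \<bullet> v"
  using assms roof_equiv_iff by blast

lemma roof_equiv_refl: "r \<in> roofs T N X Y \<Longrightarrow> roof_equiv T N r r"
  by (cases r) (auto simp: roofs_iff den_Ide
    intro!: roof_equivI[of _ _ "Ide T (dom (fst r))" "Ide T (dom (fst r))"])

lemma roof_equiv_sym:
  assumes "r \<in> roofs T N X Y" "r' \<in> roofs T N X Y" "roof_equiv T N r r'"
  shows "roof_equiv T N r' r"
  using assms by (cases r; cases r') (auto simp: roofs_iff roof_equiv_iff, metis)

lemma roof_equiv_trans:
  assumes "r \<in> roofs T N X Y" "r' \<in> roofs T N X Y" "r'' \<in> roofs T N X Y"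
    "roof_equiv T N r r'" "roof_equiv T N r' r''"
  shows "roof_equiv T N r r''"
proof -
  obtain s f t g p k where r: "r = (s, f)" "r' = (t, g)" "r'' = (p, k)" by (cases r; cases r'; cases r'')
  have S: "s \<in> S" "t \<in> S" "p \<in> S" "arr f" "arr g" "arr k" "dom f = dom s"
    "dom g = dom t" "dom k = dom p"
    using assms by (auto simp: roofs_iff r)
  obtain u v where uv: "u \<in> S" "v \<in> S" "dom u = dom v" "cod u = dom s" "cod v = dom t"
    "s \<bullet> u = t \<bullet> v" "f \<bullet> u = g \<bullet> v"
    using assms(4) S by (auto simp: r elim: roof_equivE)
  obtain u' v' where uv': "u' \<in> S" "v' \<in> S" "dom u' = dom v'" "cod u' = dom t" "cod v' = dom p"
    "t \<bullet> u' = p \<bullet> v'" "g \<bullet> u' = k \<bullet> v'"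
    using assms(5) S by (auto simp: r elim: roof_equivE)
  \<comment> \<open>The middle roof has been refined twice, by \<open>v\<close> and by
    \<open>u'\<close>; an Ore square over its apex gives a common refinement. The side
    \<open>b\<close> is at first a mere arrow and becomes a denominator by cancelling
    \<open>v\<close>.\<close>
  obtain a b where ab: "a \<in> S" "arr b" "dom a = dom b" "cod a = dom u'" "cod b = dom v"
    "u' \<bullet> a = v \<bullet> b"
    using Ore[of v u'] uv uv' by auto
  have "v \<bullet> b \<in> S" using ab den_Comp[of a u'] uv' by simp
  then have bS: "b \<in> S" using den_cancel[of v b] uv ab by simp
  have 1: "s \<bullet> (u \<bullet> b) = t \<bullet> (v \<bullet> b)"
    by (rule Comp_cong_left) (use uv S ab in auto)
  have 2: "t \<bullet> (u' \<bullet> a) = p \<bullet> (v' \<bullet> a)"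
    by (rule Comp_cong_left) (use uv' S ab in auto)
  have 3: "f \<bullet> (u \<bullet> b) = g \<bullet> (v \<bullet> b)"
    by (rule Comp_cong_left) (use uv S ab in auto)
  have 4: "g \<bullet> (u' \<bullet> a) = k \<bullet> (v' \<bullet> a)"
    by (rule Comp_cong_left) (use uv' S ab in auto)
  show ?thesis unfolding r
    by (rule roof_equivI[of _ _ "u \<bullet> b" "v' \<bullet> a"])
       (use S uv uv' ab bS 1 2 3 4 den_Comp in auto)
qed

lemma roof_class_eq_iff:
  assumes "r \<in> roofs T N X Y" "r' \<in> roofs T N X Y"
  shows "roof_class T N X Y r = roof_class T N X Y r' \<longleftrightarrow> roof_equiv T N r r'"
proof
  assume "roof_class T N X Y r = roof_class T N X Y r'"
  moreover have "r' \<in> roof_class T N X Y r'"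
    using assms roof_equiv_refl by (simp add: roof_class_def)
  ultimately have "r' \<in> roof_class T N X Y r" by simp
  then show "roof_equiv T N r r'" by (simp add: roof_class_def)
next
  assume "roof_equiv T N r r'"
  then show "roof_class T N X Y r = roof_class T N X Y r'"
    using assms roof_equiv_sym roof_equiv_trans unfolding roof_class_def by blast
qed

lemma roof_classD: "q \<in> roof_class T N X Y r \<Longrightarrow> q \<in> roofs T N X Y \<and> roof_equiv T N r q"
  by (simp add: roof_class_def)

lemma roof_class_self: "r \<in> roofs T N X Y \<Longrightarrow> r \<in> roof_class T N X Y r"
  using roof_equiv_refl by (simp add: roof_class_def)

lemma roof_compI:
  assumes "t' \<in> S" "arr h" "dom t' = dom h" "cod t' = dom s" "cod h = dom t"
    "f \<bullet> t' = t \<bullet> h"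
  shows "(s \<bullet> t', g \<bullet> h) \<in> roof_comp T N (t, g) (s, f)"
  using assms by (auto simp: roof_comp_def)

lemma roof_compE:
  assumes "q \<in> roof_comp T N (t, g) (s, f)"
  obtains t' h where "q = (s \<bullet> t', g \<bullet> h)" "t' \<in> S" "arr h" "dom t' = dom h"
    "cod t' = dom s" "cod h = dom t" "f \<bullet> t' = t \<bullet> h"
  using assms by (auto simp: roof_comp_def)

lemma roof_comp_roofs:
  assumes "r \<in> roofs T N X Y" "r' \<in> roofs T N Y Z" "q \<in> roof_comp T N r' r"
  shows "q \<in> roofs T N X Z"
proof -
  obtain s f t g where "r = (s, f)" "r' = (t, g)" by (cases r; cases r')
  with assms show ?thesis by (auto simp: roofs_iff den_Comp elim!: roof_compE)
qed

lemma roof_comp_ex: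
  assumes "r \<in> roofs T N X Y" "r' \<in> roofs T N Y Z"
  shows "\<exists>q. q \<in> roof_comp T N r' r"
proof -
  obtain s f t g where r: "r = (s, f)" "r' = (t, g)" by (cases r; cases r')
  obtain t' h where "t' \<in> S" "arr h" "dom t' = dom h" "cod t' = dom f"
    "cod h = dom t" "f \<bullet> t' = t \<bullet> h"
    using Ore[of t f] assms by (auto simp: r roofs_iff)
  then show ?thesis using roof_compI[of t' h s t f g] assms by (auto simp: r roofs_iff)
qed

text \<open>On a common refinement of \<open>t1\<close> and \<open>t2\<close> the two completions
  \<open>h1\<close> and \<open>h2\<close> agree only after composition with \<open>t\<close>. Since
  \<open>t\<close> need not be mono, a further denominator \<open>c\<close> from
  \<open>equalize\<close> is required to make them equal.\<close>

lemma roof_comp_same: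
  assumes r: "r \<in> roofs T N X Y" and r': "r' \<in> roofs T N Y Z"
    and q: "q \<in> roof_comp T N r' r" "q' \<in> roof_comp T N r' r"
  shows "roof_equiv T N q q'"
proof -
  obtain s f t g where rr: "r = (s, f)" "r' = (t, g)" by (cases r; cases r')
  have S: "s \<in> S" "t \<in> S" "arr f" "arr g" "dom f = dom s" "dom g = dom t"
    "cod f = cod t"
    using r r' by (auto simp: roofs_iff rr)
  obtain t1 h1 where 1: "q = (s \<bullet> t1, g \<bullet> h1)" "t1 \<in> S" "arr h1" "dom t1 = dom h1"
    "cod t1 = dom s" "cod h1 = dom t" "f \<bullet> t1 = t \<bullet> h1"
    using q(1) unfolding rr by (rule roof_compE)
  obtain t2 h2 where 2: "q' = (s \<bullet> t2, g \<bullet> h2)" "t2 \<in> S" "arr h2" "dom t2 = dom h2"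
    "cod t2 = dom s" "cod h2 = dom t" "f \<bullet> t2 = t \<bullet> h2"
    using q(2) unfolding rr by (rule roof_compE)
  obtain a b where ab: "a \<in> S" "arr b" "dom a = dom b" "cod a = dom t1" "cod b = dom t2"
    "t1 \<bullet> a = t2 \<bullet> b"
    using Ore[of t2 t1] 1 2 by auto
  have "t2 \<bullet> b \<in> S" using ab den_Comp[of a t1] 1 by simp
  then have bS: "b \<in> S" using den_cancel[of t2 b] 2 ab by simp
  have "t \<bullet> (h1 \<bullet> a) = f \<bullet> (t1 \<bullet> a)"
    by (rule Comp_cong_left[OF 1(7)[symmetric]]) (use 1 S ab in auto)
  also have "\<dots> = f \<bullet> (t2 \<bullet> b)" using ab by simp
  also have "\<dots> = t \<bullet> (h2 \<bullet> b)"
    by (rule Comp_cong_left[OF 2(7)]) (use 2 S ab in auto)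
  finally obtain c where c: "c \<in> S" "cod c = dom a" "(h1 \<bullet> a) \<bullet> c = (h2 \<bullet> b) \<bullet> c"
    using equalize[of t "h1 \<bullet> a" "h2 \<bullet> b"] S 1 2 ab by auto
  have 3: "t1 \<bullet> (a \<bullet> c) = t2 \<bullet> (b \<bullet> c)"
    by (rule Comp_cong_left[OF ab(6)]) (use 1 2 ab c in auto)
  have 4: "h1 \<bullet> (a \<bullet> c) = h2 \<bullet> (b \<bullet> c)"
    using 1 2 ab c by simp
  show ?thesis unfolding 1(1) 2(1)
    by (rule roof_equivI[of _ _ "a \<bullet> c" "b \<bullet> c"])
      (use 1 2 3 4 S ab bS c den_Comp in auto)
qed

text \<open>The refining denominators \<open>u\<close> and \<open>v\<close> can be absorbed into the
  Ore square: \<open>u \<bullet> t1\<close> and \<open>v \<bullet> h1\<close> complete the original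
  roofs and give the same composite.\<close>

lemma roof_comp_refine:
  assumes "(t, g) \<in> roofs T N Y Z" "(s, f) \<in> roofs T N X Y" "u \<in> S" "cod u = dom s"
    "v \<in> S" "cod v = dom t"
    and q: "q \<in> roof_comp T N (t \<bullet> v, g \<bullet> v) (s \<bullet> u, f \<bullet> u)"
  shows "q \<in> roof_comp T N (t, g) (s, f)"
proof -
  have S: "s \<in> S" "t \<in> S" "arr f" "arr g" "dom f = dom s" "dom g = dom t"
    "cod f = cod t"
    using assms by (auto simp: roofs_iff)
  obtain t1 h1 where 1: "q = ((s \<bullet> u) \<bullet> t1, (g \<bullet> v) \<bullet> h1)" "t1 \<in> S" "arr h1" "dom t1 = dom h1"
    "cod t1 = dom u" "cod h1 = dom v" "(f \<bullet> u) \<bullet> t1 = (t \<bullet> v) \<bullet> h1"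
    using q S assms(3-6) by (auto elim: roof_compE)
  have "q = (s \<bullet> (u \<bullet> t1), g \<bullet> (v \<bullet> h1))"
    using 1 S assms(3-6) by simp
  moreover have "f \<bullet> (u \<bullet> t1) = t \<bullet> (v \<bullet> h1)"
    using 1 S assms(3-6) by simp
  ultimately show ?thesis
    using roof_compI[of "u \<bullet> t1" "v \<bullet> h1" s t f g] 1 S assms(3-6) den_Comp by auto
qed

text \<open>A composite \<open>q2\<close> of the common refinements is, by
  \<open>roof_comp_refine\<close>, a composite of either pair of roofs. Comparing \<open>q\<close>
  and \<open>q1\<close> with it reduces independence of representatives to independence of the
  completion.\<close>

lemma roof_comp_cong:
  assumes r: "r \<in> roofs T N X Y" "r1 \<in> roofs T N X Y" "roof_equiv T N r r1"
    and r': "r' \<in> roofs T N Y Z" "r1' \<in> roofs T N Y Z" "roof_equiv T N r' r1'"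
    and q: "q \<in> roof_comp T N r' r" "q1 \<in> roof_comp T N r1' r1"
  shows "roof_equiv T N q q1"
proof -
  obtain s f t g s1 f1 t1 g1 where rr: "r = (s, f)" "r' = (t, g)" "r1 = (s1, f1)" "r1' = (t1, g1)"
    by (cases r; cases r'; cases r1; cases r1')
  have S: "s \<in> S" "t \<in> S" "s1 \<in> S" "t1 \<in> S" "arr f" "arr g" "arr f1" "arr g1"
    "dom s = dom f" "dom t = dom g" "cod s = X" "cod f = Y" "cod t = Y" "cod g = Z"
    "dom s1 = dom f1" "dom t1 = dom g1" "cod s1 = X" "cod f1 = Y" "cod t1 = Y" "cod g1 = Z"
    using r r' by (auto simp: roofs_iff rr)
  obtain u u1 where u: "u \<in> S" "u1 \<in> S" "dom u = dom u1" "cod u = dom s" "cod u1 = dom s1"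
    "s \<bullet> u = s1 \<bullet> u1" "f \<bullet> u = f1 \<bullet> u1"
    using r S by (auto simp: rr elim: roof_equivE)
  obtain v v1 where v: "v \<in> S" "v1 \<in> S" "dom v = dom v1" "cod v = dom t" "cod v1 = dom t1"
    "t \<bullet> v = t1 \<bullet> v1" "g \<bullet> v = g1 \<bullet> v1"
    using r' S by (auto simp: rr elim: roof_equivE)
  have "(s \<bullet> u, f \<bullet> u) \<in> roofs T N X Y" "(t \<bullet> v, g \<bullet> v) \<in> roofs T N Y Z"
    using S u v den_Comp by (auto simp: roofs_iff)
  then obtain q2 where q2: "q2 \<in> roof_comp T N (t \<bullet> v, g \<bullet> v) (s \<bullet> u, f \<bullet> u)"
    using roof_comp_ex by blast
  have "q2 \<in> roof_comp T N r' r" using roof_comp_refine r r' u v q2 unfolding rr by blast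
  moreover have "q2 \<in> roof_comp T N r1' r1"
    using roof_comp_refine[of t1 g1 Y Z s1 f1 X u1 v1 q2] r r' u v q2 unfolding rr by simp
  ultimately have "roof_equiv T N q q2" "roof_equiv T N q2 q1" "q2 \<in> roofs T N X Z"
    using roof_comp_same[OF r(1) r'(1) q(1)] roof_comp_same[OF r(2) r'(2) _ q(2)]
      roof_comp_roofs[OF r(1) r'(1)] by blast+
  then show ?thesis
    using roof_equiv_trans roof_comp_roofs[OF r(1) r'(1) q(1)] roof_comp_roofs[OF r(2) r'(2) q(2)] by blast
qed

section \<open>The localized category of roofs\<close>

definition frac :: "'o \<Rightarrow> 'o \<Rightarrow> 'a \<times> 'a \<Rightarrow> 'o \<times> 'o \<times> ('a \<times> 'a) set" where
  "frac X Y r = (X, Y, roof_class T N X Y r)"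

lemma frac_eq_iff:
  assumes "r \<in> roofs T N X Y" "r' \<in> roofs T N X Y"
  shows "frac X Y r = frac X Y r' \<longleftrightarrow> roof_equiv T N r r'"
  using roof_class_eq_iff[OF assms] by (simp add: frac_def)

lemma quotient_Obj [simp]: "Obj D = Obj T"
  and quotient_Dom [simp]: "Dom D (frac X Y r) = X"
  and quotient_Cod [simp]: "Cod D (frac X Y r) = Y"
  and quotient_Ide: "Ide D X = frac X X (Ide T X, Ide T X)"
  and quotient_Zero: "Zero D X Y = frac X Y (Ide T X, Zero T X Y)"
  and quotient_Sh [simp]: "Sh D = Sh T"
  by (simp_all add: quotient_shiftcat_def frac_def)

lemma quotient_Hom:
  assumes "X \<in> Obj T" "Y \<in> Obj T"
  shows "Hom D X Y = frac X Y ` roofs T N X Y"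
  using assms by (auto simp: Hom_def quotient_shiftcat_def frac_def)

lemma quotient_Arr: "Arr D = {frac X Y r | X Y r. X \<in> Obj T \<and> Y \<in> Obj T \<and> r \<in> roofs T N X Y}"
  by (simp add: quotient_shiftcat_def frac_def)

lemma quotient_HomE:
  assumes "F \<in> Hom D X Y"
  obtains s f where "X \<in> Obj T" "Y \<in> Obj T" "F = frac X Y (s, f)" "(s, f) \<in> roofs T N X Y"
  using assms by (auto simp: Hom_def quotient_Arr)

lemma quotient_Comp:
  assumes r: "r \<in> roofs T N X Y" and r': "r' \<in> roofs T N Y Z" and q: "q \<in> roof_comp T N r' r"
  shows "frac Y Z r' \<cdot>\<^bsub>D\<^esub> frac X Y r = frac X Z q"
proof -
  have "roof_class T N X Z q1 = roof_class T N X Z q"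
    if "r1 \<in> roof_class T N X Y r" "r1' \<in> roof_class T N Y Z r'" "q1 \<in> roof_comp T N r1' r1" for r1 r1' q1
  proof -
    have r1: "r1 \<in> roofs T N X Y" "roof_equiv T N r r1" "r1' \<in> roofs T N Y Z" "roof_equiv T N r' r1'"
      using that by (auto dest: roof_classD)
    have "roof_equiv T N q q1"
      by (rule roof_comp_cong[OF r r1(1,2) r' r1(3,4) q that(3)])
    then show ?thesis
      using roof_class_eq_iff roof_comp_roofs[OF r r' q] roof_comp_roofs[OF r1(1,3) that(3)] by blast
  qed
  then have "(\<Union>r1' \<in> roof_class T N Y Z r'. \<Union>r1 \<in> roof_class T N X Y r.
      \<Union>q1 \<in> roof_comp T N r1' r1. roof_class T N X Z q1) = roof_class T N X Z q"
    by (rule UN3_constant[where R = "roof_comp T N", OF roof_class_self[OF r'] roof_class_self[OF r] q])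
  then show ?thesis by (simp add: quotient_shiftcat_def frac_def)
qed

lemma quotient_Comp_ex:
  assumes "(s, f) \<in> roofs T N X Y" "(t, g) \<in> roofs T N Y Z"
  obtains t' h where "t' \<in> S" "arr h" "dom t' = dom h" "cod t' = dom s" "cod h = dom t"
    "f \<bullet> t' = t \<bullet> h" "frac Y Z (t, g) \<cdot>\<^bsub>D\<^esub> frac X Y (s, f) = frac X Z (s \<bullet> t', g \<bullet> h)"
    "(s \<bullet> t', g \<bullet> h) \<in> roofs T N X Z"
proof -
  obtain q where q: "q \<in> roof_comp T N (t, g) (s, f)" using roof_comp_ex assms by blast
  then obtain t' h where h: "q = (s \<bullet> t', g \<bullet> h)" "t' \<in> S" "arr h" "dom t' = dom h"
    "cod t' = dom s" "cod h = dom t" "f \<bullet> t' = t \<bullet> h"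
    by (rule roof_compE)
  show ?thesis
    by (rule that[OF h(2-7)]) (use quotient_Comp[OF assms q] roof_comp_roofs[OF assms q] h(1) in \<open>simp_all only:\<close>)
qed

sublocale quotient: category D
proof
  fix X assume X: "X \<in> Obj D"
  then show "Ide D X \<in> Hom D X X"
    using den_Ide by (auto simp: quotient_Ide quotient_Hom roofs_iff)
next
  fix X Y F assume F: "F \<in> Hom D X Y"
  then obtain s f where X: "X \<in> Obj T" "Y \<in> Obj T" and Ff: "F = frac X Y (s, f)" and r: "(s, f) \<in> roofs T N X Y"
    by (rule quotient_HomE)
  have IX: "(Ide T X, Ide T X) \<in> roofs T N X X" and IY: "(Ide T Y, Ide T Y) \<in> roofs T N Y Y"
    using X den_Ide by (auto simp: roofs_iff)
  have "(Ide T X \<bullet> s, f \<bullet> Ide T (dom s)) \<in> roof_comp T N (s, f) (Ide T X, Ide T X)"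
    by (rule roof_compI) (use r X in \<open>auto simp: roofs_iff\<close>)
  then show "F \<cdot>\<^bsub>D\<^esub> Ide D X = F"
    using quotient_Comp[OF IX r] r by (simp add: Ff quotient_Ide roofs_iff)
  have "(s \<bullet> Ide T (dom s), Ide T Y \<bullet> f) \<in> roof_comp T N (Ide T Y, Ide T Y) (s, f)"
    by (rule roof_compI) (use r X den_Ide in \<open>auto simp: roofs_iff\<close>)
  then show "Ide D Y \<cdot>\<^bsub>D\<^esub> F = F"
    using quotient_Comp[OF r IY] r by (simp add: Ff quotient_Ide roofs_iff)
next
  fix X Y Z F G assume F: "F \<in> Hom D X Y" and G: "G \<in> Hom D Y Z"
  obtain s f where Ff: "X \<in> Obj T" "Y \<in> Obj T" "F = frac X Y (s, f)" and r: "(s, f) \<in> roofs T N X Y"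
    using F by (rule quotient_HomE)
  obtain t g where Gg: "Z \<in> Obj T" "G = frac Y Z (t, g)" and r': "(t, g) \<in> roofs T N Y Z"
    using G by (rule quotient_HomE)
  show "G \<cdot>\<^bsub>D\<^esub> F \<in> Hom D X Z"
    using quotient_Comp_ex[OF r r'] quotient_Hom Ff Gg by (metis imageI)
next
  fix W X Y Z F G H assume F: "F \<in> Hom D W X" and G: "G \<in> Hom D X Y" and H: "H \<in> Hom D Y Z"
  obtain s f where Ff: "F = frac W X (s, f)" and r: "(s, f) \<in> roofs T N W X"
    using F by (rule quotient_HomE)
  obtain t g where Gg: "G = frac X Y (t, g)" and r': "(t, g) \<in> roofs T N X Y"
    using G by (rule quotient_HomE)
  obtain p k where Hk: "H = frac Y Z (p, k)" and r'': "(p, k) \<in> roofs T N Y Z"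
    using H by (rule quotient_HomE)
  note roofs = r[unfolded roofs_iff] r'[unfolded roofs_iff] r''[unfolded roofs_iff]
  obtain t' h where th: "t' \<in> S" "arr h" "dom t' = dom h" "cod t' = dom s" "cod h = dom t"
    "f \<bullet> t' = t \<bullet> h" and GF: "G \<cdot>\<^bsub>D\<^esub> F = frac W Y (s \<bullet> t', g \<bullet> h)"
    and GFr: "(s \<bullet> t', g \<bullet> h) \<in> roofs T N W Y"
    using quotient_Comp_ex[OF r r'] unfolding Ff Gg by metis
  obtain p' l where pl: "p' \<in> S" "arr l" "dom p' = dom l" "cod p' = dom t" "cod l = dom p"
    "g \<bullet> p' = p \<bullet> l" and HG: "H \<cdot>\<^bsub>D\<^esub> G = frac X Z (t \<bullet> p', k \<bullet> l)"
    and HGr: "(t \<bullet> p', k \<bullet> l) \<in> roofs T N X Z"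
    using quotient_Comp_ex[OF r' r''] unfolding Gg Hk by metis
  \<comment> \<open>A third Ore square, of \<open>h\<close> against \<open>p'\<close>, sits on top
    of the two already chosen. The roof it completes is a composite for either bracketing, so both
    sides have a common representative.\<close>
  obtain c b where cb: "c \<in> S" "arr b" "dom c = dom b" "cod c = dom h" "cod b = dom p'"
    "h \<bullet> c = p' \<bullet> b"
    using Ore[of p' h] pl th by auto
  have "g \<bullet> (h \<bullet> c) = p \<bullet> (l \<bullet> b)"
    unfolding cb(6) by (rule Comp_cong_left[OF pl(6)]) (use roofs pl cb in auto)
  then have "((s \<bullet> t') \<bullet> c, k \<bullet> (l \<bullet> b)) \<in> roof_comp T N (p, k) (s \<bullet> t', g \<bullet> h)"
    by (intro roof_compI) (use roofs th pl cb in auto)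
  then have 1: "H \<cdot>\<^bsub>D\<^esub> (G \<cdot>\<^bsub>D\<^esub> F) = frac W Z ((s \<bullet> t') \<bullet> c, k \<bullet> (l \<bullet> b))"
    unfolding GF Hk using quotient_Comp[OF GFr r''] by blast
  have "f \<bullet> (t' \<bullet> c) = t \<bullet> (h \<bullet> c)"
    by (rule Comp_cong_left[OF th(6)]) (use roofs th cb in auto)
  then have "(s \<bullet> (t' \<bullet> c), (k \<bullet> l) \<bullet> b) \<in> roof_comp T N (t \<bullet> p', k \<bullet> l) (s, f)"
    by (intro roof_compI) (use roofs th pl cb den_Comp in auto)
  then have 2: "(H \<cdot>\<^bsub>D\<^esub> G) \<cdot>\<^bsub>D\<^esub> F = frac W Z (s \<bullet> (t' \<bullet> c), (k \<bullet> l) \<bullet> b)"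
    unfolding HG Ff using quotient_Comp[OF r HGr] by blast
  show "(H \<cdot>\<^bsub>D\<^esub> G) \<cdot>\<^bsub>D\<^esub> F = H \<cdot>\<^bsub>D\<^esub> (G \<cdot>\<^bsub>D\<^esub> F)"
    unfolding 1 2 using roofs th pl cb by simp
qed (auto simp: quotient_Arr)

end

section \<open>Complexes up to homotopy\<close>

context additive_category
begin

abbreviation complex where "complex X \<equiv> is_complex C X"
abbreviation chains where "chains X Y \<equiv> chain_maps C X Y"

lemma complexD [simp]:
  assumes "complex X"
  shows "arr (Dif X n)" "dom (Dif X n) = Ter X n" "cod (Dif X n) = Ter X (n + 1)"
    "Ter X n \<in> Obj C"
proof -
  have "Dif X n \<in> Hom C (Ter X n) (Ter X (n + 1))" using assms by (simp add: is_complex_def)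
  then show "arr (Dif X n)" "dom (Dif X n) = Ter X n" "cod (Dif X n) = Ter X (n + 1)"
    "Ter X n \<in> Obj C"
    using Hom_Obj[of "Dif X n"] by (auto simp: Hom_def)
qed

lemma int_plus_1_plus_1 [simp]: "(n :: int) + 1 + 1 = n + 2" "n + 2 - 1 = n + 1"
  by simp_all

text \<open>The outer index is a variable tied to the inner one by an equation, so that the rule
  also fires for pairs such as \<open>n\<close> and \<open>n - 1\<close>. Many rules below have an
  index \<open>m\<close> for the same reason.\<close>

lemma Dif_Dif [simp]:
  "\<lbrakk>complex X; m = n + 1\<rbrakk> \<Longrightarrow> Dif X m \<star> Dif X n = Zero C (Ter X n) (Ter X (m + 1))"
  by (simp add: is_complex_def)

lemma Dif_Dif_Comp [simp]:
  assumes "complex X" "m = n + 1" "arr x" "cod x = Ter X n"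
  shows "Dif X m \<star> (Dif X n \<star> x) = Zero C (dom x) (Ter X (m + 1))"
proof -
  have "Dif X m \<star> (Dif X n \<star> x) = (Dif X m \<star> Dif X n) \<star> x"
    using assms by (intro Comp_assoc_eq[symmetric]) auto
  also have "\<dots> = Zero C (Ter X n) (Ter X (m + 1)) \<star> x"
    by (simp only: Dif_Dif[OF assms(1,2)])
  also have "\<dots> = Zero C (dom x) (Ter X (m + 1))" using assms by simp
  finally show ?thesis .
qed

abbreviation "cocycle X n x \<equiv> Dif X n \<star> x = Zero C (dom x) (Ter X (n + 1))"

abbreviation "zero_map X Y \<equiv> \<lambda>n. Zero C (Ter X n) (Ter Y n)"

abbreviation "bdry X Y h n \<equiv> Add C (Dif Y (n - 1) \<star> h n) (h (n + 1) \<star> Dif X n)"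

lemma is_complexI:
  assumes "\<And>n. arr (Dif X n)" "\<And>n. dom (Dif X n) = Ter X n" "\<And>n. cod (Dif X n) = Ter X (n + 1)"
    "\<And>n. Dif X (n + 1) \<star> Dif X n = Zero C (Ter X n) (Ter X (n + 2))"
  shows "complex X"
  unfolding is_complex_def Hom_def using assms by blast

lemma chain_mapsI:
  assumes "\<And>n. arr (f n)" "\<And>n. dom (f n) = Ter X n" "\<And>n. cod (f n) = Ter Y n"
    "\<And>n. f (n + 1) \<star> Dif X n = Dif Y n \<star> f n"
  shows "f \<in> chains X Y"
  unfolding chain_maps_def Hom_def using assms by blast

lemma chain_mapsD:
  assumes "f \<in> chains X Y"
  shows "arr (f n)" "dom (f n) = Ter X n" "cod (f n) = Ter Y n"
    "m = n + 1 \<Longrightarrow> f m \<star> Dif X n = Dif Y n \<star> f n"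
    "\<lbrakk>complex X; complex Y; m = n + 1; arr x; cod x = Ter X n\<rbrakk>
      \<Longrightarrow> f m \<star> (Dif X n \<star> x) = Dif Y n \<star> (f n \<star> x)"
proof -
  have f: "f n \<in> Hom C (Ter X n) (Ter Y n) \<and> f (n + 1) \<star> Dif X n = Dif Y n \<star> f n" for n
    using assms by (simp add: chain_maps_def)
  have g: "arr (f n)" "dom (f n) = Ter X n" "cod (f n) = Ter Y n" for n
    using f[of n] by (auto simp: Hom_def)
  then show "arr (f n)" "dom (f n) = Ter X n" "cod (f n) = Ter Y n" by auto
  show 1: "f m \<star> Dif X n = Dif Y n \<star> f n" if "m = n + 1" for m
    using f[of n] that by simp
  show "f m \<star> (Dif X n \<star> x) = Dif Y n \<star> (f n \<star> x)"
    if "complex X" "complex Y" "m = n + 1" "arr x" "cod x = Ter X n"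
    by (rule Comp_cong_left) (use that g 1 in auto)
qed

lemma homotopicI:
  assumes "\<And>n. arr (h n)" "\<And>n. dom (h n) = Ter X n" "\<And>n. cod (h n) = Ter Y (n - 1)"
    "\<And>n. f n = Add C (g n) (bdry X Y h n)"
  shows "homotopic C X Y f g"
  using assms unfolding homotopic_def Hom_def by blast

lemma homotopicD:
  assumes "homotopic C X Y f g"
  shows "\<exists>h. (\<forall>n. arr (h n)) \<and> (\<forall>n. dom (h n) = Ter X n) \<and> (\<forall>n. cod (h n) = Ter Y (n - 1)) \<and>
    (\<forall>n. f n = Add C (g n) (bdry X Y h n))"
  using assms unfolding homotopic_def Hom_def by blast

lemma homotopic_refl:
  assumes "complex X" "complex Y" "f \<in> chains X Y"
  shows "homotopic C X Y f f"
  by (rule homotopicI[where h = "\<lambda>n. Zero C (Ter X n) (Ter Y (n - 1))"])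
    (use assms in \<open>simp_all add: chain_mapsD[OF assms(3)]\<close>)

lemma homotopic_sym:
  assumes X: "complex X" and Y: "complex Y" and g: "g \<in> chains X Y"
    and "homotopic C X Y f g"
  shows "homotopic C X Y g f"
proof -
  obtain h where h: "\<And>n. arr (h n)" "\<And>n. dom (h n) = Ter X n" "\<And>n. cod (h n) = Ter Y (n - 1)"
    "\<And>n. f n = Add C (g n) (bdry X Y h n)"
    using homotopicD[OF assms(4)] by blast
  have "g n = Add C (f n) (Add C (Neg C (Dif Y (n - 1) \<star> h n)) (Neg C (h (n + 1) \<star> Dif X n)))" for n
    by (rule Add_sum_sym[OF _ _ _ h(4)]) (use X Y h(1-3) chain_mapsD[OF g] in \<open>auto simp: Hom_def\<close>)
  then show ?thesis
    by (intro homotopicI[where h = "\<lambda>n. Neg C (h n)"]) (use X Y h(1-3) in simp_all)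
qed

lemma homotopic_trans:
  assumes X: "complex X" and Y: "complex Y" and k: "k \<in> chains X Y"
    and "homotopic C X Y f g" "homotopic C X Y g k"
  shows "homotopic C X Y f k"
proof -
  obtain h where h: "\<And>n. arr (h n)" "\<And>n. dom (h n) = Ter X n" "\<And>n. cod (h n) = Ter Y (n - 1)"
    "\<And>n. f n = Add C (g n) (bdry X Y h n)"
    using homotopicD[OF assms(4)] by blast
  obtain h' where h': "\<And>n. arr (h' n)" "\<And>n. dom (h' n) = Ter X n" "\<And>n. cod (h' n) = Ter Y (n - 1)"
    "\<And>n. g n = Add C (k n) (bdry X Y h' n)"
    using homotopicD[OF assms(5)] by blast
  have "f n = Add C (k n) (Add C (Add C (Dif Y (n - 1) \<star> h' n) (Dif Y (n - 1) \<star> h n))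
      (Add C (h' (n + 1) \<star> Dif X n) (h (n + 1) \<star> Dif X n)))" for n
    by (rule Add_sum_trans[OF _ _ _ _ _ h(4) h'(4)])
      (use X Y h(1-3) h'(1-3) chain_mapsD[OF k] in \<open>auto simp: Hom_def\<close>)
  then show ?thesis
    by (intro homotopicI[where h = "\<lambda>n. Add C (h' n) (h n)"]) (use X Y h(1-3) h'(1-3) in simp_all)
qed

lemma homotopic_Comp_left:
  assumes X: "complex X" and Y: "complex Y" and Z: "complex Z"
    and g: "g \<in> chains X Y" and k: "k \<in> chains Y Z" and "homotopic C X Y f g"
  shows "homotopic C X Z (\<lambda>n. k n \<star> f n) (\<lambda>n. k n \<star> g n)"
proof -
  obtain h where h: "\<And>n. arr (h n)" "\<And>n. dom (h n) = Ter X n" "\<And>n. cod (h n) = Ter Y (n - 1)"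
    "\<And>n. f n = Add C (g n) (bdry X Y h n)"
    using homotopicD[OF assms(6)] by blast
  show ?thesis
    by (intro homotopicI[where h = "\<lambda>n. k (n - 1) \<star> h n"])
      (use X Y Z h(1-3) in \<open>simp_all add: h(4) chain_mapsD[OF g] chain_mapsD[OF k]\<close>)
qed

lemma homotopic_Comp_right:
  assumes X: "complex X" and Y: "complex Y" and Z: "complex Z"
    and g: "g \<in> chains Y Z" and k: "k \<in> chains X Y" and "homotopic C Y Z f g"
  shows "homotopic C X Z (\<lambda>n. f n \<star> k n) (\<lambda>n. g n \<star> k n)"
proof -
  obtain h where h: "\<And>n. arr (h n)" "\<And>n. dom (h n) = Ter Y n" "\<And>n. cod (h n) = Ter Z (n - 1)"
    "\<And>n. f n = Add C (g n) (bdry Y Z h n)"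
    using homotopicD[OF assms(6)] by blast
  show ?thesis
    by (intro homotopicI[where h = "\<lambda>n. h n \<star> k n"])
      (use X Y Z h(1-3) in \<open>simp_all add: h(4) chain_mapsD[OF g] chain_mapsD[OF k]\<close>)
qed

lemma chain_maps_Comp:
  assumes "complex X" "complex Y" "complex Z" "f \<in> chains X Y" "g \<in> chains Y Z"
  shows "(\<lambda>n. g n \<star> f n) \<in> chains X Z"
  by (rule chain_mapsI) (use assms in \<open>simp_all add: chain_mapsD[OF assms(4)] chain_mapsD[OF assms(5)]\<close>)

lemma chain_maps_Ide: "complex X \<Longrightarrow> (\<lambda>n. Ide C (Ter X n)) \<in> chains X X"
  by (rule chain_mapsI) simp_all

lemma chain_maps_Zero:
  "\<lbrakk>complex X; complex Y\<rbrakk> \<Longrightarrow> (zero_map X Y) \<in> chains X Y"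
  by (rule chain_mapsI) simp_all

lemma homotopic_Comp:
  assumes X: "complex X" and Y: "complex Y" and Z: "complex Z"
    and "f \<in> chains X Y" "f' \<in> chains X Y" "g \<in> chains Y Z" "g' \<in> chains Y Z"
    and "homotopic C X Y f f'" "homotopic C Y Z g g'"
  shows "homotopic C X Z (\<lambda>n. g n \<star> f n) (\<lambda>n. g' n \<star> f' n)"
  using homotopic_trans[OF X Z chain_maps_Comp[OF X Y Z assms(5,7)]
      homotopic_Comp_left[OF X Y Z assms(5,6,8)] homotopic_Comp_right[OF X Y Z assms(7,5,9)]] .

definition htpy :: "('o, 'a) cpx \<Rightarrow> ('o, 'a) cpx \<Rightarrow> (int \<Rightarrow> 'a) \<Rightarrow> ('o, 'a) htpy_arr" where
  "htpy X Y f = (X, Y, htpy_class C X Y f)"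

lemma htpy_class_self:
  "\<lbrakk>complex X; complex Y; f \<in> chains X Y\<rbrakk> \<Longrightarrow> f \<in> htpy_class C X Y f"
  by (simp add: htpy_class_def homotopic_refl)

lemma htpy_eq_iff:
  assumes XY: "complex X" "complex Y" and f: "f \<in> chains X Y" "g \<in> chains X Y"
  shows "htpy X Y f = htpy X Y g \<longleftrightarrow> homotopic C X Y f g"
proof
  assume "htpy X Y f = htpy X Y g"
  then have "g \<in> htpy_class C X Y f" using htpy_class_self assms by (simp add: htpy_def)
  then show "homotopic C X Y f g" by (simp add: htpy_class_def)
next
  assume fg: "homotopic C X Y f g"
  have "htpy_class C X Y f = htpy_class C X Y g"
    unfolding htpy_class_def
    using homotopic_trans[OF XY _ fg] homotopic_trans[OF XY _ homotopic_sym[OF XY f(2) fg]] by blast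
  then show "htpy X Y f = htpy X Y g" by (simp add: htpy_def)
qed

end

lemma with_triangles_simps [simp]:
  "Obj (with_triangles C S) = Obj C" "Arr (with_triangles C S) = Arr C" "Dom (with_triangles C S) = Dom C"
  "Cod (with_triangles C S) = Cod C" "Ide (with_triangles C S) = Ide C" "Comp (with_triangles C S) = Comp C"
  "Add (with_triangles C S) = Add C" "Zero (with_triangles C S) = Zero C" "Sh (with_triangles C S) = Sh C"
  "ShA (with_triangles C S) = ShA C"
  "Tri (with_triangles C S) = {t. candidate_triangle C t \<and> (\<exists>t' \<in> S. triangle_iso C t t')}"
  by (simp_all add: with_triangles_def shiftcat.extend_def tricat.fields_def)

section \<open>The homotopy category\<close>

context additive_category
begin

abbreviation "K \<equiv> homotopy_category C"
abbreviation comp\<^sub>K (infixr \<open>\<odot>\<close> 70) where "G \<odot> F \<equiv> G \<cdot>\<^bsub>K\<^esub> F"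

lemma K_simps [simp]:
  "Obj K = {X. complex X}" "Dom K (htpy X Y f) = X" "Cod K (htpy X Y f) = Y"
  "Sh K = shift_cpx C"
  by (simp_all add: homotopy_category_def homotopy_shiftcat_def htpy_def)

lemma K_Ide: "Ide K X = htpy X X (\<lambda>n. Ide C (Ter X n))"
  and K_Zero: "Zero K X Y = htpy X Y (zero_map X Y)"
  by (simp_all add: homotopy_category_def homotopy_shiftcat_def htpy_def)

lemma K_Arr: "Arr K = {htpy X Y f | X Y f. complex X \<and> complex Y \<and> f \<in> chains X Y}"
  by (simp add: homotopy_category_def homotopy_shiftcat_def htpy_def)

lemma K_ArrI: "\<lbrakk>complex X; complex Y; f \<in> chains X Y\<rbrakk> \<Longrightarrow> htpy X Y f \<in> Arr K"
  using K_Arr by blast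

lemma K_HomI: "\<lbrakk>complex X; complex Y; f \<in> chains X Y\<rbrakk> \<Longrightarrow> htpy X Y f \<in> Hom K X Y"
  using K_ArrI by (simp add: Hom_def)

lemma K_ArrE:
  assumes "F \<in> Arr K"
  obtains X Y f where "complex X" "complex Y" "f \<in> chains X Y" "F = htpy X Y f"
  using assms K_Arr by blast

lemma K_HomE:
  assumes "F \<in> Hom K X Y"
  obtains f where "complex X" "complex Y" "f \<in> chains X Y" "F = htpy X Y f"
  using assms by (auto simp: Hom_def elim: K_ArrE)

lemma K_Comp:
  assumes X: "complex X" and Y: "complex Y" and Z: "complex Z"
    and f: "f \<in> chains X Y" and g: "g \<in> chains Y Z"
  shows "htpy Y Z g \<odot> htpy X Y f = htpy X Z (\<lambda>n. g n \<star> f n)"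
proof -
  have "htpy_class C X Z (\<lambda>n. g' n \<star> f' n) = htpy_class C X Z (\<lambda>n. g n \<star> f n)"
    if "g' \<in> htpy_class C Y Z g" "f' \<in> htpy_class C X Y f" for g' f'
  proof -
    have fg': "f' \<in> chains X Y" "g' \<in> chains Y Z" "homotopic C X Y f f'" "homotopic C Y Z g g'"
      using that by (auto simp: htpy_class_def)
    have "htpy X Z (\<lambda>n. g n \<star> f n) = htpy X Z (\<lambda>n. g' n \<star> f' n)"
      using htpy_eq_iff[OF X Z] homotopic_Comp[OF X Y Z f fg'(1) g fg'(2-4)] chain_maps_Comp[OF X Y Z] f g fg'
      by blast
    then show ?thesis by (simp add: htpy_def)
  qed
  then have "(\<Union>g' \<in> htpy_class C Y Z g. \<Union>f' \<in> htpy_class C X Y f.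
      htpy_class C X Z (\<lambda>n. g' n \<star> f' n)) = htpy_class C X Z (\<lambda>n. g n \<star> f n)"
    using htpy_class_self[OF X Y f] htpy_class_self[OF Y Z g] by blast
  then show ?thesis
    by (simp add: homotopy_category_def homotopy_shiftcat_def htpy_def)
qed

lemma htpy_cong: "(\<And>n. f n = g n) \<Longrightarrow> htpy X Y f = htpy X Y g"
  by (simp add: ext[of f g])

sublocale K: category K
proof
  fix F assume "F \<in> Arr K"
  then show "Dom K F \<in> Obj K" "Cod K F \<in> Obj K" by (auto elim!: K_ArrE)
next
  fix X assume "X \<in> Obj K"
  then show "Ide K X \<in> Hom K X X" using K_HomI chain_maps_Ide by (simp add: K_Ide)
next
  fix X Y Z F G assume "F \<in> Hom K X Y" "G \<in> Hom K Y Z"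
  then show "G \<odot> F \<in> Hom K X Z"
    by (auto simp: K_Comp intro!: K_HomI chain_maps_Comp elim!: K_HomE)
next
  fix X Y F assume "F \<in> Hom K X Y"
  then obtain f where f: "complex X" "complex Y" "f \<in> chains X Y" "F = htpy X Y f"
    by (rule K_HomE)
  show "F \<odot> Ide K X = F" "Ide K Y \<odot> F = F"
    using f by (auto simp: K_Ide K_Comp chain_maps_Ide chain_mapsD[OF f(3)] intro!: htpy_cong)
next
  fix W X Y Z F G H assume F: "F \<in> Hom K W X" and G: "G \<in> Hom K X Y" and H: "H \<in> Hom K Y Z"
  obtain f where f: "complex W" "complex X" "f \<in> chains W X" "F = htpy W X f"
    using F by (rule K_HomE)
  obtain g where g: "complex Y" "g \<in> chains X Y" "G = htpy X Y g"
    using G by (rule K_HomE)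
  obtain h where h: "complex Z" "h \<in> chains Y Z" "H = htpy Y Z h"
    using H by (rule K_HomE)
  show "(H \<odot> G) \<odot> F = H \<odot> (G \<odot> F)"
    using f(1,2) g(1) h(1) unfolding f(4) g(3) h(3)
    by (simp add: K_Comp f(3) g(2) h(2) chain_maps_Comp chain_mapsD[OF f(3)] chain_mapsD[OF g(2)] chain_mapsD[OF h(2)])
qed

subsection \<open>The shift\<close>

lemma shift_simps [simp]: "Ter (shift_cpx C X) n = Ter X (n + 1)" "Dif (shift_cpx C X) n = Neg C (Dif X (n + 1))"
  by (simp_all add: shift_cpx_def)

lemma is_complex_shift [simp]: "complex X \<Longrightarrow> complex (shift_cpx C X)"
  by (rule is_complexI) simp_all

lemma chain_maps_shift:
  assumes "complex X" "complex Y" "f \<in> chains X Y"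
  shows "(\<lambda>n. f (n + 1)) \<in> chains (shift_cpx C X) (shift_cpx C Y)"
  by (rule chain_mapsI) (use assms in \<open>simp_all add: chain_mapsD[OF assms(3)]\<close>)

lemma homotopic_shift:
  assumes X: "complex X" and Y: "complex Y" and "homotopic C X Y f g"
  shows "homotopic C (shift_cpx C X) (shift_cpx C Y) (\<lambda>n. f (n + 1)) (\<lambda>n. g (n + 1))"
proof -
  obtain h where h: "\<And>n. arr (h n)" "\<And>n. dom (h n) = Ter X n" "\<And>n. cod (h n) = Ter Y (n - 1)"
    "\<And>n. f n = Add C (g n) (bdry X Y h n)"
    using homotopicD[OF assms(3)] by blast
  \<comment> \<open>The differential of the shift carries a sign, so the shifted homotopy must carry
    one as well.\<close>
  show ?thesis
    by (intro homotopicI[where h = "\<lambda>n. Neg C (h (n + 1))"]) (use X Y h(1-3) in \<open>simp_all add: h(4)\<close>)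
qed

lemma K_ShA:
  assumes X: "complex X" and Y: "complex Y" and f: "f \<in> chains X Y"
  shows "ShA K (htpy X Y f) = htpy (shift_cpx C X) (shift_cpx C Y) (\<lambda>n. f (n + 1))"
proof -
  have "htpy_class C (shift_cpx C X) (shift_cpx C Y) (\<lambda>n. f' (n + 1))
      = htpy_class C (shift_cpx C X) (shift_cpx C Y) (\<lambda>n. f (n + 1))" if "f' \<in> htpy_class C X Y f" for f'
  proof -
    have f': "f' \<in> chains X Y" "homotopic C X Y f f'" using that by (auto simp: htpy_class_def)
    then show ?thesis
      using htpy_eq_iff[of "shift_cpx C X" "shift_cpx C Y" "\<lambda>n. f (n + 1)" "\<lambda>n. f' (n + 1)"]
        homotopic_shift[OF X Y] chain_maps_shift[OF X Y] f X Y by (simp add: htpy_def)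
  qed
  then have "(\<Union>f' \<in> htpy_class C X Y f. htpy_class C (shift_cpx C X) (shift_cpx C Y) (\<lambda>n. f' (n + 1)))
      = htpy_class C (shift_cpx C X) (shift_cpx C Y) (\<lambda>n. f (n + 1))"
    using htpy_class_self[OF X Y f] by blast
  then show ?thesis
    by (simp add: homotopy_category_def homotopy_shiftcat_def htpy_def)
qed

lemma K_ShA_Ide: "complex X \<Longrightarrow> ShA K (Ide K X) = Ide K (shift_cpx C X)"
  by (simp add: K_Ide K_ShA chain_maps_Ide)

lemma K_ShA_Hom: "F \<in> Hom K X Y \<Longrightarrow> ShA K F \<in> Hom K (shift_cpx C X) (shift_cpx C Y)"
  by (auto elim!: K_HomE simp: K_ShA chain_maps_shift intro!: K_HomI)

lemma K_ShA_Comp: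
  assumes "F \<in> Hom K X Y" "G \<in> Hom K Y Z"
  shows "ShA K (G \<odot> F) = ShA K G \<odot> ShA K F"
  using assms by (auto elim!: K_HomE simp: K_Comp K_ShA chain_maps_shift chain_maps_Comp)

end

section \<open>Cones\<close>

lemma triangle_iso_with_triangles [simp]:
  "triangle_iso (with_triangles C S) = triangle_iso C"
  by (intro ext) (simp add: triangle_iso_def iso_arr_def Hom_def split: prod.splits)

lemma candidate_triangle_with_triangles [simp]:
  "candidate_triangle (with_triangles C S) = candidate_triangle C"
  by (intro ext) (simp add: candidate_triangle_def split: prod.splits)

text \<open>Distinguished triangles are the candidates isomorphic to a listed triangle, so a listed
  triangle is itself distinguished by means of identities. The last square then contains
  \<open>ShA\<close> of an identity, whence the hypothesis on \<open>ShA\<close>.\<close>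

lemma triangle_iso_refl:
  fixes T :: "('o, 'a, 'z) tricat_scheme"
  assumes "category T" "candidate_triangle T (u, v, w)"
    "ShA T (Ide T (Dom T u)) = Ide T (Sh T (Dom T u))"
  shows "triangle_iso T (u, v, w) (u, v, w)"
proof -
  interpret category T by fact
  have uvw: "u \<in> Arr T" "v \<in> Arr T" "w \<in> Arr T" "Dom T v = Cod T u" "Dom T w = Cod T v"
    "Cod T w = Sh T (Dom T u)"
    using assms(2) by (auto simp: candidate_triangle_def)
  then have "iso_arr T (Ide T (Dom T u))" "iso_arr T (Ide T (Dom T v))" "iso_arr T (Ide T (Dom T w))"
    "Ide T (Dom T u) \<in> Hom T (Dom T u) (Dom T u)" "Ide T (Dom T v) \<in> Hom T (Dom T v) (Dom T v)"
    "Ide T (Dom T w) \<in> Hom T (Dom T w) (Dom T w)"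
    using iso_arr_Ide Ide_Hom by auto
  moreover have "Ide T (Dom T v) \<cdot>\<^bsub>T\<^esub> u = u \<cdot>\<^bsub>T\<^esub> Ide T (Dom T u)"
    "Ide T (Dom T w) \<cdot>\<^bsub>T\<^esub> v = v \<cdot>\<^bsub>T\<^esub> Ide T (Dom T v)"
    "ShA T (Ide T (Dom T u)) \<cdot>\<^bsub>T\<^esub> w = w \<cdot>\<^bsub>T\<^esub> Ide T (Dom T w)"
    using uvw assms(3) by simp_all
  ultimately show ?thesis unfolding triangle_iso_def by blast
qed

context additive_category
begin

text \<open>The triangle uses only \<open>cone_in\<close> and \<open>cone_out\<close>. The other two
  maps of the same chosen biproduct complete them to coordinates in each degree; they need not form
  chain maps.\<close>

definition cone_inl :: "('o, 'a) cpx \<Rightarrow> ('o, 'a) cpx \<Rightarrow> int \<Rightarrow> 'a" where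
  "cone_inl X Y n = (case cone_biprod C X Y n of (S, i\<^sub>1, i\<^sub>2, p\<^sub>1, p\<^sub>2) \<Rightarrow> i\<^sub>1)"

definition cone_proj :: "('o, 'a) cpx \<Rightarrow> ('o, 'a) cpx \<Rightarrow> int \<Rightarrow> 'a" where
  "cone_proj X Y n = (case cone_biprod C X Y n of (S, i\<^sub>1, i\<^sub>2, p\<^sub>1, p\<^sub>2) \<Rightarrow> p\<^sub>2)"

definition cone_obj :: "('o, 'a) cpx \<Rightarrow> ('o, 'a) cpx \<Rightarrow> int \<Rightarrow> 'o" where
  "cone_obj X Y n = fst (cone_biprod C X Y n)"

abbreviation (input) "cin \<equiv> cone_in C"
abbreviation (input) "cout \<equiv> cone_out C"

lemma cone_biprod_is_biproduct:
  assumes "complex X" "complex Y"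
  shows "is_biproduct C (Ter X (n + 1)) (Ter Y n)
    (cone_obj X Y n, cone_inl X Y n, cin X Y n, cout X Y n, cone_proj X Y n)"
proof -
  have "is_biproduct C (Ter X (n + 1)) (Ter Y n) (cone_biprod C X Y n)"
    unfolding cone_biprod_def biprod_def by (rule someI_ex, rule ex_biproduct) (use assms in simp_all)
  then show ?thesis
    by (cases "cone_biprod C X Y n")
      (simp add: cone_obj_def cone_inl_def cone_in_def cone_out_def cone_proj_def)
qed

lemma cone_arrows [simp]:
  assumes "complex X" "complex Y"
  shows "arr (cone_inl X Y n)" "dom (cone_inl X Y n) = Ter X (n + 1)" "cod (cone_inl X Y n) = cone_obj X Y n"
    "arr (cin X Y n)" "dom (cin X Y n) = Ter Y n" "cod (cin X Y n) = cone_obj X Y n"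
    "arr (cout X Y n)" "dom (cout X Y n) = cone_obj X Y n" "cod (cout X Y n) = Ter X (n + 1)"
    "arr (cone_proj X Y n)" "dom (cone_proj X Y n) = cone_obj X Y n" "cod (cone_proj X Y n) = Ter Y n"
    "cone_obj X Y n \<in> Obj C"
  using cone_biprod_is_biproduct[OF assms, of n] Dom_Obj[of "cone_proj X Y n"]
  by (auto simp: is_biproduct_def Hom_def)

lemma cone_equations:
  assumes "complex X" "complex Y"
  shows "cout X Y n \<star> cone_inl X Y n = Ide C (Ter X (n + 1))"
    "cone_proj X Y n \<star> cin X Y n = Ide C (Ter Y n)"
    "cone_proj X Y n \<star> cone_inl X Y n = Zero C (Ter X (n + 1)) (Ter Y n)"
    "cout X Y n \<star> cin X Y n = Zero C (Ter Y n) (Ter X (n + 1))"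
    "Add C (cone_inl X Y n \<star> cout X Y n) (cin X Y n \<star> cone_proj X Y n) = Ide C (cone_obj X Y n)"
  using cone_biprod_is_biproduct[OF assms, of n] by (auto simp: is_biproduct_def)

lemma cone_equations_Comp:
  assumes XY: "complex X" "complex Y" and "arr x"
  shows "cod x = Ter X (n + 1) \<Longrightarrow> cout X Y n \<star> (cone_inl X Y n \<star> x) = x"
    "cod x = Ter Y n \<Longrightarrow> cone_proj X Y n \<star> (cin X Y n \<star> x) = x"
    "cod x = Ter X (n + 1) \<Longrightarrow> cone_proj X Y n \<star> (cone_inl X Y n \<star> x) = Zero C (dom x) (Ter Y n)"
    "cod x = Ter Y n \<Longrightarrow> cout X Y n \<star> (cin X Y n \<star> x) = Zero C (dom x) (Ter X (n + 1))"
  using assms Comp_assoc_eq[of x "cone_inl X Y n" "cout X Y n", symmetric]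
    Comp_assoc_eq[of x "cin X Y n" "cout X Y n", symmetric]
    Comp_assoc_eq[of x "cone_inl X Y n" "cone_proj X Y n", symmetric]
    Comp_assoc_eq[of x "cin X Y n" "cone_proj X Y n", symmetric]
  by (simp_all add: cone_equations[OF XY] del: Comp_assoc_eq)

text \<open>The biproduct identity recovers \<open>z\<close> from its two coordinates. Every
  equation between maps into a cone is checked this way, one row of the matrix at a time.\<close>

lemma cone_ext:
  assumes XY: "complex X" "complex Y"
    and z: "arr z" "cod z = cone_obj X Y n" "arr z'" "cod z' = cone_obj X Y n"
    and eq: "cout X Y n \<star> z = cout X Y n \<star> z'" "cone_proj X Y n \<star> z = cone_proj X Y n \<star> z'"
  shows "z = z'"
proof -
  have *: "Add C (cone_inl X Y n \<star> (cout X Y n \<star> w)) (cin X Y n \<star> (cone_proj X Y n \<star> w)) = w"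
    if "arr w" "cod w = cone_obj X Y n" for w
  proof -
    have "Add C (cone_inl X Y n \<star> (cout X Y n \<star> w)) (cin X Y n \<star> (cone_proj X Y n \<star> w)) =
      Add C (cone_inl X Y n \<star> cout X Y n) (cin X Y n \<star> cone_proj X Y n) \<star> w"
      using XY that by simp
    also have "\<dots> = w" using cone_equations(5)[OF XY] that by simp
    finally show ?thesis .
  qed
  show ?thesis using *[OF z(1,2)] *[OF z(3,4)] unfolding eq by (rule trans[OF sym])
qed

definition cone_pair :: "('o, 'a) cpx \<Rightarrow> ('o, 'a) cpx \<Rightarrow> int \<Rightarrow> 'a \<Rightarrow> 'a \<Rightarrow> 'a" where
  "cone_pair X Y n x y = Add C (cone_inl X Y n \<star> x) (cin X Y n \<star> y)"

lemma cone_pair [simp]: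
  assumes XY: "complex X" "complex Y"
    and xy: "arr x" "arr y" "dom y = dom x" "cod x = Ter X (n + 1)" "cod y = Ter Y n"
  shows "arr (cone_pair X Y n x y)" "dom (cone_pair X Y n x y) = dom x"
    "cod (cone_pair X Y n x y) = cone_obj X Y n"
    "cout X Y n \<star> cone_pair X Y n x y = x" "cone_proj X Y n \<star> cone_pair X Y n x y = y"
  unfolding cone_pair_def using assms by (simp_all add: cone_equations_Comp)

lemma Ter_cone [simp]: "Ter (cone C X Y f) n = cone_obj X Y n"
  by (simp add: cone_def cone_obj_def)

lemma Dif_cone:
  "Dif (cone C X Y f) n = Add C (cone_inl X Y (n + 1) \<star> Neg C (Dif X (n + 1)) \<star> cout X Y n)
    (Add C (cin X Y (n + 1) \<star> f (n + 1) \<star> cout X Y n) (cin X Y (n + 1) \<star> Dif Y n \<star> cone_proj X Y n))"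
  by (simp add: cone_def cone_inl_def cone_in_def cone_out_def cone_proj_def split: prod.splits)

lemma cone_Dif [simp]:
  assumes X: "complex X" and Y: "complex Y" and f: "f \<in> chains X Y"
  shows "arr (Dif (cone C X Y f) n)" "dom (Dif (cone C X Y f) n) = cone_obj X Y n"
    "cod (Dif (cone C X Y f) n) = cone_obj X Y (n + 1)"
    "m = n + 1 \<Longrightarrow> cout X Y m \<star> Dif (cone C X Y f) n = Neg C (Dif X m \<star> cout X Y n)"
    "m = n + 1 \<Longrightarrow> cone_proj X Y m \<star> Dif (cone C X Y f) n =
       Add C (f m \<star> cout X Y n) (Dif Y n \<star> cone_proj X Y n)"
  unfolding Dif_cone using X Y by (simp_all add: chain_mapsD[OF f] cone_equations_Comp)

lemma cone_Dif_Comp [simp]: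
  assumes X: "complex X" and Y: "complex Y" and f: "f \<in> chains X Y"
    and z: "arr z" "cod z = cone_obj X Y n" and m: "m = n + 1"
  shows "cout X Y m \<star> (Dif (cone C X Y f) n \<star> z) = Neg C (Dif X m \<star> (cout X Y n \<star> z))"
    "cone_proj X Y m \<star> (Dif (cone C X Y f) n \<star> z) =
       Add C (f m \<star> (cout X Y n \<star> z)) (Dif Y n \<star> (cone_proj X Y n \<star> z))"
proof -
  have "cout X Y m \<star> (Dif (cone C X Y f) n \<star> z) = (cout X Y m \<star> Dif (cone C X Y f) n) \<star> z"
    using X Y f z m by (intro Comp_assoc_eq[symmetric]) auto
  also have "\<dots> = Neg C (Dif X m \<star> (cout X Y n \<star> z))"
    unfolding cone_Dif(4)[OF X Y f m] using X Y z m by simp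
  finally show "cout X Y m \<star> (Dif (cone C X Y f) n \<star> z) = \<dots>" .
  have "cone_proj X Y m \<star> (Dif (cone C X Y f) n \<star> z) = (cone_proj X Y m \<star> Dif (cone C X Y f) n) \<star> z"
    using X Y f z m by (intro Comp_assoc_eq[symmetric]) auto
  also have "\<dots> = Add C (f m \<star> (cout X Y n \<star> z)) (Dif Y n \<star> (cone_proj X Y n \<star> z))"
    unfolding cone_Dif(5)[OF X Y f m] using X Y z m by (simp add: chain_mapsD[OF f])
  finally show "cone_proj X Y m \<star> (Dif (cone C X Y f) n \<star> z) = \<dots>" .
qed

lemma is_complex_cone:
  assumes X: "complex X" and Y: "complex Y" and f: "f \<in> chains X Y"
  shows "complex (cone C X Y f)"
proof (rule is_complexI)
  fix n
  show "Dif (cone C X Y f) (n + 1) \<star> Dif (cone C X Y f) n =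
    Zero C (Ter (cone C X Y f) n) (Ter (cone C X Y f) (n + 2))"
    by (rule cone_ext[OF X Y, of _ "n + 2"]) (use X Y f in \<open>simp_all add: chain_mapsD[OF f]\<close>)
qed (use X Y f in simp_all)

lemma chain_maps_cone_in:
  assumes X: "complex X" and Y: "complex Y" and f: "f \<in> chains X Y"
  shows "cin X Y \<in> chains Y (cone C X Y f)"
proof (rule chain_mapsI)
  fix n
  show "cin X Y (n + 1) \<star> Dif Y n = Dif (cone C X Y f) n \<star> cin X Y n"
    by (rule cone_ext[OF X Y, of _ "n + 1"])
      (use X Y f in \<open>simp_all add: chain_mapsD[OF f] cone_equations cone_equations_Comp\<close>)
qed (use X Y f in simp_all)

lemma chain_maps_cone_out:
  assumes X: "complex X" and Y: "complex Y" and f: "f \<in> chains X Y"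
  shows "cout X Y \<in> chains (cone C X Y f) (shift_cpx C X)"
  by (rule chain_mapsI) (use X Y f in simp_all)

lemma standard_triangle_eq: "standard_triangle C X Y f =
  (htpy X Y f, htpy Y (cone C X Y f) (cin X Y), htpy (cone C X Y f) (shift_cpx C X) (cout X Y))"
  by (simp add: standard_triangle_def htpy_def)

lemma K_Tri: "Tri K = {t. candidate_triangle K t \<and> (\<exists>X Y f. complex X \<and> complex Y \<and>
    f \<in> chains X Y \<and> triangle_iso K t (standard_triangle C X Y f))}"
  unfolding homotopy_category_def with_triangles_simps triangle_iso_with_triangles
    candidate_triangle_with_triangles by blast

lemma standard_triangle_candidate:
  assumes X: "complex X" and Y: "complex Y" and f: "f \<in> chains X Y"
  shows "candidate_triangle K (standard_triangle C X Y f)"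
  unfolding standard_triangle_eq candidate_triangle_def
  using X Y f is_complex_cone[OF X Y f] chain_maps_cone_in[OF X Y f] chain_maps_cone_out[OF X Y f]
  by (simp add: K_ArrI)

lemma standard_triangle_Tri:
  assumes X: "complex X" and Y: "complex Y" and f: "f \<in> chains X Y"
  shows "standard_triangle C X Y f \<in> Tri K"
proof -
  have "triangle_iso K (standard_triangle C X Y f) (standard_triangle C X Y f)"
    unfolding standard_triangle_eq
    by (rule triangle_iso_refl[OF K.category_axioms])
      (use standard_triangle_candidate[OF assms] K_ShA_Ide[OF X] in \<open>simp_all add: standard_triangle_eq\<close>)
  then show ?thesis
    unfolding K_Tri using X Y f standard_triangle_candidate[OF assms] by blast
qed

lemma K_TriE:
  assumes "(u, v, w) \<in> Tri K"
  obtains X Y f a b c where "complex X" "complex Y" "f \<in> chains X Y"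
    "u \<in> Arr K" "v \<in> Arr K"
    "iso_arr K a" "iso_arr K b" "iso_arr K c" "a \<in> Hom K (Dom K u) X" "b \<in> Hom K (Cod K u) Y"
    "c \<in> Hom K (Cod K v) (cone C X Y f)" "b \<odot> u = htpy X Y f \<odot> a"
proof -
  obtain X Y f where XY: "complex X" "complex Y" "f \<in> chains X Y"
    and iso: "triangle_iso K (u, v, w) (standard_triangle C X Y f)"
    and cand: "candidate_triangle K (u, v, w)"
    using assms unfolding K_Tri by blast
  show ?thesis
    using iso cand that[OF XY] unfolding standard_triangle_eq
    by (auto simp: triangle_iso_def candidate_triangle_def)
qed

lemma denominators_K_I:
  assumes "complex X" "complex Y" "f \<in> chains X Y" "cone C X Y f \<in> N"
  shows "htpy X Y f \<in> denominators K N"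
  using standard_triangle_Tri[OF assms(1-3)] assms K_ArrI
  unfolding denominators_def standard_triangle_eq by fastforce

lemma denominators_K_E:
  assumes "F \<in> denominators K N" "iso_closed K N"
  obtains X Y f a b where "complex X" "complex Y" "f \<in> chains X Y"
    "iso_arr K a" "iso_arr K b" "a \<in> Hom K (Dom K F) X" "b \<in> Hom K (Cod K F) Y"
    "b \<odot> F = htpy X Y f \<odot> a" "cone C X Y f \<in> N"
proof -
  obtain v w where F: "(F, v, w) \<in> Tri K" "Cod K v \<in> N"
    using assms by (auto simp: denominators_def)
  obtain X Y f a b c where *: "complex X" "complex Y" "f \<in> chains X Y"
    "iso_arr K a" "iso_arr K b" "iso_arr K c" "a \<in> Hom K (Dom K F) X" "b \<in> Hom K (Cod K F) Y"
    "c \<in> Hom K (Cod K v) (cone C X Y f)" "b \<odot> F = htpy X Y f \<odot> a"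
    using F(1) by (rule K_TriE)
  then have "isomorphic K (Cod K v) (cone C X Y f)" by (auto simp: isomorphic_def)
  then have "cone C X Y f \<in> N"
    using assms(2) F(2) is_complex_cone[OF *(1-3)] by (auto simp: iso_closed_def)
  then show ?thesis using that * by blast
qed

end

section \<open>Local exactness\<close>

context conflation_category
begin

lemma deflation_Arr [simp]: "deflation C p \<Longrightarrow> arr p"
  using Conf_pair by (auto simp: deflation_def kernel_cokernel_pair_def is_cokernel_def)

abbreviation locally_boundary :: "('o, 'a) cpx \<Rightarrow> int \<Rightarrow> 'a \<Rightarrow> bool" where
  "locally_boundary X n x \<equiv> \<exists>a b. deflation C a \<and> cod a = dom x \<and> arr b \<and> dom b = dom a \<and>
     cod b = Ter X (n - 1) \<and> x \<star> a = Dif X (n - 1) \<star> b"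

abbreviation locally_image :: "('o, 'a) cpx \<Rightarrow> ('o, 'a) cpx \<Rightarrow> 'a \<Rightarrow> int \<Rightarrow> 'a \<Rightarrow> bool" where
  "locally_image X Y f n y \<equiv> \<exists>a x b. deflation C a \<and> cod a = dom y \<and>
     arr x \<and> dom x = dom a \<and> cod x = Ter X n \<and> arr b \<and> dom b = dom a \<and> cod b = Ter Y (n - 1) \<and>
     cocycle X n x \<and> y \<star> a = Add C (f \<star> x) (Dif Y (n - 1) \<star> b)"

definition exact_at :: "('o, 'a) cpx \<Rightarrow> int \<Rightarrow> bool" where
  "exact_at X n \<longleftrightarrow> (\<forall>x \<in> Arr C. cod x = Ter X n \<and> cocycle X n x \<longrightarrow>
     locally_boundary X n x)"

lemma exact_atE:
  assumes "exact_at X n" "arr x" "cod x = Ter X n" "cocycle X n x"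
  obtains a b where "deflation C a" "cod a = dom x" "arr b" "dom b = dom a"
    "cod b = Ter X (n - 1)" "x \<star> a = Dif X (n - 1) \<star> b"
  using assms unfolding exact_at_def by blast

lemma exact_atI:
  assumes "\<And>x. \<lbrakk>arr x; cod x = Ter X n; cocycle X n x\<rbrakk> \<Longrightarrow>
     locally_boundary X n x"
  shows "exact_at X n"
  using assms unfolding exact_at_def by blast

text \<open>Surjectivity of the induced map on \<open>n\<close>-th cohomology sheaves: after a
  cover, a cocycle of \<open>Y\<close> comes from a cocycle of \<open>X\<close> up to a
  boundary.\<close>

definition H_surj :: "('o, 'a) cpx \<Rightarrow> ('o, 'a) cpx \<Rightarrow> (int \<Rightarrow> 'a) \<Rightarrow> int \<Rightarrow> bool" where
  "H_surj X Y f n \<longleftrightarrow> (\<forall>y \<in> Arr C. cod y = Ter Y n \<and> cocycle Y n y \<longrightarrow>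
     locally_image X Y (f n) n y)"

lemma H_surjE:
  assumes "H_surj X Y f n" "arr y" "cod y = Ter Y n" "cocycle Y n y"
  obtains a x b where "deflation C a" "cod a = dom y" "arr x" "dom x = dom a" "cod x = Ter X n"
    "arr b" "dom b = dom a" "cod b = Ter Y (n - 1)" "cocycle X n x"
    "y \<star> a = Add C (f n \<star> x) (Dif Y (n - 1) \<star> b)"
  using assms unfolding H_surj_def by blast

lemma H_surjI:
  assumes "\<And>y. \<lbrakk>arr y; cod y = Ter Y n; cocycle Y n y\<rbrakk> \<Longrightarrow>
     locally_image X Y (f n) n y"
  shows "H_surj X Y f n"
  using assms unfolding H_surj_def by blast

text \<open>Injectivity of the induced map on \<open>n\<close>-th cohomology sheaves. The image of
  \<open>x\<close> is assumed to be an actual boundary; when it is one only locally, the condition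
  is applied after passing to the cover.\<close>

definition H_inj :: "('o, 'a) cpx \<Rightarrow> ('o, 'a) cpx \<Rightarrow> (int \<Rightarrow> 'a) \<Rightarrow> int \<Rightarrow> bool" where
  "H_inj X Y f n \<longleftrightarrow> (\<forall>x \<in> Arr C. \<forall>y \<in> Arr C. dom y = dom x \<and> cod x = Ter X n \<and> cod y = Ter Y (n - 1) \<and>
     cocycle X n x \<and> f n \<star> x = Dif Y (n - 1) \<star> y \<longrightarrow>
     locally_boundary X n x)"

lemma H_injE:
  assumes "H_inj X Y f n" "arr x" "arr y" "dom y = dom x" "cod x = Ter X n" "cod y = Ter Y (n - 1)"
    "cocycle X n x" "f n \<star> x = Dif Y (n - 1) \<star> y"
  obtains a b where "deflation C a" "cod a = dom x" "arr b" "dom b = dom a"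
    "cod b = Ter X (n - 1)" "x \<star> a = Dif X (n - 1) \<star> b"
  using assms unfolding H_inj_def by blast

lemma H_injI:
  assumes "\<And>x y. \<lbrakk>arr x; arr y; dom y = dom x; cod x = Ter X n; cod y = Ter Y (n - 1);
     cocycle X n x; f n \<star> x = Dif Y (n - 1) \<star> y\<rbrakk> \<Longrightarrow>
     locally_boundary X n x"
  shows "H_inj X Y f n"
  using assms unfolding H_inj_def by blast

definition qis :: "('o, 'a) cpx \<Rightarrow> ('o, 'a) cpx \<Rightarrow> (int \<Rightarrow> 'a) \<Rightarrow> bool" where
  "qis X Y f \<longleftrightarrow> (\<forall>n. H_surj X Y f n \<and> H_inj X Y f n)"

end

section \<open>Induced maps on cohomology: homotopy, composition, cancellation\<close>

context deflation_exact_category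
begin

text \<open>No axiom mentions identities. By (R0) the identity of a zero object is a deflation, and
  \<open>Ide C X\<close> is its pullback along \<open>X \<rightarrow> 0\<close>, so (R2) applies.
  This is the trivial cover.\<close>

lemma deflation_Ide:
  assumes X: "X \<in> Obj C"
  shows "deflation C (Ide C X)"
proof -
  obtain Z where Z: "zero_obj C Z" using ex_zero_obj by blast
  then have ZO: "Z \<in> Obj C" by (simp add: zero_obj_def)
  then obtain t where t: "t \<in> Hom C X Z" using Z X by (auto simp: zero_obj_def)
  have "deflation C (Ide C Z)" using R0[OF Z Ide_Hom[OF ZO]] .
  moreover have "is_pullback C (Ide C Z) t (Ide C X) t"
    unfolding is_pullback_def
  proof (intro conjI ballI impI)
    fix u v assume uv: "arr u" "arr v"
      "dom u = dom v \<and> cod u = dom t \<and> cod v = dom (Ide C Z) \<and> t \<star> u = Ide C Z \<star> v"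
    show "\<exists>!h. h \<in> Hom C (dom u) (dom (Ide C X)) \<and> Ide C X \<star> h = u \<and> t \<star> h = v"
    proof (rule ex1I[of _ u])
      have "v = t \<star> u" using uv ZO by simp
      then show "u \<in> Hom C (dom u) (dom (Ide C X)) \<and> Ide C X \<star> u = u \<and> t \<star> u = v"
        using uv(1,3) HomD[OF t] X by (simp add: Hom_def)
      show "h = u" if "h \<in> Hom C (dom u) (dom (Ide C X)) \<and> Ide C X \<star> h = u \<and> t \<star> h = v" for h
        using that X by (auto simp: Hom_def)
    qed
  qed (use t X ZO in \<open>auto simp: Hom_def\<close>)
  ultimately show ?thesis by (rule R2)
qed

lemma deflation_Comp: "\<lbrakk>deflation C p; deflation C q; dom q = cod p\<rbrakk> \<Longrightarrow> deflation C (q \<star> p)"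
  by (rule R1)

text \<open>On a cocycle \<open>x\<close> the half \<open>h (n + 1) \<star> Dif X n\<close> of the
  homotopy vanishes, and the other half is a boundary that is absorbed into
  \<open>b\<close>.\<close>

lemma H_surj_homotopic:
  assumes X: "complex X" and Y: "complex Y" and g: "g \<in> chains X Y"
    and fg: "homotopic C X Y f g" and f: "H_surj X Y f n"
  shows "H_surj X Y g n"
proof (rule H_surjI)
  obtain h where h: "\<And>n. arr (h n)" "\<And>n. dom (h n) = Ter X n" "\<And>n. cod (h n) = Ter Y (n - 1)"
    "\<And>n. f n = Add C (g n) (bdry X Y h n)"
    using homotopicD[OF fg] by blast
  note gD = chain_mapsD[OF g]
  fix y assume y: "arr y" "cod y = Ter Y n" "cocycle Y n y"
  obtain a x b where axb: "deflation C a" "cod a = dom y" "arr x" "dom x = dom a" "cod x = Ter X n"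
    "arr b" "dom b = dom a" "cod b = Ter Y (n - 1)" "cocycle X n x"
    "y \<star> a = Add C (f n \<star> x) (Dif Y (n - 1) \<star> b)"
    using f y by (rule H_surjE)
  have "y \<star> a = Add C (g n \<star> x) (Dif Y (n - 1) \<star> Add C (h n \<star> x) b)"
    using X Y h(1-3) axb gD by (simp add: h(4) Add_assoc[of _ "dom a" "Ter Y n"] Hom_def)
  then show "locally_image X Y (g n) n y"
    using axb h(1-3) by (intro exI[of _ a] exI[of _ x] exI[of _ "Add C (h n \<star> x) b"]) simp
qed

lemma H_inj_homotopic:
  assumes X: "complex X" and Y: "complex Y" and f: "f \<in> chains X Y" "g \<in> chains X Y"
    and "homotopic C X Y f g" and inj: "H_inj X Y f n"
  shows "H_inj X Y g n"
proof (rule H_injI)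
  obtain h where h: "\<And>n. arr (h n)" "\<And>n. dom (h n) = Ter X n" "\<And>n. cod (h n) = Ter Y (n - 1)"
    "\<And>n. f n = Add C (g n) (bdry X Y h n)"
    using homotopicD[OF assms(5)] by blast
  fix x y assume xy: "arr x" "arr y" "dom y = dom x" "cod x = Ter X n" "cod y = Ter Y (n - 1)"
     "cocycle X n x" "g n \<star> x = Dif Y (n - 1) \<star> y"
  have "f n \<star> x = Dif Y (n - 1) \<star> Add C y (h n \<star> x)"
    using X Y h(1-3) xy chain_mapsD[OF f(2)] by (simp add: h(4))
  then show "locally_boundary X n x"
    using H_injE[OF inj xy(1), of "Add C y (h n \<star> x)"] xy h(1-3)
    by (metis Add_typing Comp_typing)
qed

lemma qis_homotopic:
  assumes "complex X" "complex Y" "f \<in> chains X Y" "g \<in> chains X Y"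
    and "homotopic C X Y f g" "qis X Y f"
  shows "qis X Y g"
  using assms H_inj_homotopic H_surj_homotopic unfolding qis_def by blast

lemma H_surj_Comp:
  assumes X: "complex X" and Y: "complex Y" and Z: "complex Z"
    and f: "f \<in> chains X Y" and g: "g \<in> chains Y Z"
    and sf: "H_surj X Y f n" and sg: "H_surj Y Z g n"
  shows "H_surj X Z (\<lambda>n. g n \<star> f n) n"
proof (rule H_surjI)
  note fD = chain_mapsD[OF f] and gD = chain_mapsD[OF g]
  fix z assume z: "arr z" "cod z = Ter Z n" "cocycle Z n z"
  obtain a y b where ayb: "deflation C a" "cod a = dom z" "arr y" "dom y = dom a" "cod y = Ter Y n"
    "arr b" "dom b = dom a" "cod b = Ter Z (n - 1)" "cocycle Y n y"
    "z \<star> a = Add C (g n \<star> y) (Dif Z (n - 1) \<star> b)"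
    using sg z by (rule H_surjE)
  obtain a' x b' where axb: "deflation C a'" "cod a' = dom y" "arr x" "dom x = dom a'" "cod x = Ter X n"
    "arr b'" "dom b' = dom a'" "cod b' = Ter Y (n - 1)" "cocycle X n x"
    "y \<star> a' = Add C (f n \<star> x) (Dif Y (n - 1) \<star> b')"
    using sf ayb(3,5,9) by (rule H_surjE)
  have "z \<star> (a \<star> a') = Add C (g n \<star> y) (Dif Z (n - 1) \<star> b) \<star> a'"
    by (rule precomp_eq[OF ayb(10)]) (use z ayb(1-9) axb(1-9) in auto)
  also have "\<dots> = Add C (g n \<star> (f n \<star> x)) (Dif Z (n - 1) \<star> Add C (g (n - 1) \<star> b') (b \<star> a'))"
    using X Y Z z ayb(1-9) axb by (simp add: fD gD Add_assoc[of _ "dom a'" "Ter Z n"] Hom_def)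
  finally show "locally_image X Z (g n \<star> f n) n z"
    using X Y Z z ayb(1-9) axb(1-9) fD gD
    by (intro exI[of _ "a \<star> a'"] exI[of _ x] exI[of _ "Add C (g (n - 1) \<star> b') (b \<star> a')"])
      (simp add: deflation_Comp)
qed

lemma H_inj_Comp:
  assumes X: "complex X" and Y: "complex Y" and Z: "complex Z"
    and f: "f \<in> chains X Y" and g: "g \<in> chains Y Z"
    and "H_inj X Y f n" and "H_inj Y Z g n"
  shows "H_inj X Z (\<lambda>n. g n \<star> f n) n"
proof (rule H_injI)
  note fD = chain_mapsD[OF f] and gD = chain_mapsD[OF g]
  fix x z assume xz: "arr x" "arr z" "dom z = dom x" "cod x = Ter X n" "cod z = Ter Z (n - 1)"
     "cocycle X n x" "(g n \<star> f n) \<star> x = Dif Z (n - 1) \<star> z"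
  have dfx: "cocycle Y n (f n \<star> x)"
    using fD(5)[OF X Y refl xz(1,4)] X Y xz fD by simp
  obtain a b where ab: "deflation C a" "cod a = dom (f n \<star> x)" "arr b" "dom b = dom a"
    "cod b = Ter Y (n - 1)" "(f n \<star> x) \<star> a = Dif Y (n - 1) \<star> b"
    by (rule H_injE[OF assms(7), of "f n \<star> x" z]) (use X Y Z xz fD gD dfx in auto)
  have dxa: "Dif X n \<star> (x \<star> a) = Zero C (dom x) (Ter X (n + 1)) \<star> a"
    by (rule precomp_eq[OF xz(6)]) (use X xz ab fD in auto)
  obtain a' b' where ab': "deflation C a'" "cod a' = dom (x \<star> a)" "arr b'" "dom b' = dom a'"
    "cod b' = Ter X (n - 1)" "(x \<star> a) \<star> a' = Dif X (n - 1) \<star> b'"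
    by (rule H_injE[OF assms(6), of "x \<star> a" b]) (use X Y Z xz fD gD ab dxa in auto)
  show "locally_boundary X n x"
    using X Y xz ab ab' fD
    by (intro exI[of _ "a \<star> a'"] exI[of _ b']) (simp add: deflation_Comp)
qed

lemma qis_Comp:
  assumes "complex X" "complex Y" "complex Z" "f \<in> chains X Y" "g \<in> chains Y Z"
    "qis X Y f" "qis Y Z g"
  shows "qis X Z (\<lambda>n. g n \<star> f n)"
  using assms H_surj_Comp H_inj_Comp unfolding qis_def by blast

lemma H_inj_of_Comp:
  assumes X: "complex X" and Y: "complex Y" and Z: "complex Z"
    and f: "f \<in> chains X Y" and g: "g \<in> chains Y Z"
    and i: "H_inj X Z (\<lambda>n. g n \<star> f n) n"
  shows "H_inj X Y f n"
proof (rule H_injI)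
  note fD = chain_mapsD[OF f] and gD = chain_mapsD[OF g]
  fix x y assume xy: "arr x" "arr y" "dom y = dom x" "cod x = Ter X n" "cod y = Ter Y (n - 1)"
     "cocycle X n x" "f n \<star> x = Dif Y (n - 1) \<star> y"
  have "(g n \<star> f n) \<star> x = Dif Z (n - 1) \<star> (g (n - 1) \<star> y)"
    using X Y Z xy by (simp add: fD gD)
  then show "locally_boundary X n x"
    using H_injE[OF i xy(1), of "g (n - 1) \<star> y"] xy fD(1-3) gD(1-3)
    by (metis Comp_typing)
qed

text \<open>For surjectivity, the composite gives locally \<open>g y = g (f x) + d b\<close>, so the
  cocycle \<open>y - f x\<close> has a boundary as its image under \<open>g\<close>. Injectivity of
  \<open>g\<close> makes it a local boundary, which exhibits \<open>y\<close> as \<open>f x\<close>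
  plus a boundary. This becomes \<open>den_cancel\<close>.\<close>

lemma qis_cancel:
  assumes X: "complex X" and Y: "complex Y" and Z: "complex Z"
    and f: "f \<in> chains X Y" and g: "g \<in> chains Y Z"
    and "qis Y Z g" "qis X Z (\<lambda>n. g n \<star> f n)"
  shows "qis X Y f"
  unfolding qis_def
proof (intro allI conjI)
  note fD = chain_mapsD[OF f] and gD = chain_mapsD[OF g]
  fix n
  have gi: "H_inj Y Z g n" and s: "H_surj X Z (\<lambda>n. g n \<star> f n) n" and i: "H_inj X Z (\<lambda>n. g n \<star> f n) n"
    using assms(6,7) by (auto simp: qis_def)
  show "H_inj X Y f n" by (rule H_inj_of_Comp[OF X Y Z f g i])
  show "H_surj X Y f n"
  proof (rule H_surjI)
    fix y assume y: "arr y" "cod y = Ter Y n" "cocycle Y n y"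
    have dgy: "cocycle Z n (g n \<star> y)"
      using gD(5)[OF Y Z refl y(1,2)] Y Z y by (simp add: gD(1-3))
    obtain a x b where axb: "deflation C a" "cod a = dom (g n \<star> y)" "arr x" "dom x = dom a" "cod x = Ter X n"
      "arr b" "dom b = dom a" "cod b = Ter Z (n - 1)" "cocycle X n x"
      "(g n \<star> y) \<star> a = Add C ((g n \<star> f n) \<star> x) (Dif Z (n - 1) \<star> b)"
      by (rule H_surjE[OF s _ _ dgy]) (use Y Z y in \<open>simp_all add: gD(1-3)\<close>)
    have axb': "cod a = dom y" using axb(2) y by (simp add: gD)
    let ?w = "Add C (y \<star> a) (Neg C (f n \<star> x))"
    have w: "arr (?w)" "dom ?w = dom a" "cod ?w = Ter Y n"
      using X Y y axb(1-9) axb' by (simp_all add: fD)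
    have gw: "g n \<star> ?w = Dif Z (n - 1) \<star> b"
      using X Y Z y axb(1-9) axb'
        Add_Neg_eq[of "g n \<star> (y \<star> a)" "dom a" "Ter Z n" "g n \<star> (f n \<star> x)" "Dif Z (n - 1) \<star> b"]
        axb(10)
      by (simp add: fD(1-3) gD(1-3) Hom_def)
    have "Dif Y n \<star> (y \<star> a) = Zero C (dom y) (Ter Y (n + 1)) \<star> a"
      by (rule precomp_eq[OF y(3)]) (use Y y axb(1-9) axb' in auto)
    then have dya: "Dif Y n \<star> (y \<star> a) = Zero C (dom a) (Ter Y (n + 1))"
      using Y axb(1) axb' by simp
    have "Dif Y n \<star> (f n \<star> x) = f (n + 1) \<star> (Dif X n \<star> x)"
      using X Y axb(3,5) by (simp add: fD)
    then have dfx: "Dif Y n \<star> (f n \<star> x) = Zero C (dom a) (Ter Y (n + 1))"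
      using X axb(1,3,4,9) by (simp add: fD(1-3))
    have dw: "cocycle Y n ?w"
      using X Y y axb(1-9) axb' dya dfx by (simp add: fD(1-3))
    obtain a' b' where ab: "deflation C a'" "cod a' = dom ?w" "arr b'" "dom b' = dom a'"
      "cod b' = Ter Y (n - 1)" "?w \<star> a' = Dif Y (n - 1) \<star> b'"
      by (rule H_injE[OF gi w(1) axb(6) _ w(3) axb(8) dw gw]) (use w axb(7) in auto)
    have "y \<star> (a \<star> a') = Add C (f n \<star> (x \<star> a')) (Dif Y (n - 1) \<star> b')"
    proof (rule Add_eq_swap)
      show "y \<star> (a \<star> a') \<in> Hom C (dom a') (Ter Y n)" "f n \<star> (x \<star> a') \<in> Hom C (dom a') (Ter Y n)"
        using X Y y w axb(1-9) axb' ab(1-5) by (simp_all add: fD(1-3) Hom_def)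
      have "Add C (y \<star> (a \<star> a')) (Neg C (f n \<star> (x \<star> a'))) = ?w \<star> a'"
        using X Y y w axb(1-9) axb' ab(1-5) by (simp add: fD(1-3))
      then show "Add C (y \<star> (a \<star> a')) (Neg C (f n \<star> (x \<star> a'))) = Dif Y (n - 1) \<star> b'"
        using ab(6) by simp
    qed
    moreover have "Dif X n \<star> (x \<star> a') = Zero C (dom x) (Ter X (n + 1)) \<star> a'"
      by (rule precomp_eq[OF axb(9)]) (use X w axb(1-8) ab(1-5) in auto)
    ultimately show "locally_image X Y (f n) n y"
      using X Y y w axb(1-8) axb' ab(1-5)
      by (intro exI[of _ "a \<star> a'"] exI[of _ "x \<star> a'"] exI[of _ b']) (simp add: deflation_Comp)
  qed
qed

lemma qis_Ide:
  assumes X: "complex X"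
  shows "qis X X (\<lambda>n. Ide C (Ter X n))"
  unfolding qis_def
proof (intro allI conjI H_surjI H_injI)
  fix n y assume y: "arr y" "cod y = Ter X n" "cocycle X n y"
  show "locally_image X X (Ide C (Ter X n)) n y"
    using X y by (intro exI[of _ "Ide C (dom y)"] exI[of _ y] exI[of _ "Zero C (dom y) (Ter X (n - 1))"])
      (simp add: deflation_Ide)
next
  fix n x y assume "arr x" "arr y" "dom y = dom x" "cod x = Ter X n" "cod y = Ter X (n - 1)"
    "Ide C (Ter X n) \<star> x = Dif X (n - 1) \<star> y"
  then show "locally_boundary X n x"
    using X by (intro exI[of _ "Ide C (dom x)"] exI[of _ y]) (simp add: deflation_Ide)
qed

lemma exact_at_H_surj:
  assumes X: "complex X" and Y: "complex Y" and f: "f \<in> chains X Y"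
    and s: "H_surj X Y f n" and ex: "exact_at X n"
  shows "exact_at Y n"
proof (rule exact_atI)
  note fD = chain_mapsD[OF f]
  fix y assume y: "arr y" "cod y = Ter Y n" "cocycle Y n y"
  obtain a x b where axb: "deflation C a" "cod a = dom y" "arr x" "dom x = dom a" "cod x = Ter X n"
      "arr b" "dom b = dom a" "cod b = Ter Y (n - 1)" "cocycle X n x"
      "y \<star> a = Add C (f n \<star> x) (Dif Y (n - 1) \<star> b)"
    using s y by (rule H_surjE)
  obtain a' b' where ab: "deflation C a'" "cod a' = dom x" "arr b'" "dom b' = dom a'"
      "cod b' = Ter X (n - 1)" "x \<star> a' = Dif X (n - 1) \<star> b'"
    using ex axb(3,5,9) by (rule exact_atE)
  have "y \<star> (a \<star> a') = Add C (f n \<star> x) (Dif Y (n - 1) \<star> b) \<star> a'"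
    by (rule precomp_eq[OF axb(10)]) (use y axb(1-9) ab(1-5) in auto)
  also have "\<dots> = Dif Y (n - 1) \<star> Add C (f (n - 1) \<star> b') (b \<star> a')"
    using X Y y axb(1-9) ab by (simp add: fD)
  finally show "locally_boundary Y n y"
    using X Y y axb(1-9) ab(1-5)
    by (intro exI[of _ "a \<star> a'"] exI[of _ "Add C (f (n - 1) \<star> b') (b \<star> a')"])
      (simp add: fD(1-3) deflation_Comp)
qed

lemma exact_at_H_inj:
  assumes X: "complex X" and Y: "complex Y" and f: "f \<in> chains X Y"
    and i: "H_inj X Y f n" and ex: "exact_at Y n"
  shows "exact_at X n"
proof (rule exact_atI)
  note fD = chain_mapsD[OF f]
  fix x assume x: "arr x" "cod x = Ter X n" "cocycle X n x"
  have "Dif Y n \<star> (f n \<star> x) = f (n + 1) \<star> (Dif X n \<star> x)"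
    using X Y x(1,2) by (simp add: fD)
  then have dfx: "cocycle Y n (f n \<star> x)"
    using X x by (simp add: fD(1-3))
  obtain a b where ab: "deflation C a" "cod a = dom (f n \<star> x)" "arr b" "dom b = dom a"
      "cod b = Ter Y (n - 1)" "(f n \<star> x) \<star> a = Dif Y (n - 1) \<star> b"
    by (rule exact_atE[OF ex _ _ dfx]) (use x in \<open>simp_all add: fD(1-3)\<close>)
  have a: "cod a = dom x" using ab(2) x by (simp add: fD)
  have dxa: "Dif X n \<star> (x \<star> a) = Zero C (dom x) (Ter X (n + 1)) \<star> a"
    by (rule precomp_eq[OF x(3)]) (use X x ab(1) a in auto)
  obtain a' b' where ab': "deflation C a'" "cod a' = dom (x \<star> a)" "arr b'" "dom b' = dom a'"
    "cod b' = Ter X (n - 1)" "(x \<star> a) \<star> a' = Dif X (n - 1) \<star> b'"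
    by (rule H_injE[OF i, of "x \<star> a" b]) (use X Y x ab a dxa in \<open>simp_all add: fD(1-3)\<close>)
  show "locally_boundary X n x"
    using X x ab(1) a ab' by (intro exI[of _ "a \<star> a'"] exI[of _ b']) (simp add: deflation_Comp)
qed

lemma H_surj_of_exact:
  assumes X: "complex X" and Y: "complex Y" and f: "f \<in> chains X Y"
    and ex: "exact_at Y n"
  shows "H_surj X Y f n"
proof (rule H_surjI)
  note fD = chain_mapsD[OF f]
  fix y assume y: "arr y" "cod y = Ter Y n" "cocycle Y n y"
  obtain a b where ab: "deflation C a" "cod a = dom y" "arr b" "dom b = dom a"
      "cod b = Ter Y (n - 1)" "y \<star> a = Dif Y (n - 1) \<star> b"
    using ex y by (rule exact_atE)
  then show "locally_image X Y (f n) n y"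
    using X Y y by (intro exI[of _ a] exI[of _ "Zero C (dom a) (Ter X n)"] exI[of _ b]) (simp add: fD(1-3))
qed

lemma H_inj_of_exact: "exact_at X n \<Longrightarrow> H_inj X Y f n"
  unfolding exact_at_def H_inj_def by blast

lemma exact_at_shift:
  assumes X: "complex X"
  shows "exact_at (shift_cpx C X) n \<longleftrightarrow> exact_at X (n + 1)"
proof -
  have 1: "Neg C (Dif X (n + 1)) \<star> x = Zero C (dom x) (Ter X (n + 2)) \<longleftrightarrow>
    Dif X (n + 1) \<star> x = Zero C (dom x) (Ter X (n + 2))" if "arr x" "cod x = Ter X (n + 1)" for x
    using X that Neg_eq_Zero_iff[of "Dif X (n + 1) \<star> x" "dom x" "Ter X (n + 2)"] by simp
  have 2: "(\<exists>b. arr b \<and> dom b = A \<and> cod b = Ter X n \<and> y = Neg C (Dif X n) \<star> b) \<longleftrightarrow>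
    (\<exists>b. arr b \<and> dom b = A \<and> cod b = Ter X n \<and> y = Dif X n \<star> b)" (is "?L \<longleftrightarrow> ?R") for A y
  proof
    assume ?L
    then obtain b where "arr b" "dom b = A" "cod b = Ter X n" "y = Neg C (Dif X n) \<star> b" by blast
    then show ?R using X by (intro exI[of _ "Neg C b"]) simp
  next
    assume ?R
    then obtain b where "arr b" "dom b = A" "cod b = Ter X n" "y = Dif X n \<star> b" by blast
    then show ?L using X by (intro exI[of _ "Neg C b"]) simp
  qed
  show ?thesis
    unfolding exact_at_def shift_simps int_plus_1_plus_1
    using 1 2 by (simp cong: conj_cong)
qed

section \<open>Exactness of cones and quasi-isomorphisms\<close>

text \<open>One piece of the long exact sequence, between the cohomology of \<open>Y\<close> at
  \<open>n\<close> and that of \<open>X\<close> at \<open>n + 1\<close>. A cocycle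
  \<open>(x, y)\<close> has \<open>x\<close> closed and \<open>f x = - d y\<close>; injectivity
  makes \<open>x\<close> a local boundary, which leaves a cocycle of \<open>Y\<close>, and
  surjectivity deals with that.\<close>

lemma exact_at_cone:
  assumes X: "complex X" and Y: "complex Y" and f: "f \<in> chains X Y"
    and surj: "H_surj X Y f n" and inj: "H_inj X Y f (n + 1)"
  shows "exact_at (cone C X Y f) n"
proof (rule exact_atI)
  note fD = chain_mapsD[OF f]
  fix z assume z: "arr z" "cod z = Ter (cone C X Y f) n"
    and dz: "cocycle (cone C X Y f) n z"
  define x where "x = cout X Y n \<star> z"
  define y where "y = cone_proj X Y n \<star> z"
  have xy: "arr x" "dom x = dom z" "cod x = Ter X (n + 1)"
    "arr y" "dom y = dom z" "cod y = Ter Y n"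
    using X Y z by (simp_all add: x_def y_def)
  have "Neg C (Dif X (n + 1) \<star> x) = cout X Y (n + 1) \<star> (Dif (cone C X Y f) n \<star> z)"
    using X Y f z unfolding x_def by simp
  then have dx: "cocycle X (n + 1) x"
    using X Y z xy unfolding dz by (simp add: Neg_eq_Zero_iff)
  have "Add C (f (n + 1) \<star> x) (Dif Y n \<star> y) = cone_proj X Y (n + 1) \<star> (Dif (cone C X Y f) n \<star> z)"
    using X Y f z unfolding x_def y_def by simp
  then have fx_dy: "Add C (f (n + 1) \<star> x) (Dif Y n \<star> y) = Zero C (dom z) (Ter Y (n + 1))"
    using X Y z unfolding dz by simp
  then have fx: "f (n + 1) \<star> x = Dif Y (n + 1 - 1) \<star> Neg C y"
    using X Y xy Add_eq_Zero[of "f (n + 1) \<star> x" "dom z" "Ter Y (n + 1)"] by (simp add: fD(1-3) Hom_def)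
  obtain a b where ab: "deflation C a" "cod a = dom x" "arr b" "dom b = dom a"
    "cod b = Ter X (n + 1 - 1)" "x \<star> a = Dif X (n + 1 - 1) \<star> b"
    by (rule H_injE[OF inj xy(1) _ _ xy(3) _ dx fx]) (use xy in auto)
  \<comment> \<open>Subtracting the boundary of \<open>(-b, 0)\<close> from the restricted
    \<open>(x, y)\<close> kills the first coordinate and leaves this element in the second.\<close>
  define w where "w = Add C (f n \<star> b) (y \<star> a)"
  have w: "arr w" "dom w = dom a" "cod w = Ter Y n"
    using X Y xy ab(1-5) by (simp_all add: w_def fD)
  have "Dif Y n \<star> w = Add C (f (n + 1) \<star> (Dif X n \<star> b)) (Dif Y n \<star> (y \<star> a))"
    using X Y xy ab(1-5) by (simp add: w_def fD)
  also have "\<dots> = Add C (f (n + 1) \<star> x) (Dif Y n \<star> y) \<star> a"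
    using X Y xy ab(1-5) ab(6)[symmetric] by (simp add: fD(1-3))
  also have "\<dots> = Zero C (dom w) (Ter Y (n + 1))"
    unfolding fx_dy using Y xy ab(1,2) w by simp
  finally have dw: "cocycle Y n w" .
  obtain a' x' b' where axb: "deflation C a'" "cod a' = dom w" "arr x'" "dom x' = dom a'" "cod x' = Ter X n"
      "arr b'" "dom b' = dom a'" "cod b' = Ter Y (n - 1)" "cocycle X n x'"
      "w \<star> a' = Add C (f n \<star> x') (Dif Y (n - 1) \<star> b')"
    using surj w(1,3) dw by (rule H_surjE)
  have "Add C (f n \<star> (b \<star> a')) (y \<star> (a \<star> a')) = w \<star> a'"
    using X Y xy ab(1-5) w(2) axb(1,2) by (simp add: w_def fD(1-3))
  then have ya: "y \<star> (a \<star> a') = Add C (Add C (Neg C (f n \<star> (b \<star> a'))) (f n \<star> x')) (Dif Y (n - 1) \<star> b')"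
    using X Y xy ab(1-5) w(2) axb
    by (intro Add_eq_Add[of _ "dom a'" "Ter Y n"]) (simp_all add: fD(1-3) Hom_def)
  \<comment> \<open>The bounding element puts back the correction \<open>-b\<close> and adds the
    cocycle \<open>x'\<close>; the latter contributes \<open>f x'\<close> in the second coordinate
    and nothing in the first.\<close>
  define v where "v = Add C (Neg C (b \<star> a')) x'"
  have v: "arr v" "dom v = dom a'" "cod v = Ter X n"
    using X w ab(1-5) axb(1-8) by (simp_all add: v_def)
  have za: "z \<star> (a \<star> a') = Dif (cone C X Y f) (n - 1) \<star> cone_pair X Y (n - 1) v b'"
  proof (rule cone_ext[OF X Y, of _ n])
    have "cout X Y n \<star> (z \<star> (a \<star> a')) = x \<star> (a \<star> a')"
      unfolding x_def using X Y z xy ab(1-5) axb(1-8) w by simp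
    also have "\<dots> = (Dif X (n + 1 - 1) \<star> b) \<star> a'"
      by (rule precomp_eq[OF ab(6)]) (use xy ab(1-5) axb(1-8) w in auto)
    also have "\<dots> = cout X Y n \<star> (Dif (cone C X Y f) (n - 1) \<star> cone_pair X Y (n - 1) v b')"
      using X Y f ab(1-5) axb(1-9) w v by (simp add: v_def)
    finally show "cout X Y n \<star> (z \<star> (a \<star> a')) = \<dots>" .
    have "cone_proj X Y n \<star> (z \<star> (a \<star> a')) = y \<star> (a \<star> a')"
      unfolding y_def using X Y z xy ab(1-5) axb(1-8) w by simp
    also have "\<dots> = cone_proj X Y n \<star> (Dif (cone C X Y f) (n - 1) \<star> cone_pair X Y (n - 1) v b')"
      unfolding ya using X Y f ab(1-5) axb(1-9) w v by (simp add: v_def fD(1-3))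
    finally show "cone_proj X Y n \<star> (z \<star> (a \<star> a')) = \<dots>" .
  qed (use X Y f z xy ab(1-5) axb(1-8) w v in auto)
  then show "locally_boundary (cone C X Y f) n z"
    using X Y z xy ab(1-5) axb(1-8) w v
    by (intro exI[of _ "a \<star> a'"] exI[of _ "cone_pair X Y (n - 1) v b'"]) (simp add: deflation_Comp)
qed

text \<open>Exactness is tested on two cocycles of the cone: \<open>(0, y)\<close> yields
  surjectivity at \<open>n\<close>, and \<open>(x, -y)\<close>, closed because
  \<open>f x = d y\<close>, yields injectivity at \<open>n + 1\<close>.\<close>

lemma exact_at_coneD:
  assumes X: "complex X" and Y: "complex Y" and f: "f \<in> chains X Y"
    and ex: "exact_at (cone C X Y f) n"
  shows "H_surj X Y f n" "H_inj X Y f (n + 1)"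
proof -
  note fD = chain_mapsD[OF f]
  note cin_D = chain_mapsD[OF chain_maps_cone_in[OF X Y f]]
  show "H_surj X Y f n"
  proof (rule H_surjI)
    fix y assume y: "arr y" "cod y = Ter Y n" "cocycle Y n y"
    define z where "z = cin X Y n \<star> y"
    have z: "arr z" "dom z = dom y" "cod z = Ter (cone C X Y f) n"
      "cout X Y n \<star> z = Zero C (dom y) (Ter X (n + 1))" "cone_proj X Y n \<star> z = y"
      using X Y y by (simp_all add: z_def cone_equations_Comp)
    have dz: "cocycle (cone C X Y f) n z"
      by (rule cone_ext[OF X Y, of _ "n + 1"]) (use X Y f y z in \<open>simp_all add: fD(1-3)\<close>)
    obtain a w where w: "deflation C a" "cod a = dom z" "arr w" "dom w = dom a"
      "cod w = Ter (cone C X Y f) (n - 1)" "z \<star> a = Dif (cone C X Y f) (n - 1) \<star> w"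
      using ex z(1,3) dz by (rule exact_atE)
    define x where "x = cout X Y (n - 1) \<star> w"
    define b where "b = cone_proj X Y (n - 1) \<star> w"
    have xb: "arr x" "dom x = dom a" "cod x = Ter X n" "arr b" "dom b = dom a"
      "cod b = Ter Y (n - 1)"
      using X Y w(1-5) by (simp_all add: x_def b_def)
    have "y \<star> a = cone_proj X Y n \<star> (z \<star> a)"
      using precomp_eq[OF z(5), of a] X Y w(1-5) z by simp
    also have "\<dots> = Add C (f n \<star> x) (Dif Y (n - 1) \<star> b)"
      unfolding w(6) x_def b_def using X Y f w(1-5) by simp
    finally have ya: "y \<star> a = \<dots>" .
    have "Neg C (Dif X n \<star> x) = cout X Y n \<star> (z \<star> a)"
      unfolding w(6) x_def using X Y f w(1-5) by simp
    also have "\<dots> = Zero C (dom x) (Ter X (n + 1))"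
      using precomp_eq[OF z(4), of a] X Y y w(1-5) z xb by simp
    finally have "cocycle X n x"
      using X xb by (simp add: Neg_eq_Zero_iff)
    with ya show "locally_image X Y (f n) n y"
      using w(1,2) z(2) xb by metis
  qed
  show "H_inj X Y f (n + 1)"
  proof (rule H_injI)
    fix x y assume xy: "arr x" "arr y" "dom y = dom x" "cod x = Ter X (n + 1)" "cod y = Ter Y (n + 1 - 1)"
     "cocycle X (n + 1) x" "f (n + 1) \<star> x = Dif Y (n + 1 - 1) \<star> y"
    define z where "z = cone_pair X Y n x (Neg C y)"
    have z: "arr z" "dom z = dom x" "cod z = Ter (cone C X Y f) n"
      "cout X Y n \<star> z = x" "cone_proj X Y n \<star> z = Neg C y"
      using X Y xy by (simp_all add: z_def)
    have dz: "cocycle (cone C X Y f) n z"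
      by (rule cone_ext[OF X Y, of _ "n + 1"]) (use X Y f xy z in simp_all)
    obtain a w where w: "deflation C a" "cod a = dom z" "arr w" "dom w = dom a"
      "cod w = Ter (cone C X Y f) (n - 1)" "z \<star> a = Dif (cone C X Y f) (n - 1) \<star> w"
      using ex z(1,3) dz by (rule exact_atE)
    have "x \<star> a = cout X Y n \<star> (z \<star> a)"
      using precomp_eq[OF z(4), of a] X Y w(1-5) z by simp
    also have "\<dots> = Dif X n \<star> Neg C (cout X Y (n - 1) \<star> w)"
      unfolding w(6) using X Y f w(1-5) by simp
    finally show "locally_boundary X (n + 1) x"
      using X Y w(1-5) z(2)
      by (intro exI[of _ a] exI[of _ "Neg C (cout X Y (n - 1) \<star> w)"]) simp
  qed
qed

lemma exact_cone_iff_qis: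
  assumes "complex X" "complex Y" "f \<in> chains X Y"
  shows "(\<forall>n. exact_at (cone C X Y f) n) \<longleftrightarrow> qis X Y f"
proof
  assume *: "\<forall>n. exact_at (cone C X Y f) n"
  show "qis X Y f" unfolding qis_def
  proof
    fix n
    show "H_surj X Y f n \<and> H_inj X Y f n"
      using exact_at_coneD(1)[OF assms, of n] exact_at_coneD(2)[OF assms, of "n - 1"] * by simp
  qed
next
  assume "qis X Y f"
  then show "\<forall>n. exact_at (cone C X Y f) n"
    using exact_at_cone[OF assms] by (simp add: qis_def)
qed

end

section \<open>Cocones and fractions of quasi-isomorphisms\<close>

context additive_category
begin

text \<open>The sign is chosen so that the sign in \<open>shift_cpx\<close> cancels it: the shift of
  the cocone is then equal to the cone, not merely isomorphic to it.\<close>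

definition cocone :: "('o, 'a) cpx \<Rightarrow> ('o, 'a) cpx \<Rightarrow> (int \<Rightarrow> 'a) \<Rightarrow> ('o, 'a) cpx" where
  "cocone X Y f = \<lparr>Ter = (\<lambda>n. cone_obj X Y (n - 1)), Dif = (\<lambda>n. Neg C (Dif (cone C X Y f) (n - 1)))\<rparr>"

definition cocone_out :: "('o, 'a) cpx \<Rightarrow> ('o, 'a) cpx \<Rightarrow> int \<Rightarrow> 'a" where
  "cocone_out X Y n = cout X Y (n - 1)"

lemma cocone_simps [simp]:
  "Ter (cocone X Y f) n = cone_obj X Y (n - 1)"
  "Dif (cocone X Y f) n = Neg C (Dif (cone C X Y f) (n - 1))"
  by (simp_all add: cocone_def)

lemma is_complex_cocone:
  assumes X: "complex X" and Y: "complex Y" and f: "f \<in> chains X Y"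
  shows "complex (cocone X Y f)"
proof (rule is_complexI)
  fix n
  show "Dif (cocone X Y f) (n + 1) \<star> Dif (cocone X Y f) n =
    Zero C (Ter (cocone X Y f) n) (Ter (cocone X Y f) (n + 2))"
    using X Y f Dif_Dif[OF is_complex_cone[OF X Y f], of n "n - 1"] by simp
qed (use X Y f in simp_all)

lemma chain_maps_cocone_out:
  assumes X: "complex X" and Y: "complex Y" and f: "f \<in> chains X Y"
  shows "cocone_out X Y \<in> chains (cocone X Y f) X"
  by (rule chain_mapsI) (use X Y f in \<open>simp_all add: cocone_out_def\<close>)

lemma shift_cocone:
  assumes X: "complex X" and Y: "complex Y" and f: "f \<in> chains X Y"
  shows "shift_cpx C (cocone X Y f) = cone C X Y f"
  by (rule cpx.equality) (use X Y f in \<open>auto simp: fun_eq_iff\<close>)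

text \<open>The second coordinate of the cocone is, up to sign, a universal null-homotopy: in its
  boundary the two terms \<open>d\<close> after \<open>cone_proj\<close> cancel, and
  \<open>f\<close> after \<open>cone_out\<close> remains.\<close>

lemma homotopic_cocone_out:
  assumes X: "complex X" and Y: "complex Y" and f: "f \<in> chains X Y"
  shows "homotopic C (cocone X Y f) Y (\<lambda>n. f n \<star> cocone_out X Y n)
    (zero_map (cocone X Y f) Y)"
proof (rule homotopicI[where h = "\<lambda>n. Neg C (cone_proj X Y (n - 1))"])
  fix n
  show "f n \<star> cocone_out X Y n = Add C (Zero C (Ter (cocone X Y f) n) (Ter Y n))
    (Add C (Dif Y (n - 1) \<star> Neg C (cone_proj X Y (n - 1)))
      (Neg C (cone_proj X Y (n + 1 - 1)) \<star> Dif (cocone X Y f) n))"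
    using X Y f Add_cancel(1)[of "f n \<star> cout X Y (n - 1)" "cone_obj X Y (n - 1)" "Ter Y n"
        "Dif Y (n - 1) \<star> cone_proj X Y (n - 1)"]
    by (simp add: cocone_out_def chain_mapsD(1-3)[OF f] Hom_def)
qed (use X Y in simp_all)

end

context deflation_exact_category
begin

text \<open>A cocycle \<open>x\<close> of \<open>X\<close> has \<open>f x = d b\<close> locally
  because \<open>Y\<close> is exact, so \<open>(x, -b)\<close> is a cocycle that lifts it.
  Injectivity uses exactness of \<open>Y\<close> one degree lower.\<close>

lemma qis_cocone_out:
  assumes X: "complex X" and Y: "complex Y" and f: "f \<in> chains X Y"
    and ex: "\<And>n. exact_at Y n"
  shows "qis (cocone X Y f) X (cocone_out X Y)"
  unfolding qis_def
proof (intro allI conjI)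
  note fD = chain_mapsD[OF f]
  fix n
  show "H_surj (cocone X Y f) X (cocone_out X Y) n"
  proof (rule H_surjI)
    fix x assume x: "arr x" "cod x = Ter X n" "cocycle X n x"
    have "Dif Y n \<star> (f n \<star> x) = f (n + 1) \<star> (Dif X n \<star> x)"
      using X Y x(1,2) by (simp add: fD)
    then have dfx: "cocycle Y n (f n \<star> x)"
      using X x by (simp add: fD(1-3))
    obtain a b where ab: "deflation C a" "cod a = dom (f n \<star> x)" "arr b" "dom b = dom a"
      "cod b = Ter Y (n - 1)" "(f n \<star> x) \<star> a = Dif Y (n - 1) \<star> b"
      by (rule exact_atE[OF ex _ _ dfx]) (use x in \<open>simp_all add: fD(1-3)\<close>)
    have a: "cod a = dom x" using ab(2) x by (simp add: fD)
    have dxa: "Dif X n \<star> (x \<star> a) = Zero C (dom a) (Ter X (n + 1))"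
      using precomp_eq[OF x(3), of a] X x ab(1) a by simp
    have fxa: "f n \<star> (x \<star> a) = Dif Y (n - 1) \<star> b"
      using ab(1,6) a x by (simp add: fD(1-3))
    define w where "w = cone_pair X Y (n - 1) (x \<star> a) (Neg C b)"
    have w: "arr w" "dom w = dom a" "cod w = cone_obj X Y (n - 1)" "cout X Y (n - 1) \<star> w = x \<star> a"
      "cone_proj X Y (n - 1) \<star> w = Neg C b"
      using X Y x ab(1-5) a by (simp_all add: w_def)
    have "Dif (cone C X Y f) (n - 1) \<star> w = Zero C (dom w) (cone_obj X Y n)"
      by (rule cone_ext[OF X Y, of _ n]) (use X Y f w dxa fxa ab(1-5) in simp_all)
    then show "locally_image (cocone X Y f) X (cocone_out X Y n) n x"
      using X Y f x ab(1-5) a w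
      by (intro exI[of _ a] exI[of _ w] exI[of _ "Zero C (dom a) (Ter X (n - 1))"]) (simp add: cocone_out_def)
  qed
  show "H_inj (cocone X Y f) X (cocone_out X Y) n"
  proof (rule H_injI)
    fix w z assume w: "arr w" "arr z" "dom z = dom w" "cod w = Ter (cocone X Y f) n" "cod z = Ter X (n - 1)"
      and dw: "cocycle (cocone X Y f) n w"
      and wz: "cocone_out X Y n \<star> w = Dif X (n - 1) \<star> z"
    have dw': "Dif (cone C X Y f) (n - 1) \<star> w = Zero C (dom w) (cone_obj X Y n)"
      using dw X Y f w by (simp add: Neg_eq_Zero_iff)
    have wz': "cout X Y (n - 1) \<star> w = Dif X (n - 1) \<star> z"
      using wz by (simp add: cocone_out_def)
    define y where "y = cone_proj X Y (n - 1) \<star> w"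
    have y: "arr y" "dom y = dom w" "cod y = Ter Y (n - 1)"
      using X Y w by (simp_all add: y_def)
    have "Add C (f n \<star> (Dif X (n - 1) \<star> z)) (Dif Y (n - 1) \<star> y)
        = cone_proj X Y n \<star> (Dif (cone C X Y f) (n - 1) \<star> w)"
      unfolding y_def using X Y f w wz' by simp
    also have "\<dots> = Zero C (dom w) (Ter Y n)" unfolding dw' using X Y w by simp
    finally have *: "Add C (f n \<star> (Dif X (n - 1) \<star> z)) (Dif Y (n - 1) \<star> y) = Zero C (dom w) (Ter Y n)" .
    \<comment> \<open>If the first coordinate of the cocycle \<open>w\<close> is \<open>d z\<close>,
      closedness in the second coordinate says exactly that \<open>f z + y\<close> is a cocycle.
      Writing it locally as \<open>d b\<close> makes \<open>w\<close> the boundary of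
      \<open>(z, -b)\<close>.\<close>
    define v where "v = Add C (f (n - 1) \<star> z) y"
    have v: "arr v" "dom v = dom w" "cod v = Ter Y (n - 1)"
      using X Y w y by (simp_all add: v_def fD)
    have dv: "cocycle Y (n - 1) v"
      using * X Y w y v(2) by (simp add: v_def fD)
    obtain a b where ab: "deflation C a" "cod a = dom v" "arr b" "dom b = dom a"
      "cod b = Ter Y (n - 1 - 1)" "v \<star> a = Dif Y (n - 1 - 1) \<star> b"
      using ex v(1,3) dv by (rule exact_atE)
    have a: "cod a = dom w" using ab(2) v by simp
    define u where "u = cone_pair X Y (n - 2) (z \<star> a) (Neg C b)"
    have u: "arr u" "dom u = dom a" "cod u = cone_obj X Y (n - 2)" "cout X Y (n - 2) \<star> u = z \<star> a"
      "cone_proj X Y (n - 2) \<star> u = Neg C b"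
      using X Y w ab(1-5) a by (simp_all add: u_def)
    have va: "Dif Y (n - 2) \<star> b = Add C (f (n - 1) \<star> (z \<star> a)) (y \<star> a)"
      using ab X Y w y a by (simp add: v_def fD(1-3))
    have "w \<star> a = Neg C (Dif (cone C X Y f) (n - 2) \<star> u)"
    proof (rule cone_ext[OF X Y, of _ "n - 1"])
      show "cout X Y (n - 1) \<star> (w \<star> a) = cout X Y (n - 1) \<star> Neg C (Dif (cone C X Y f) (n - 2) \<star> u)"
        using precomp_eq[OF wz', of a] X Y f w ab(1) a u by simp
      have "cone_proj X Y (n - 1) \<star> (w \<star> a) = y \<star> a"
        using X Y w ab(1) a by (simp add: y_def)
      also have "\<dots> = Add C (Neg C (f (n - 1) \<star> (z \<star> a))) (Dif Y (n - 2) \<star> b)"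
        unfolding va using X Y w y ab(1) a
        by (intro Add_cancel(2)[of _ "dom a" "Ter Y (n - 1)", symmetric]) (simp_all add: fD(1-3) Hom_def)
      also have "\<dots> = cone_proj X Y (n - 1) \<star> Neg C (Dif (cone C X Y f) (n - 2) \<star> u)"
        using X Y f w ab(1-5) a u by (simp add: fD(1-3))
      finally show "cone_proj X Y (n - 1) \<star> (w \<star> a) = \<dots>" .
    qed (use X Y f w ab(1-5) a u in simp_all)
    then show "locally_boundary (cocone X Y f) n w"
      using X Y f ab(1) a u by (intro exI[of _ a] exI[of _ u]) simp
  qed
qed

lemma ex_qis_annihilating:
  assumes X: "complex X" and Y: "complex Y" and f: "f \<in> chains X Y"
    and ex: "\<And>n. exact_at Y n"
  obtains P u where "complex P" "u \<in> chains P X" "qis P X u"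
    "homotopic C P Y (\<lambda>n. f n \<star> u n) (zero_map P Y)"
  by (rule that[OF is_complex_cocone[OF X Y f] chain_maps_cocone_out[OF X Y f]
        qis_cocone_out[OF X Y f ex] homotopic_cocone_out[OF X Y f]])

lemma exact_at_cocone:
  assumes X: "complex X" and Y: "complex Y" and f: "f \<in> chains X Y"
    and q: "qis X Y f"
  shows "exact_at (cocone X Y f) n"
  using exact_at_shift[OF is_complex_cocone[OF X Y f], of "n - 1"] shift_cocone[OF X Y f]
    exact_cone_iff_qis[OF X Y f] q by simp

text \<open>The cone of \<open>t\<close> is exact, so \<open>f\<close> followed by the inclusion of
  \<open>Y\<close> becomes null-homotopic on some \<open>P\<close>. The first coordinate of the
  null-homotopy is the required chain map \<open>h\<close>, and the second is a homotopy from
  \<open>f u\<close> to \<open>t h\<close>.\<close>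

lemma qis_Ore:
  assumes W: "complex W" and Y: "complex Y" and Z: "complex Z"
    and t: "t \<in> chains W Y" and q: "qis W Y t" and f: "f \<in> chains Z Y"
  obtains P u h where "complex P" "u \<in> chains P Z" "qis P Z u" "h \<in> chains P W"
    "homotopic C P Y (\<lambda>n. f n \<star> u n) (\<lambda>n. t n \<star> h n)"
proof -
  let ?C = "cone C W Y t"
  note cW = is_complex_cone[OF W Y t]
  note inD = chain_mapsD[OF chain_maps_cone_in[OF W Y t]]
  note fD = chain_mapsD[OF f] and tD = chain_mapsD[OF t]
  have ex: "exact_at ?C n" for n using exact_cone_iff_qis[OF W Y t] q by blast
  have g: "(\<lambda>n. cin W Y n \<star> f n) \<in> chains Z ?C"
    using chain_maps_Comp[OF Z Y cW f chain_maps_cone_in[OF W Y t]] .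
  obtain P u where P: "complex P" and u: "u \<in> chains P Z" "qis P Z u" and
    n: "homotopic C P ?C (\<lambda>n. (cin W Y n \<star> f n) \<star> u n) (zero_map P ?C)"
    by (rule ex_qis_annihilating[OF Z cW g ex])
  note uD = chain_mapsD[OF u(1)]
  obtain H where H: "\<And>n. arr (H n)" "\<And>n. dom (H n) = Ter P n" "\<And>n. cod (H n) = Ter ?C (n - 1)"
    and eq: "\<And>n. (cin W Y n \<star> f n) \<star> u n = Add C (Zero C (Ter P n) (Ter ?C n)) (bdry P ?C H n)"
    using homotopicD[OF n] by blast
  have eq': "Add C (Dif ?C (n - 1) \<star> H n) (H (n + 1) \<star> Dif P n) = cin W Y n \<star> (f n \<star> u n)" for n
    using eq[of n] W Y Z P t H by (simp add: fD(1-3) uD(1-3))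
  define h where "h n = cout W Y (n - 1) \<star> H n" for n
  define k where "k n = cone_proj W Y (n - 1) \<star> H n" for n
  have hk: "arr (h n)" "dom (h n) = Ter P n" "cod (h n) = Ter W n"
    "arr (k n)" "dom (k n) = Ter P n" "cod (k n) = Ter Y (n - 1)" for n
    using W Y H by (simp_all add: h_def k_def)
  have "h (n + 1) \<star> Dif P n = Dif W n \<star> h n" for n
  proof -
    have "Add C (Neg C (Dif W n \<star> h n)) (h (n + 1) \<star> Dif P n) =
      cout W Y n \<star> bdry P ?C H n"
      using W Y P t H by (simp add: h_def)
    also have "\<dots> = Zero C (Ter P n) (Ter W (n + 1))"
      unfolding eq' using W Y Z P by (simp add: cone_equations_Comp fD(1-3) uD(1-3))
    finally show ?thesis
      using Neg_unique[of "Neg C (Dif W n \<star> h n)" "Ter P n" "Ter W (n + 1)" "h (n + 1) \<star> Dif P n"]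
        W P hk by (simp add: Hom_def)
  qed
  then have h: "h \<in> chains P W" using hk by (intro chain_mapsI)
  have "homotopic C P Y (\<lambda>n. f n \<star> u n) (\<lambda>n. t n \<star> h n)"
  proof (rule homotopicI[where h = k])
    fix n
    have "f n \<star> u n = cone_proj W Y n \<star> (cin W Y n \<star> (f n \<star> u n))"
      using W Y Z by (simp add: cone_equations_Comp fD(1-3) uD(1-3))
    also have "\<dots> = Add C (Add C (t n \<star> h n) (Dif Y (n - 1) \<star> k n)) (k (n + 1) \<star> Dif P n)"
      unfolding eq'[symmetric] using W Y P t H by (simp add: h_def k_def)
    also have "\<dots> = Add C (t n \<star> h n) (bdry P Y k n)"
      using W Y P hk by (intro Add_assoc[of _ "Ter P n" "Ter Y n"]) (simp_all add: tD(1-3) Hom_def)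
    finally show "f n \<star> u n = \<dots>" .
  qed (use hk in simp_all)
  then show ?thesis by (rule that[OF P u h])
qed

lemma homotopic_diff:
  assumes X: "complex X" and Y: "complex Y" and f: "f \<in> chains X Y" and g: "g \<in> chains X Y"
  shows "homotopic C X Y (\<lambda>n. Add C (f n) (Neg C (g n))) (zero_map X Y) \<longleftrightarrow> homotopic C X Y f g"
    (is "?L \<longleftrightarrow> ?R")
proof
  note fD = chain_mapsD[OF f] and gD = chain_mapsD[OF g]
  {
    assume ?L
    then obtain h where h: "\<And>n. arr (h n)" "\<And>n. dom (h n) = Ter X n" "\<And>n. cod (h n) = Ter Y (n - 1)"
      "\<And>n. Add C (f n) (Neg C (g n)) = Add C (Zero C (Ter X n) (Ter Y n)) (bdry X Y h n)"
      using homotopicD by blast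
    show ?R
    proof (rule homotopicI[where h = h])
      fix n
      show "f n = Add C (g n) (bdry X Y h n)"
        by (rule Add_eq_swap[of _ "Ter X n" "Ter Y n"])
          (use X Y h(1-3) h(4)[of n] in \<open>simp_all add: fD(1-3) gD(1-3) Hom_def\<close>)
    qed (use h in simp_all)
  }
  {
    assume ?R
    then obtain h where h: "\<And>n. arr (h n)" "\<And>n. dom (h n) = Ter X n" "\<And>n. cod (h n) = Ter Y (n - 1)"
      "\<And>n. f n = Add C (g n) (bdry X Y h n)"
      using homotopicD by blast
    show ?L
    proof (rule homotopicI[where h = h])
      fix n
      have "Add C (f n) (Neg C (g n)) = bdry X Y h n"
        by (rule Add_Neg_eq[of _ "Ter X n" "Ter Y n", OF _ _ _ h(4)])
          (use X Y h(1-3) in \<open>simp_all add: fD(1-3) gD(1-3) Hom_def\<close>)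
      then show "Add C (f n) (Neg C (g n)) =
        Add C (Zero C (Ter X n) (Ter Y n)) (bdry X Y h n)"
        using X Y h(1-3) by simp
    qed (use h in simp_all)
  }
qed

lemma chain_maps_diff:
  assumes X: "complex X" and Y: "complex Y" and f: "f \<in> chains X Y" and g: "g \<in> chains X Y"
  shows "(\<lambda>n. Add C (f n) (Neg C (g n))) \<in> chains X Y"
  by (rule chain_mapsI) (use X Y in \<open>simp_all add: chain_mapsD[OF f] chain_mapsD[OF g]\<close>)

text \<open>A null-homotopy \<open>s\<close> of \<open>t k\<close> is the same as a lift
  \<open>(k, -s)\<close> of \<open>k\<close> to the cocone of \<open>t\<close>. That cocone is
  exact, so the lift is annihilated by a quasi-isomorphism \<open>u\<close>, and projecting back to
  \<open>W\<close> annihilates \<open>k\<close>. The general case applies this to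
  \<open>h - h'\<close>.\<close>

lemma qis_equalize_Zero:
  assumes W: "complex W" and Y: "complex Y" and Z: "complex Z"
    and t: "t \<in> chains W Y" and q: "qis W Y t" and k: "k \<in> chains Z W"
    and tk: "homotopic C Z Y (\<lambda>n. t n \<star> k n) (zero_map Z Y)"
  obtains P u where "complex P" "u \<in> chains P Z" "qis P Z u"
    "homotopic C P W (\<lambda>n. k n \<star> u n) (zero_map P W)"
proof -
  let ?C = "cocone W Y t"
  note cW = is_complex_cocone[OF W Y t]
  note tD = chain_mapsD[OF t] and kD = chain_mapsD[OF k]
  obtain s where s: "\<And>n. arr (s n)" "\<And>n. dom (s n) = Ter Z n" "\<And>n. cod (s n) = Ter Y (n - 1)"
    and tks: "\<And>n. t n \<star> k n = Add C (Zero C (Ter Z n) (Ter Y n)) (bdry Z Y s n)"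
    using homotopicD[OF tk] by blast
  define l where "l n = cone_pair W Y (n - 1) (k n) (Neg C (s n))" for n
  have l: "arr (l n)" "dom (l n) = Ter Z n" "cod (l n) = cone_obj W Y (n - 1)"
    "cout W Y (n - 1) \<star> l n = k n" "cone_proj W Y (n - 1) \<star> l n = Neg C (s n)" for n
    using W Y s by (simp_all add: l_def kD)
  have lC: "l \<in> chains Z ?C"
  proof (rule chain_mapsI)
    fix n
    show "l (n + 1) \<star> Dif Z n = Dif ?C n \<star> l n"
    proof (rule cone_ext[OF W Y, of _ n])
      note l' = l(4,5)[of "n + 1", simplified]
      show "cout W Y n \<star> (l (n + 1) \<star> Dif Z n) = cout W Y n \<star> (Dif ?C n \<star> l n)"
        using precomp_eq[OF l'(1), of "Dif Z n"] W Y Z t l by (simp add: kD)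
      have "cone_proj W Y n \<star> (l (n + 1) \<star> Dif Z n) = Neg C (s (n + 1) \<star> Dif Z n)"
        using precomp_eq[OF l'(2), of "Dif Z n"] W Y Z l s by simp
      also have "\<dots> = Add C (Neg C (t n \<star> k n)) (Dif Y (n - 1) \<star> s n)"
        using Add_cancel(3)[of "Dif Y (n - 1) \<star> s n" "Ter Z n" "Ter Y n" "s (n + 1) \<star> Dif Z n"] W Y Z s
        by (simp add: tks Hom_def)
      also have "\<dots> = cone_proj W Y n \<star> (Dif ?C n \<star> l n)"
        using W Y Z t l s by (simp add: tD(1-3) kD(1-3))
      finally show "cone_proj W Y n \<star> (l (n + 1) \<star> Dif Z n) = \<dots>" .
    qed (use W Y Z t l in simp_all)
  qed (use l in simp_all)
  obtain P u where P: "complex P" and u: "u \<in> chains P Z" "qis P Z u" and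
    n: "homotopic C P ?C (\<lambda>n. l n \<star> u n) (zero_map P ?C)"
    by (rule ex_qis_annihilating[OF Z cW lC exact_at_cocone[OF W Y t q]])
  have "homotopic C P W (\<lambda>n. cocone_out W Y n \<star> (l n \<star> u n)) (\<lambda>n. cocone_out W Y n \<star> Zero C (Ter P n) (Ter ?C n))"
    using homotopic_Comp_left[OF P cW W _ chain_maps_cocone_out[OF W Y t] n] chain_maps_Zero[OF P cW] by blast
  moreover have "cocone_out W Y n \<star> (l n \<star> u n) = k n \<star> u n" for n
    using precomp_eq[OF l(4), of n "u n"] W Y l chain_mapsD(1-3)[OF u(1)] by (simp add: cocone_out_def)
  moreover have "cocone_out W Y n \<star> Zero C (Ter P n) (Ter ?C n) = Zero C (Ter P n) (Ter W n)" for n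
    using W Y P by (simp add: cocone_out_def)
  ultimately show ?thesis using that[OF P u] by simp
qed

lemma qis_equalize:
  assumes W: "complex W" and Y: "complex Y" and Z: "complex Z"
    and t: "t \<in> chains W Y" and q: "qis W Y t" and h: "h \<in> chains Z W" "h' \<in> chains Z W"
    and th: "homotopic C Z Y (\<lambda>n. t n \<star> h n) (\<lambda>n. t n \<star> h' n)"
  obtains P u where "complex P" "u \<in> chains P Z" "qis P Z u"
    "homotopic C P W (\<lambda>n. h n \<star> u n) (\<lambda>n. h' n \<star> u n)"
proof -
  note tD = chain_mapsD[OF t] and hD = chain_mapsD[OF h(1)] chain_mapsD[OF h(2)]
  have "homotopic C Z Y (\<lambda>n. Add C (t n \<star> h n) (Neg C (t n \<star> h' n))) (zero_map Z Y)"
    using homotopic_diff[OF Z Y chain_maps_Comp[OF Z W Y h(1) t] chain_maps_Comp[OF Z W Y h(2) t]] th by simp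
  then have "homotopic C Z Y (\<lambda>n. t n \<star> Add C (h n) (Neg C (h' n))) (zero_map Z Y)"
    by (simp add: tD(1-3) chain_mapsD(1-3)[OF h(1)] chain_mapsD(1-3)[OF h(2)])
  then obtain P u where P: "complex P" and u: "u \<in> chains P Z" "qis P Z u"
    and "homotopic C P W (\<lambda>n. Add C (h n) (Neg C (h' n)) \<star> u n) (zero_map P W)"
    by (rule qis_equalize_Zero[OF W Y Z t q chain_maps_diff[OF Z W h]])
  then have "homotopic C P W (\<lambda>n. Add C (h n \<star> u n) (Neg C (h' n \<star> u n))) (zero_map P W)"
    by (simp add: chain_mapsD(1-3)[OF u(1)] chain_mapsD(1-3)[OF h(1)] chain_mapsD(1-3)[OF h(2)])
  then have "homotopic C P W (\<lambda>n. h n \<star> u n) (\<lambda>n. h' n \<star> u n)"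
    using homotopic_diff[OF P W chain_maps_Comp[OF P Z W u(1) h(1)] chain_maps_Comp[OF P Z W u(1) h(2)]] by simp
  then show ?thesis by (rule that[OF P u])
qed

end

section \<open>Kernels and acyclic complexes\<close>

context additive_category
begin

lemma is_kernelD:
  assumes "is_kernel C k f"
  shows "arr f" "arr k" "cod k = dom f" "f \<star> k = Zero C (dom k) (cod f)"
  using assms by (simp_all add: is_kernel_def)

lemma is_kernel_ex1:
  assumes "is_kernel C k f" "arr g" "cod g = dom f" "f \<star> g = Zero C (dom g) (cod f)"
  shows "\<exists>!h. h \<in> Hom C (dom g) (dom k) \<and> k \<star> h = g"
  using assms unfolding is_kernel_def by blast

lemma is_kernel_lift:
  assumes "is_kernel C k f" "arr g" "cod g = dom f" "f \<star> g = Zero C (dom g) (cod f)"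
  shows "\<exists>h. arr h \<and> dom h = dom g \<and> cod h = dom k \<and> k \<star> h = g"
  using is_kernel_ex1[OF assms] unfolding Hom_def by blast

lemma is_kernel_mono:
  assumes k: "is_kernel C k f"
    and h: "arr h" "arr h'" "dom h' = dom h" "cod h = dom k" "cod h' = dom k" "k \<star> h = k \<star> h'"
  shows "h = h'"
proof -
  note kD = is_kernelD[OF k]
  have "f \<star> (k \<star> h') = Zero C (dom h') (cod f)"
    using precomp_eq[OF kD(4), of h'] kD h by simp
  then have "\<exists>!l. l \<in> Hom C (dom (k \<star> h')) (dom k) \<and> k \<star> l = k \<star> h'"
    using is_kernel_ex1[OF k, of "k \<star> h'"] kD h(1-5) by simp
  moreover have "h \<in> Hom C (dom (k \<star> h')) (dom k)" "h' \<in> Hom C (dom (k \<star> h')) (dom k)"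
    using h kD by (simp_all add: Hom_def)
  ultimately show ?thesis using h(6) by blast
qed

lemma is_kernelI:
  assumes "arr f" "arr k" "cod k = dom f" "f \<star> k = Zero C (dom k) (cod f)"
    and lift: "\<And>g. \<lbrakk>arr g; cod g = dom f; f \<star> g = Zero C (dom g) (cod f)\<rbrakk> \<Longrightarrow>
      \<exists>h. arr h \<and> dom h = dom g \<and> cod h = dom k \<and> k \<star> h = g"
    and mono: "\<And>h h'. \<lbrakk>arr h; arr h'; dom h' = dom h; cod h = dom k; cod h' = dom k;
      k \<star> h = k \<star> h'\<rbrakk> \<Longrightarrow> h = h'"
  shows "is_kernel C k f"
  unfolding is_kernel_def
proof (intro conjI ballI impI)
  fix g assume "arr g" "cod g = dom f \<and> f \<star> g = Zero C (dom g) (cod f)"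
  then obtain h where "arr h" "dom h = dom g" "cod h = dom k" "k \<star> h = g"
    using lift by blast
  then show "\<exists>!h. h \<in> Hom C (dom g) (dom k) \<and> k \<star> h = g"
    using mono by (intro ex1I[of _ h]) (auto simp: Hom_def)
qed (use assms in auto)

lemma is_cokernelD:
  assumes "is_cokernel C c f"
  shows "arr f" "arr c" "dom c = cod f" "c \<star> f = Zero C (dom f) (cod c)"
  using assms by (simp_all add: is_cokernel_def)

lemma is_cokernel_ex1:
  assumes "is_cokernel C c f" "arr g" "dom g = cod f" "g \<star> f = Zero C (dom f) (cod g)"
  shows "\<exists>!h. h \<in> Hom C (cod c) (cod g) \<and> h \<star> c = g"
  using assms unfolding is_cokernel_def by blast

lemma is_cokernel_lift:
  assumes "is_cokernel C c f" "arr g" "dom g = cod f" "g \<star> f = Zero C (dom f) (cod g)"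
  shows "\<exists>h. arr h \<and> dom h = cod c \<and> cod h = cod g \<and> h \<star> c = g"
  using is_cokernel_ex1[OF assms] unfolding Hom_def by blast

lemma is_cokernel_epi:
  assumes c: "is_cokernel C c f"
    and h: "arr h" "arr h'" "cod h' = cod h" "dom h = cod c" "dom h' = cod c" "h \<star> c = h' \<star> c"
  shows "h = h'"
proof -
  note cD = is_cokernelD[OF c]
  have "(h' \<star> c) \<star> f = Zero C (dom f) (cod h')"
    using cD h(1-5) by simp
  then have "\<exists>!l. l \<in> Hom C (cod c) (cod (h' \<star> c)) \<and> l \<star> c = h' \<star> c"
    using is_cokernel_ex1[OF c, of "h' \<star> c"] cD h(1-5) by simp
  moreover have "h \<in> Hom C (cod c) (cod (h' \<star> c))" "h' \<in> Hom C (cod c) (cod (h' \<star> c))"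
    using h(1-5) cD by (simp_all add: Hom_def)
  ultimately show ?thesis using h(6) by blast
qed

lemma is_cokernelI:
  assumes "arr f" "arr c" "dom c = cod f" "c \<star> f = Zero C (dom f) (cod c)"
    and lift: "\<And>g. \<lbrakk>arr g; dom g = cod f; g \<star> f = Zero C (dom f) (cod g)\<rbrakk> \<Longrightarrow>
      \<exists>h. arr h \<and> dom h = cod c \<and> cod h = cod g \<and> h \<star> c = g"
    and epi: "\<And>h h'. \<lbrakk>arr h; arr h'; cod h' = cod h; dom h = cod c; dom h' = cod c;
      h \<star> c = h' \<star> c\<rbrakk> \<Longrightarrow> h = h'"
  shows "is_cokernel C c f"
  unfolding is_cokernel_def
proof (intro conjI ballI impI)
  fix g assume "arr g" "dom g = cod f \<and> g \<star> f = Zero C (dom f) (cod g)"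
  then obtain h where "arr h" "dom h = cod c" "cod h = cod g" "h \<star> c = g"
    using lift by blast
  then show "\<exists>!h. h \<in> Hom C (cod c) (cod g) \<and> h \<star> c = g"
    using epi by (intro ex1I[of _ h]) (auto simp: Hom_def)
qed (use assms in auto)

end

context conflation_category
begin

text \<open>A deflation belongs to a conflation with one particular kernel, and any other kernel is
  isomorphic to it. Closure under isomorphisms presupposes a kernel-cokernel pair, so the cokernel
  property is transferred first.\<close>

lemma Conf_of_kernel:
  assumes p: "deflation C p" and i: "is_kernel C i p"
  shows "(i, p) \<in> Conf C"
proof -
  obtain k where kp: "(k, p) \<in> Conf C" using p by (auto simp: deflation_def)
  then have k: "is_kernel C k p" and c: "is_cokernel C p k"
    using Conf_pair by (auto simp: kernel_cokernel_pair_def)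
  note kD = is_kernelD[OF k] and iD = is_kernelD[OF i] and cD = is_cokernelD[OF c]
  obtain a where a: "arr a" "dom a = dom k" "cod a = dom i" "i \<star> a = k"
    using is_kernel_lift[OF i kD(2-4)] by blast
  obtain b where b: "arr b" "dom b = dom i" "cod b = dom k" "k \<star> b = i"
    using is_kernel_lift[OF k iD(2-4)] by blast
  have ba: "b \<star> a = Ide C (dom k)"
    by (rule is_kernel_mono[OF k]) (use precomp_eq[OF b(4), of a] a b kD in auto)
  have ab: "a \<star> b = Ide C (dom i)"
    by (rule is_kernel_mono[OF i]) (use precomp_eq[OF a(4), of b] a b iD in auto)
  have "is_cokernel C p i"
  proof (rule is_cokernelI)
    fix g assume g: "arr g" "dom g = cod i" "g \<star> i = Zero C (dom i) (cod g)"
    have "g \<star> (i \<star> a) = Zero C (dom i) (cod g) \<star> a"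
      by (rule precomp_eq[OF g(3)]) (use g a iD in auto)
    then have "g \<star> k = Zero C (dom k) (cod g)" using a g(1) by simp
    then show "\<exists>h. arr h \<and> dom h = cod p \<and> cod h = cod g \<and> h \<star> p = g"
      using is_cokernel_lift[OF c, of g] g iD kD by simp
  next
    show "h = h'" if "arr h" "arr h'" "cod h' = cod h" "dom h = cod p" "dom h' = cod p"
      "h \<star> p = h' \<star> p" for h h'
      by (rule is_cokernel_epi[OF c that])
  qed (use iD in auto)
  then have "kernel_cokernel_pair C i p" using i by (simp add: kernel_cokernel_pair_def)
  moreover have "pair_iso C (k, p) (i, p)"
  proof -
    have "iso_arr C a" unfolding iso_arr_def using a b ab ba by (auto simp: Hom_def intro!: bexI[of _ b])
    moreover have "iso_arr C (Ide C (dom p))" "iso_arr C (Ide C (cod p))"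
      using iso_arr_Ide iD(1) by auto
    moreover have "a \<in> Hom C (dom k) (dom i)" "Ide C (dom p) \<in> Hom C (cod k) (cod i)"
      "Ide C (cod p) \<in> Hom C (cod p) (cod p)"
      using a kD iD by (simp_all add: Hom_def)
    moreover have "Ide C (dom p) \<star> k = i \<star> a" "Ide C (cod p) \<star> p = p \<star> Ide C (dom p)"
      using a(4) kD iD by simp_all
    ultimately show ?thesis unfolding pair_iso_def by blast
  qed
  ultimately show ?thesis using Conf_iso kp by blast
qed

end

locale strongly_deflation_exact_category_with_kernels = strongly_deflation_exact_category +
  assumes kernels: "has_kernels C"
begin

abbreviation cycles_arr :: "('a, 'b) cpx \<Rightarrow> int \<Rightarrow> 'b" where
  "cycles_arr X n \<equiv> ker_arr C (Dif X n)"

lemma ker_arr_is_kernel: "arr f \<Longrightarrow> is_kernel C (ker_arr C f) f"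
  unfolding ker_arr_def using kernels by (auto simp: has_kernels_def intro: someI_ex)

lemma cycles_arr_is_kernel: "complex X \<Longrightarrow> is_kernel C (cycles_arr X n) (Dif X n)"
  by (rule ker_arr_is_kernel) simp

lemma cycles_arr [simp]:
  assumes "complex X"
  shows "arr (cycles_arr X n)" "cod (cycles_arr X n) = Ter X n"
    "Dif X n \<star> cycles_arr X n = Zero C (dom (cycles_arr X n)) (Ter X (n + 1))"
  using is_kernelD[OF cycles_arr_is_kernel[OF assms, of n]] assms by simp_all

lemma trunc_arr:
  assumes X: "complex X"
  shows "trunc_arr C n X \<in> Hom C (Ter X (n - 1)) (dom (cycles_arr X n)) \<and>
    cycles_arr X n \<star> trunc_arr C n X = Dif X (n - 1)"
  unfolding trunc_arr_def
proof (rule theI')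
  have "\<exists>!h. h \<in> Hom C (dom (Dif X (n - 1))) (dom (cycles_arr X n)) \<and> cycles_arr X n \<star> h = Dif X (n - 1)"
    using is_kernel_ex1[OF cycles_arr_is_kernel[OF X, of n], of "Dif X (n - 1)"] X by simp
  then show "\<exists>!p. p \<in> Hom C (Ter X (n - 1)) (dom (cycles_arr X n)) \<and> cycles_arr X n \<star> p = Dif X (n - 1)"
    using X by simp
qed

lemma trunc_arr_simps [simp]:
  assumes X: "complex X"
  shows "arr (trunc_arr C n X)" "dom (trunc_arr C n X) = Ter X (n - 1)"
    "cod (trunc_arr C n X) = dom (cycles_arr X n)" "cycles_arr X n \<star> trunc_arr C n X = Dif X (n - 1)"
  using trunc_arr[OF X, of n] by (auto simp: Hom_def)

lemma cycles_arr_trunc_arr_Comp [simp]: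
  assumes X: "complex X" and x: "arr x" "cod x = Ter X (n - 1)"
  shows "cycles_arr X n \<star> (trunc_arr C n X \<star> x) = Dif X (n - 1) \<star> x"
  by (rule precomp_eq[OF trunc_arr_simps(4)[OF X]]) (use X x in auto)

text \<open>Exactness is applied to the universal cocycle, the inclusion of the kernel itself. As
  this inclusion is mono, the resulting cover \<open>a\<close> factors as \<open>trunc_arr\<close>
  after \<open>b\<close>, and (R3) passes from the composite to \<open>trunc_arr\<close>; its
  hypothesis on kernels is where \<open>has_kernels\<close> enters.\<close>

lemma deflation_trunc_arr:
  assumes X: "complex X" and ex: "exact_at X n"
  shows "deflation C (trunc_arr C n X)"
proof -
  obtain a b where ab: "deflation C a" "cod a = dom (cycles_arr X n)" "arr b" "dom b = dom a"
    "cod b = Ter X (n - 1)" "cycles_arr X n \<star> a = Dif X (n - 1) \<star> b"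
    using ex by (rule exact_atE) (use X in auto)
  have "a = trunc_arr C n X \<star> b"
    by (rule is_kernel_mono[OF cycles_arr_is_kernel[OF X, of n]]) (use X ab in simp_all)
  then have "deflation C (trunc_arr C n X \<star> b)" using ab(1) by simp
  then show ?thesis
    using R3[of b "dom b" "cod b" "trunc_arr C n X" "dom (cycles_arr X n)"] X ab
      kernels by (auto simp: Hom_def has_kernels_def)
qed

text \<open>\<open>Dif X (n - 1)\<close> is \<open>trunc_arr C n X\<close> followed by a
  monomorphism, so both have the same kernel.\<close>

lemma cycles_arr_is_kernel_trunc_arr:
  assumes X: "complex X"
  shows "is_kernel C (cycles_arr X (n - 1)) (trunc_arr C n X)"
proof (rule is_kernelI)
  show "trunc_arr C n X \<star> cycles_arr X (n - 1) = Zero C (dom (cycles_arr X (n - 1))) (cod (trunc_arr C n X))"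
    by (rule is_kernel_mono[OF cycles_arr_is_kernel[OF X, of n]]) (use X cycles_arr(3)[OF X, of "n - 1"] in simp_all)
next
  fix g assume g: "arr g" "cod g = dom (trunc_arr C n X)"
    "trunc_arr C n X \<star> g = Zero C (dom g) (cod (trunc_arr C n X))"
  have "Dif X (n - 1) \<star> g = cycles_arr X n \<star> (trunc_arr C n X \<star> g)"
    using X g(1,2) by simp
  also have "\<dots> = Zero C (dom g) (Ter X n)" unfolding g(3) using X g(1) by simp
  finally show "\<exists>h. arr h \<and> dom h = dom g \<and> cod h = dom (cycles_arr X (n - 1)) \<and> cycles_arr X (n - 1) \<star> h = g"
    using is_kernel_lift[OF cycles_arr_is_kernel[OF X, of "n - 1"] g(1)] X g by simp
next
  show "h = h'" if "arr h" "arr h'" "dom h' = dom h" "cod h = dom (cycles_arr X (n - 1))"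
    "cod h' = dom (cycles_arr X (n - 1))" "cycles_arr X (n - 1) \<star> h = cycles_arr X (n - 1) \<star> h'" for h h'
    by (rule is_kernel_mono[OF cycles_arr_is_kernel[OF X, of "n - 1"] that])
qed (use X in simp_all)

text \<open>A cocycle \<open>x\<close> factors through the kernel \<open>i\<close> as some
  \<open>y\<close>; the pullback of \<open>p\<close> along \<open>y\<close> is the cover on which
  \<open>x\<close> becomes a boundary.\<close>

lemma exact_at_of_factorization:
  assumes X: "complex X" and p: "deflation C p" and i: "is_kernel C i (Dif X n)"
    and ip: "cod p = dom i" "Dif X (n - 1) = i \<star> p"
  shows "exact_at X n"
proof (rule exact_atI)
  note iD = is_kernelD[OF i]
  have Dp: "dom p = Ter X (n - 1)"
    using Dom_Comp[of p i] p iD ip X complexD(2)[OF X, of "n - 1"] by simp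
  fix x assume x: "arr x" "cod x = Ter X n" "cocycle X n x"
  obtain y where y: "arr y" "dom y = dom x" "cod y = dom i" "i \<star> y = x"
    using is_kernel_lift[OF i x(1)] X x by auto
  obtain a b where pb: "is_pullback C p y a b" using R2_ex[OF p y(1)] y ip by auto
  then have a: "deflation C a" by (rule R2[OF p])
  have ab: "arr b" "dom b = dom a" "cod a = dom y" "cod b = dom p" "y \<star> a = p \<star> b"
    using pb by (auto simp: is_pullback_def)
  have "x \<star> a = i \<star> (y \<star> a)"
    by (rule precomp_eq[OF y(4), symmetric]) (use iD y a ab in auto)
  also have "\<dots> = Dif X (n - 1) \<star> b"
    unfolding ab(5) ip(2) using iD p ip(1) ab by simp
  finally show "locally_boundary X n x"
    using a ab y Dp by auto
qed

lemma acyclic_complex_iff: "acyclic_complex C X \<longleftrightarrow> complex X \<and> (\<forall>n. exact_at X n)"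
proof (intro iffI conjI allI)
  show "complex X" if "acyclic_complex C X" using that by (simp add: acyclic_complex_def)
  show "exact_at X n" if "acyclic_complex C X" for n
    using that exact_at_of_factorization unfolding acyclic_complex_def by metis
next
  assume *: "complex X \<and> (\<forall>n. exact_at X n)"
  then have X: "complex X" by blast
  have d: "deflation C (trunc_arr C n X)" for n using deflation_trunc_arr * by blast
  have conf: "(cycles_arr X (n - 1), trunc_arr C n X) \<in> Conf C" for n
    using Conf_of_kernel[OF d cycles_arr_is_kernel_trunc_arr[OF X]] .
  have coker: "is_cokernel C (trunc_arr C n X) (cycles_arr X (n - 1))" for n
    using Conf_pair[OF conf] by (simp add: kernel_cokernel_pair_def)
  \<comment> \<open>The cycles in degree \<open>n\<close> are the kernel of the deflation onto the
    cycles in degree \<open>n + 1\<close>, hence the shifted index.\<close>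
  have infl: "inflation C (cycles_arr X n)" for n
    using conf[of "n + 1"] by (auto simp: inflation_def)
  \<comment> \<open>Acyclicity asks for a cokernel of the differential, while the conflation gives
    one of the cycle inclusion. The differential is that inclusion after a deflation; the latter is
    epi, so the two have the same cokernel.\<close>
  have "is_cokernel C (trunc_arr C n X) (Dif X (n - 2))" for n
  proof (rule is_cokernelI)
    have fac: "Dif X (n - 2) = cycles_arr X (n - 1) \<star> trunc_arr C (n - 1) X"
      using X by simp
    note cD = is_cokernelD[OF coker[of n]]
    show "trunc_arr C n X \<star> Dif X (n - 2) = Zero C (dom (Dif X (n - 2))) (cod (trunc_arr C n X))"
      unfolding fac using precomp_eq[OF cD(4), of "trunc_arr C (n - 1) X"] X by simp
    fix g assume g: "arr g" "dom g = cod (Dif X (n - 2))" "g \<star> Dif X (n - 2) = Zero C (dom (Dif X (n - 2))) (cod g)"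
    have "g \<star> cycles_arr X (n - 1) = Zero C (dom (cycles_arr X (n - 1))) (cod g)"
    proof (rule is_cokernel_epi[OF coker[of "n - 1"]])
      show "(g \<star> cycles_arr X (n - 1)) \<star> trunc_arr C (n - 1) X =
        Zero C (dom (cycles_arr X (n - 1))) (cod g) \<star> trunc_arr C (n - 1) X"
        using X g by simp
    qed (use X g in simp_all)
    then show "\<exists>h. arr h \<and> dom h = cod (trunc_arr C n X) \<and> cod h = cod g \<and> h \<star> trunc_arr C n X = g"
      using is_cokernel_lift[OF coker[of n] g(1)] X g(2) by simp
  next
    show "h = h'" if "arr h" "arr h'" "cod h' = cod h" "dom h = cod (trunc_arr C n X)"
      "dom h' = cod (trunc_arr C n X)" "h \<star> trunc_arr C n X = h' \<star> trunc_arr C n X" for h h'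
      by (rule is_cokernel_epi[OF coker[of n] that])
  qed (use X in simp_all)
  moreover have "cod (trunc_arr C n X) = dom (cycles_arr X n)"
    "Dif X (n - 1) = cycles_arr X n \<star> trunc_arr C n X" for n
    using X by simp_all
  ultimately show "acyclic_complex C X"
    unfolding acyclic_complex_def using X d infl cycles_arr_is_kernel[OF X] by blast
qed

end

section \<open>The thick subcategory of acyclic complexes\<close>

context deflation_exact_category
begin

lemma H_surj_of_Comp:
  assumes X: "complex X" and Y: "complex Y" and Z: "complex Z"
    and f: "f \<in> chains X Y" and g: "g \<in> chains Y Z"
    and s: "H_surj X Z (\<lambda>n. g n \<star> f n) n"
  shows "H_surj Y Z g n"
proof (rule H_surjI)
  note fD = chain_mapsD[OF f] and gD = chain_mapsD[OF g]
  fix z assume z: "arr z" "cod z = Ter Z n" "cocycle Z n z"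
  obtain a x b where axb: "deflation C a" "cod a = dom z" "arr x" "dom x = dom a" "cod x = Ter X n"
    "arr b" "dom b = dom a" "cod b = Ter Z (n - 1)" "cocycle X n x"
    "z \<star> a = Add C ((g n \<star> f n) \<star> x) (Dif Z (n - 1) \<star> b)"
    using s z by (rule H_surjE)
  have "Dif Y n \<star> (f n \<star> x) = f (n + 1) \<star> (Dif X n \<star> x)"
    using X Y axb(3,5) by (simp add: fD)
  then show "locally_image Y Z (g n) n z"
    using X axb by (intro exI[of _ a] exI[of _ "f n \<star> x"] exI[of _ b]) (simp add: fD(1-3) gD(1-3))
qed

text \<open>If the zero map is surjective on cohomology, the target has none. This extracts
  exactness from the coincidence of an identity with zero, in the homotopy category and after
  localization.\<close>

lemma exact_at_of_H_surj_Zero: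
  assumes X: "complex X" and Y: "complex Y"
    and s: "H_surj X Y (zero_map X Y) n"
  shows "exact_at Y n"
proof (rule exact_atI)
  fix y assume y: "arr y" "cod y = Ter Y n" "cocycle Y n y"
  obtain a x b where "deflation C a" "cod a = dom y" "arr x" "dom x = dom a" "cod x = Ter X n"
    "arr b" "dom b = dom a" "cod b = Ter Y (n - 1)"
    "y \<star> a = Add C (Zero C (Ter X n) (Ter Y n) \<star> x) (Dif Y (n - 1) \<star> b)"
    using s y by (rule H_surjE)
  then show "locally_boundary Y n y"
    using X Y by (intro exI[of _ a] exI[of _ b]) simp
qed

lemma H_surj_shift:
  assumes X: "complex X" and Y: "complex Y" and f: "f \<in> chains X Y" and s: "H_surj X Y f (n + 1)"
  shows "H_surj (shift_cpx C X) (shift_cpx C Y) (\<lambda>n. f (n + 1)) n"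
proof (rule H_surjI)
  note fD = chain_mapsD[OF f]
  fix y assume y: "arr y" "cod y = Ter (shift_cpx C Y) n"
    "cocycle (shift_cpx C Y) n y"
  have dy: "cocycle Y (n + 1) y"
    using y Y by (simp add: Neg_eq_Zero_iff)
  obtain a x b where axb: "deflation C a" "cod a = dom y" "arr x" "dom x = dom a" "cod x = Ter X (n + 1)"
    "arr b" "dom b = dom a" "cod b = Ter Y (n + 1 - 1)"
    "cocycle X (n + 1) x"
    "y \<star> a = Add C (f (n + 1) \<star> x) (Dif Y (n + 1 - 1) \<star> b)"
    by (rule H_surjE[OF s y(1) _ dy]) (use y in simp_all)
  then show "locally_image (shift_cpx C X) (shift_cpx C Y) (f (n + 1)) n y"
    using X Y by (intro exI[of _ a] exI[of _ x] exI[of _ "Neg C b"]) simp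
qed

lemma H_inj_shift:
  assumes X: "complex X" and Y: "complex Y" and f: "f \<in> chains X Y" and i: "H_inj X Y f (n + 1)"
  shows "H_inj (shift_cpx C X) (shift_cpx C Y) (\<lambda>n. f (n + 1)) n"
proof (rule H_injI)
  fix x y assume xy: "arr x" "arr y" "dom y = dom x" "cod x = Ter (shift_cpx C X) n"
    "cod y = Ter (shift_cpx C Y) (n - 1)"
    "cocycle (shift_cpx C X) n x"
    "f (n + 1) \<star> x = Dif (shift_cpx C Y) (n - 1) \<star> y"
  have dx: "cocycle X (n + 1) x"
    using xy X by (simp add: Neg_eq_Zero_iff)
  have fx: "f (n + 1) \<star> x = Dif Y (n + 1 - 1) \<star> Neg C y"
    using xy Y by simp
  obtain a b where "deflation C a" "cod a = dom x" "arr b" "dom b = dom a"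
    "cod b = Ter X (n + 1 - 1)" "x \<star> a = Dif X (n + 1 - 1) \<star> b"
    by (rule H_injE[OF i xy(1) _ _ _ _ dx fx]) (use xy in simp_all)
  then show "locally_boundary (shift_cpx C X) n x"
    using X by (intro exI[of _ a] exI[of _ "Neg C b"]) simp
qed

lemma qis_shift:
  assumes "complex X" "complex Y" "f \<in> chains X Y" "qis X Y f"
  shows "qis (shift_cpx C X) (shift_cpx C Y) (\<lambda>n. f (n + 1))"
  using assms H_surj_shift H_inj_shift by (simp add: qis_def)

definition acyclics :: "('a, 'b) cpx set" where
  "acyclics = {X. complex X \<and> (\<forall>n. exact_at X n)}"

definition K_qis :: "('a, 'b) htpy_arr \<Rightarrow> bool" where
  "K_qis F \<longleftrightarrow> (\<exists>X Y f. complex X \<and> complex Y \<and> f \<in> chains X Y \<and> F = htpy X Y f \<and> qis X Y f)"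

text \<open>\<open>K_qis\<close> only asks for some representative that is a quasi-isomorphism; by
  homotopy invariance every other representative is one too.\<close>

lemma K_qis_htpy [simp]:
  assumes XY: "complex X" "complex Y" and f: "f \<in> chains X Y"
  shows "K_qis (htpy X Y f) \<longleftrightarrow> qis X Y f"
proof
  assume "K_qis (htpy X Y f)"
  then obtain g where g: "g \<in> chains X Y" "htpy X Y f = htpy X Y g" "qis X Y g"
    unfolding K_qis_def by (metis htpy_def prod.inject)
  then have "homotopic C X Y g f" using htpy_eq_iff[OF XY g(1) f] by simp
  then show "qis X Y f" using qis_homotopic[OF XY g(1) f] g(3) by blast
qed (use assms in \<open>auto simp: K_qis_def\<close>)

lemma K_qis_Arr: "K_qis F \<Longrightarrow> F \<in> Arr K"
  unfolding K_qis_def using K_ArrI by blast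

lemma K_qis_Ide: "complex X \<Longrightarrow> K_qis (Ide K X)"
  by (simp add: K_Ide chain_maps_Ide qis_Ide)

lemma K_qis_Comp:
  assumes "F \<in> Hom K X Y" "G \<in> Hom K Y Z" "K_qis F" "K_qis G"
  shows "K_qis (G \<odot> F)"
  using assms qis_Comp by (auto elim!: K_HomE simp: K_Comp chain_maps_Comp)

lemma K_qis_cancel:
  assumes "F \<in> Hom K X Y" "G \<in> Hom K Y Z" "K_qis G" "K_qis (G \<odot> F)"
  shows "K_qis F"
  using assms qis_cancel by (auto elim!: K_HomE simp: K_Comp chain_maps_Comp)

text \<open>A left inverse in the homotopy category makes a representative of \<open>F\<close>
  injective on all cohomology sheaves, which is how exactness descends to direct summands.\<close>

lemma K_retract:
  assumes "F \<in> Hom K X Y" "G \<in> Hom K Y X" "G \<odot> F = Ide K X"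
  shows "\<exists>f. complex X \<and> complex Y \<and> f \<in> chains X Y \<and> (\<forall>n. H_inj X Y f n)"
proof -
  obtain f where f: "complex X" "complex Y" "f \<in> chains X Y" "F = htpy X Y f"
    using assms(1) by (rule K_HomE)
  obtain g where g: "g \<in> chains Y X" "G = htpy Y X g"
    using assms(2) by (rule K_HomE)
  have "K_qis (G \<odot> F)" using assms(3) K_qis_Ide f by simp
  then have "qis X X (\<lambda>n. g n \<star> f n)" using f g by (simp add: K_Comp chain_maps_Comp)
  then show ?thesis
    using f H_inj_of_Comp[OF f(1,2,1,3) g(1)] by (auto simp: qis_def)
qed

text \<open>Injectivity comes from \<open>G \<odot> F\<close> being an identity and surjectivity
  from \<open>F \<odot> G\<close>.\<close>

lemma K_qis_iso:
  assumes "F \<in> Hom K X Y" "iso_arr K F"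
  shows "K_qis F"
proof -
  obtain G where G: "G \<in> Hom K Y X" "G \<odot> F = Ide K X" "F \<odot> G = Ide K Y"
    using assms by (auto simp: iso_arr_def Hom_def)
  obtain f where f: "complex X" "complex Y" "f \<in> chains X Y" "F = htpy X Y f"
    using assms(1) by (rule K_HomE)
  obtain g where g: "g \<in> chains Y X" "G = htpy Y X g"
    using G(1) by (rule K_HomE)
  have "K_qis (G \<odot> F)" "K_qis (F \<odot> G)" using G K_qis_Ide f by simp_all
  then have "qis X X (\<lambda>n. g n \<star> f n)" "qis Y Y (\<lambda>n. f n \<star> g n)"
    using f g by (simp_all add: K_Comp chain_maps_Comp)
  then have "qis X Y f"
    using H_inj_of_Comp[OF f(1,2,1,3) g(1)] H_surj_of_Comp[OF f(2,1,2) g(1) f(3)] by (auto simp: qis_def)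
  then show ?thesis using f by simp
qed

lemma exact_at_isomorphic:
  assumes "isomorphic K X Y" "exact_at X n"
  shows "exact_at Y n"
proof -
  obtain F where F: "F \<in> Hom K X Y" "iso_arr K F" using assms by (auto simp: isomorphic_def)
  then obtain f where f: "complex X" "complex Y" "f \<in> chains X Y" "F = htpy X Y f"
    by (auto elim: K_HomE)
  then have "qis X Y f" using K_qis_iso[OF F] by simp
  then show ?thesis using exact_at_H_surj[OF f(1-3) _ assms(2)] by (simp add: qis_def)
qed

lemma acyclics_iso_closed: "iso_closed K acyclics"
  unfolding iso_closed_def acyclics_def using exact_at_isomorphic by auto

lemma acyclics_thick: "thick K acyclics"
  unfolding thick_def
proof (intro conjI allI impI ballI)
  show "iso_closed K acyclics" by (rule acyclics_iso_closed)
next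
  fix Z assume Z: "zero_obj K Z"
  then have ZC: "complex Z" by (simp add: zero_obj_def)
  have "htpy Z Z (zero_map Z Z) \<in> Hom K Z Z" "Ide K Z \<in> Hom K Z Z"
    using K_HomI[OF ZC ZC chain_maps_Zero] K.Ide_Hom ZC by simp_all
  then have "htpy Z Z (zero_map Z Z) = Ide K Z"
    using Z ZC unfolding zero_obj_def by auto
  then have "qis Z Z (zero_map Z Z)"
    using K_qis_Ide[OF ZC] K_qis_htpy[OF ZC ZC chain_maps_Zero[OF ZC ZC]] by simp
  then show "Z \<in> acyclics"
    using ZC exact_at_of_H_surj_Zero[OF ZC ZC] by (auto simp: acyclics_def qis_def)
next
  fix X assume "X \<in> Obj K"
  then have X: "complex X" by simp
  have "(\<forall>n. exact_at X (n + 1)) \<longleftrightarrow> (\<forall>n. exact_at X n)"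
    by (metis diff_add_cancel)
  moreover have "complex (shift_cpx C X)" using X by simp
  ultimately show "Sh K X \<in> acyclics \<longleftrightarrow> X \<in> acyclics"
    using X exact_at_shift[OF X] unfolding acyclics_def K_simps mem_Collect_eq by blast
next
  fix u v w assume uvw: "(u, v, w) \<in> Tri K \<and> Dom K u \<in> acyclics \<and> Cod K u \<in> acyclics"
  then obtain X Y f a b c where *: "complex X" "complex Y" "f \<in> chains X Y" "u \<in> Arr K" "v \<in> Arr K"
    "iso_arr K a" "iso_arr K b" "iso_arr K c" "a \<in> Hom K (Dom K u) X" "b \<in> Hom K (Cod K u) Y"
    "c \<in> Hom K (Cod K v) (cone C X Y f)"
    by (auto elim: K_TriE)
  then have iso: "isomorphic K (Dom K u) X" "isomorphic K (Cod K u) Y" "isomorphic K (Cod K v) (cone C X Y f)"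
    by (auto simp: isomorphic_def)
  have "exact_at X n" "exact_at Y n" for n
    using exact_at_isomorphic iso(1,2) uvw by (auto simp: acyclics_def)
  \<comment> \<open>A chain map between exact complexes satisfies \<open>H_surj\<close> and
    \<open>H_inj\<close> for lack of cohomology, so its cone is exact.\<close>
  then have "exact_at (cone C X Y f) n" for n
    using exact_at_cone[OF *(1-3)] H_surj_of_exact[OF *(1-3)] H_inj_of_exact by blast
  then have "exact_at (Cod K v) n" for n
    using exact_at_isomorphic K.isomorphic_sym iso(3) by blast
  moreover have "complex (Cod K v)" using K.Cod_Obj *(5) by auto
  ultimately show "Cod K v \<in> acyclics" by (auto simp: acyclics_def)
next
  have retract: "A \<in> acyclics" if r: "F \<in> Hom K A S" "G \<in> Hom K S A" "G \<odot> F = Ide K A" "S \<in> acyclics" for A S F G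
  proof -
    obtain f g where "complex A" "complex S" "f \<in> chains A S" "\<forall>n. H_inj A S f n"
      using K_retract[OF r(1-3)] by blast
    then show ?thesis using exact_at_H_inj r(4) by (auto simp: acyclics_def)
  qed
  fix A B S i1 i2 p1 p2 assume "is_biproduct K A B (S, i1, i2, p1, p2) \<and> S \<in> acyclics"
  then show "A \<in> acyclics" "B \<in> acyclics"
    using retract[of i1 A S p1] retract[of i2 B S p2] by (auto simp: is_biproduct_def)
qed

text \<open>Up to isomorphisms \<open>a\<close> and \<open>b\<close> at its ends, a denominator is a
  chain map with exact cone, that is, a quasi-isomorphism; cancelling \<open>b\<close> transfers
  this to \<open>F\<close>. Conversely the standard triangle of a quasi-isomorphism is a
  witness.\<close>

lemma denominators_iff: "F \<in> denominators K acyclics \<longleftrightarrow> K_qis F"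
proof
  assume F: "F \<in> denominators K acyclics"
  then have FA: "F \<in> Arr K" by (simp add: denominators_def)
  obtain X Y f a b where *: "complex X" "complex Y" "f \<in> chains X Y"
    "iso_arr K a" "iso_arr K b" "a \<in> Hom K (Dom K F) X" "b \<in> Hom K (Cod K F) Y"
    "b \<odot> F = htpy X Y f \<odot> a" "cone C X Y f \<in> acyclics"
    using denominators_K_E[OF F acyclics_iso_closed] by blast
  then have "K_qis (htpy X Y f)" using exact_cone_iff_qis[OF *(1-3)] by (simp add: acyclics_def)
  then have "K_qis (b \<odot> F)"
    unfolding *(8) using K_qis_Comp[OF *(6) K_HomI[OF *(1-3)]] K_qis_iso[OF *(6,4)] by blast
  then show "K_qis F"
    using K_qis_cancel[OF K.HomI[OF FA] *(7)] K_qis_iso[OF *(7,5)] by blast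
next
  assume "K_qis F"
  then obtain X Y f where "complex X" "complex Y" "f \<in> chains X Y" "F = htpy X Y f" "qis X Y f"
    by (auto simp: K_qis_def)
  then show "F \<in> denominators K acyclics"
    using denominators_K_I[of X Y f acyclics] exact_cone_iff_qis is_complex_cone by (simp add: acyclics_def)
qed

sublocale fractions: right_fractions K acyclics
proof
  fix X assume "X \<in> Obj K"
  then show "Ide K X \<in> denominators K acyclics" by (simp add: denominators_iff K_qis_Ide)
next
  fix s t assume "s \<in> denominators K acyclics" "t \<in> denominators K acyclics" "Dom K t = Cod K s"
  then show "t \<odot> s \<in> denominators K acyclics"
    using K_qis_Comp[of s "Dom K s" "Cod K s" t "Cod K t"] K_qis_Arr by (simp add: denominators_iff Hom_def)
next
  fix s u assume "s \<in> denominators K acyclics" "u \<in> Arr K" "Dom K s = Cod K u" "s \<odot> u \<in> denominators K acyclics"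
  then show "u \<in> denominators K acyclics"
    using K_qis_cancel[of u "Dom K u" "Cod K u" s "Cod K s"] K_qis_Arr by (simp add: denominators_iff Hom_def)
next
  fix t F assume t: "t \<in> denominators K acyclics" and F: "F \<in> Arr K" "Cod K t = Cod K F"
  then obtain W Y t' where W: "complex W" and Y: "complex Y" and t': "t' \<in> chains W Y" "qis W Y t'"
    and tt: "t = htpy W Y t'"
    by (auto simp: denominators_iff K_qis_def)
  have "F \<in> Hom K (Dom K F) Y" using F tt by (simp add: Hom_def)
  then obtain Z f where Z: "complex Z" and f: "f \<in> chains Z Y" and Ff: "F = htpy Z Y f"
    by (auto elim: K_HomE)
  obtain P u h where P: "complex P" and u: "u \<in> chains P Z" "qis P Z u" and h: "h \<in> chains P W"
    and hom: "homotopic C P Y (\<lambda>n. f n \<star> u n) (\<lambda>n. t' n \<star> h n)"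
    by (rule qis_Ore[OF W Y Z t' f])
  have "F \<odot> htpy P Z u = t \<odot> htpy P W h"
    using htpy_eq_iff[OF P Y chain_maps_Comp[OF P Z Y u(1) f] chain_maps_Comp[OF P W Y h t'(1)]] hom
    by (simp add: Ff tt K_Comp[OF P Z Y u(1) f] K_Comp[OF P W Y h t'(1)])
  moreover have "htpy P Z u \<in> denominators K acyclics" using P Z u by (simp add: denominators_iff)
  moreover have "htpy P W h \<in> Arr K" using P W h by (rule K_ArrI)
  ultimately show "\<exists>t'\<in>denominators K acyclics. \<exists>h\<in>Arr K. Dom K t' = Dom K h \<and> Cod K t' = Dom K F \<and>
      Cod K h = Dom K t \<and> F \<odot> t' = t \<odot> h"
    by (intro bexI[of _ "htpy P Z u"] bexI[of _ "htpy P W h"]) (simp_all add: Ff tt)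
next
  fix t H H' assume t: "t \<in> denominators K acyclics" and H: "H \<in> Arr K" "H' \<in> Arr K" "Dom K H' = Dom K H"
    "Cod K H = Dom K t" "Cod K H' = Dom K t" "t \<odot> H = t \<odot> H'"
  obtain W Y t' where W: "complex W" and Y: "complex Y" and t': "t' \<in> chains W Y" "qis W Y t'"
    and tt: "t = htpy W Y t'"
    using t by (auto simp: denominators_iff K_qis_def)
  have "H \<in> Hom K (Dom K H) W" "H' \<in> Hom K (Dom K H) W" using H tt by (simp_all add: Hom_def)
  then obtain h h' where Z: "complex (Dom K H)" and h: "h \<in> chains (Dom K H) W" "h' \<in> chains (Dom K H) W"
    and hh: "H = htpy (Dom K H) W h" "H' = htpy (Dom K H) W h'"
    by (metis K_HomE)
  let ?Z = "Dom K H"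
  have "homotopic C ?Z Y (\<lambda>n. t' n \<star> h n) (\<lambda>n. t' n \<star> h' n)"
    using htpy_eq_iff[OF Z Y chain_maps_Comp[OF Z W Y h(1) t'(1)] chain_maps_Comp[OF Z W Y h(2) t'(1)]] H(6)
      K_Comp[OF Z W Y h(1) t'(1)] K_Comp[OF Z W Y h(2) t'(1)] unfolding hh(1)[symmetric] hh(2)[symmetric] tt by simp
  then obtain P u where P: "complex P" and u: "u \<in> chains P ?Z" "qis P ?Z u" and
    hom: "homotopic C P W (\<lambda>n. h n \<star> u n) (\<lambda>n. h' n \<star> u n)"
    by (rule qis_equalize[OF W Y Z t' h])
  have "H \<odot> htpy P ?Z u = H' \<odot> htpy P ?Z u"
    using htpy_eq_iff[OF P W chain_maps_Comp[OF P Z W u(1) h(1)] chain_maps_Comp[OF P Z W u(1) h(2)]] hom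
      K_Comp[OF P Z W u(1) h(1)] K_Comp[OF P Z W u(1) h(2)] hh by metis
  moreover have "htpy P ?Z u \<in> denominators K acyclics" using P Z u by (simp add: denominators_iff)
  ultimately show "\<exists>u\<in>denominators K acyclics. Cod K u = Dom K H \<and> H \<odot> u = H' \<odot> u"
    by (intro bexI[of _ "htpy P ?Z u"]) simp_all
qed

end

section \<open>Truncations\<close>

context additive_category
begin

lemma zero_object_Obj [simp]: "zero_object C \<in> Obj C"
  and to_zero_object: "\<lbrakk>arr x; arr y; dom y = dom x; cod x = zero_object C; cod y = zero_object C\<rbrakk> \<Longrightarrow> x = y"
  and from_zero_object: "\<lbrakk>arr x; arr y; cod y = cod x; dom x = zero_object C; dom y = zero_object C\<rbrakk> \<Longrightarrow> x = y"
proof -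
  have z: "zero_obj C (zero_object C)"
    unfolding zero_object_def using ex_zero_obj by (rule someI_ex)
  then show "zero_object C \<in> Obj C" by (simp add: zero_obj_def)
  show "x = y" if "arr x" "arr y" "dom y = dom x" "cod x = zero_object C" "cod y = zero_object C"
    using z that Dom_Obj[of x] unfolding zero_obj_def Hom_def by blast
  show "x = y" if "arr x" "arr y" "cod y = cod x" "dom x = zero_object C" "dom y = zero_object C"
    using z that Cod_Obj[of x] unfolding zero_obj_def Hom_def by blast
qed

end

context deflation_exact_category
begin

text \<open>The differential leaving degree \<open>n\<close> matters only through its cocycles. This
  allows it to differ, as it does at the edge of a truncation, where \<open>trunc_arr\<close>
  replaces \<open>Dif\<close>.\<close>

lemma exact_at_cong:
  assumes "Ter X n = Ter Y n" "Ter X (n - 1) = Ter Y (n - 1)" "Dif X (n - 1) = Dif Y (n - 1)"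
    "\<And>x. \<lbrakk>arr x; cod x = Ter Y n\<rbrakk> \<Longrightarrow> cocycle X n x \<longleftrightarrow>
      cocycle Y n x"
  shows "exact_at X n \<longleftrightarrow> exact_at Y n"
  unfolding exact_at_def using assms by (simp cong: ball_cong conj_cong)

lemma exact_at_zero_object:
  assumes X: "complex X" and "Ter X n = zero_object C"
  shows "exact_at X n"
proof (rule exact_atI)
  fix x assume x: "arr x" "cod x = Ter X n"
  have "x = Dif X (n - 1) \<star> Zero C (dom x) (Ter X (n - 1))"
    by (rule to_zero_object) (use X x assms(2) in simp_all)
  then show "locally_boundary X n x"
    using X x by (intro exI[of _ "Ide C (dom x)"] exI[of _ "Zero C (dom x) (Ter X (n - 1))"])
      (simp add: deflation_Ide)
qed

end

context strongly_deflation_exact_category_with_kernels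
begin

lemma cycles_arr_mono:
  assumes X: "complex X"
    and "arr h" "arr h'" "dom h' = dom h" "cod h = dom (cycles_arr X n)"
    "cod h' = dom (cycles_arr X n)" "cycles_arr X n \<star> h = cycles_arr X n \<star> h'"
  shows "h = h'"
  by (rule is_kernel_mono[OF cycles_arr_is_kernel[OF X, of n]]) (use assms in simp_all)

lemma cycles_arr_lift:
  assumes X: "complex X" and x: "arr x" "cod x = Ter X n" "cocycle X n x"
  shows "\<exists>h. arr h \<and> dom h = dom x \<and> cod h = dom (cycles_arr X n) \<and> cycles_arr X n \<star> h = x"
  using is_kernel_lift[OF cycles_arr_is_kernel[OF X, of n] x(1)] X x by simp

lemma trunc_arr_Comp_eq_Zero_iff:
  assumes X: "complex X" and x: "arr x" "cod x = Ter X (n - 1)"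
  shows "trunc_arr C n X \<star> x = Zero C (dom x) (dom (cycles_arr X n)) \<longleftrightarrow>
    Dif X (n - 1) \<star> x = Zero C (dom x) (Ter X n)"
proof
  assume eq: "trunc_arr C n X \<star> x = Zero C (dom x) (dom (cycles_arr X n))"
  have "Dif X (n - 1) \<star> x = cycles_arr X n \<star> (trunc_arr C n X \<star> x)" using X x by simp
  also have "\<dots> = Zero C (dom x) (Ter X n)" unfolding eq using X x(1) by simp
  finally show "Dif X (n - 1) \<star> x = Zero C (dom x) (Ter X n)" .
next
  assume eq: "Dif X (n - 1) \<star> x = Zero C (dom x) (Ter X n)"
  show "trunc_arr C n X \<star> x = Zero C (dom x) (dom (cycles_arr X n))"
    by (rule cycles_arr_mono[OF X, of _ _ n]) (use X x eq in simp_all)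
qed

lemma trunc_le_Ter: "Ter (trunc_le C n X) m =
    (if m < n then Ter X m else if m = n then dom (cycles_arr X n) else zero_object C)"
  by (simp add: trunc_le_def Let_def)

lemma trunc_le_Dif: "Dif (trunc_le C n X) m =
    (if m < n - 1 then Dif X m else if m = n - 1 then trunc_arr C n X
     else Zero C (Ter (trunc_le C n X) m) (Ter (trunc_le C n X) (m + 1)))"
  by (simp add: trunc_le_def Let_def)

lemma trunc_le_Ter_Obj: "complex X \<Longrightarrow> Ter (trunc_le C n X) m \<in> Obj C"
  by (simp add: trunc_le_Ter)

lemma is_complex_trunc_le:
  assumes X: "complex X"
  shows "complex (trunc_le C n X)"
proof (rule is_complexI)
  fix m
  show *: "arr (Dif (trunc_le C n X) m)" "dom (Dif (trunc_le C n X) m) = Ter (trunc_le C n X) m"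
    "cod (Dif (trunc_le C n X) m) = Ter (trunc_le C n X) (m + 1)" for m
  proof -
    consider "m < n - 1" | "m = n - 1" | "m \<ge> n" by linarith
    then have "arr (Dif (trunc_le C n X) m) \<and> dom (Dif (trunc_le C n X) m) = Ter (trunc_le C n X) m \<and>
      cod (Dif (trunc_le C n X) m) = Ter (trunc_le C n X) (m + 1)"
      by cases (use X trunc_le_Ter_Obj[OF X] in \<open>simp_all add: trunc_le_Dif\<close>, simp_all add: trunc_le_Ter X)
    then show "arr (Dif (trunc_le C n X) m)" "dom (Dif (trunc_le C n X) m) = Ter (trunc_le C n X) m"
      "cod (Dif (trunc_le C n X) m) = Ter (trunc_le C n X) (m + 1)" by auto
  qed
  consider "m < n - 2" | "m = n - 2" | "m > n - 2" by linarith
  then show "Dif (trunc_le C n X) (m + 1) \<star> Dif (trunc_le C n X) m =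
      Zero C (Ter (trunc_le C n X) m) (Ter (trunc_le C n X) (m + 2))"
  proof cases
    case 1
    then show ?thesis using X by (simp add: trunc_le_Dif trunc_le_Ter)
  next
    case 2
    then show ?thesis using X trunc_arr_Comp_eq_Zero_iff[OF X, of "Dif X (n - 2)" n]
      by (simp add: trunc_le_Dif trunc_le_Ter)
  next
    case 3
    then have "Dif (trunc_le C n X) (m + 1) =
      Zero C (Ter (trunc_le C n X) (m + 1)) (Ter (trunc_le C n X) (m + 2))"
      by (simp add: trunc_le_Dif)
    then show ?thesis using * trunc_le_Ter_Obj[OF X] by simp
  qed
qed

lemma trunc_le_cycle_iff:
  assumes X: "complex X" and m: "m < n" and x: "arr x" "cod x = Ter X m"
  shows "cocycle (trunc_le C n X) m x \<longleftrightarrow>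
    cocycle X m x"
proof (cases "m = n - 1")
  case True
  then show ?thesis using trunc_arr_Comp_eq_Zero_iff[OF X x(1), of n] x(2) by (simp add: trunc_le_Dif trunc_le_Ter)
qed (use m in \<open>simp add: trunc_le_Dif trunc_le_Ter\<close>)

text \<open>In degree \<open>n\<close> every arrow into the kernel is a cocycle, because the next
  term is zero, and such arrows correspond to the cocycles of \<open>X\<close>. A cover and a
  bounding element serve for both sides, as the inclusion of the kernel is mono.\<close>

lemma exact_at_trunc_le:
  assumes X: "complex X"
  shows "exact_at (trunc_le C n X) m \<longleftrightarrow> (m \<le> n \<longrightarrow> exact_at X m)"
proof -
  let ?T = "trunc_le C n X"
  consider "m < n" | "m = n" | "m > n" by linarith
  then show ?thesis
  proof cases
    case 1
    then have "exact_at ?T m \<longleftrightarrow> exact_at X m"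
      using trunc_le_cycle_iff[OF X 1] by (intro exact_at_cong) (simp_all add: trunc_le_Ter trunc_le_Dif)
    then show ?thesis using 1 by simp
  next
    case 3
    then have "exact_at ?T m"
      by (intro exact_at_zero_object is_complex_trunc_le X) (simp add: trunc_le_Ter)
    then show ?thesis using 3 by simp
  next
    case 2
    have T: "Ter ?T n = dom (cycles_arr X n)" "Ter ?T (n - 1) = Ter X (n - 1)" "Dif ?T (n - 1) = trunc_arr C n X"
      "Dif ?T n = Zero C (dom (cycles_arr X n)) (zero_object C)" "Ter ?T (n + 1) = zero_object C"
      by (simp_all add: trunc_le_Ter trunc_le_Dif)
    have "exact_at ?T n \<longleftrightarrow> exact_at X n"
    proof
      assume ex: "exact_at ?T n"
      show "exact_at X n"
      proof (rule exact_atI)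
        fix x assume x: "arr x" "cod x = Ter X n" "cocycle X n x"
        obtain h where h: "arr h" "dom h = dom x" "cod h = dom (cycles_arr X n)" "cycles_arr X n \<star> h = x"
          using cycles_arr_lift[OF X x] by blast
        obtain a b where ab: "deflation C a" "cod a = dom h" "arr b" "dom b = dom a"
          "cod b = Ter ?T (n - 1)" "h \<star> a = Dif ?T (n - 1) \<star> b"
          by (rule exact_atE[OF ex, of h]) (use X h T in simp_all)
        have "x \<star> a = cycles_arr X n \<star> (h \<star> a)"
          by (rule precomp_eq[OF h(4), symmetric]) (use X h ab in simp_all)
        also have "\<dots> = Dif X (n - 1) \<star> b"
          unfolding ab(6) T using X ab(3,5) T by simp
        finally show "locally_boundary X n x"
          using ab h T by auto
      qed
    next
      assume ex: "exact_at X n"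
      show "exact_at ?T n"
      proof (rule exact_atI)
        fix h assume h: "arr h" "cod h = Ter ?T n"
        have d: "Dif X n \<star> (cycles_arr X n \<star> h) = Zero C (dom h) (Ter X (n + 1))"
          using precomp_eq[OF cycles_arr(3)[OF X, of n], of h] X h T by simp
        obtain a b where ab: "deflation C a" "cod a = dom (cycles_arr X n \<star> h)" "arr b" "dom b = dom a"
          "cod b = Ter X (n - 1)" "(cycles_arr X n \<star> h) \<star> a = Dif X (n - 1) \<star> b"
          by (rule exact_atE[OF ex, of "cycles_arr X n \<star> h"]) (use X h T d in simp_all)
        have "h \<star> a = trunc_arr C n X \<star> b"
          by (rule cycles_arr_mono[OF X, of _ _ n]) (use X h T ab in simp_all)
        then show "locally_boundary ?T n h"
          using X ab h T by (intro exI[of _ a] exI[of _ b]) simp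
      qed
    qed
    then show ?thesis using 2 by simp
  qed
qed

section \<open>The upper truncation\<close>

lemma trunc_ge_Ter: "Ter (trunc_ge C n X) m =
    (if m \<ge> n - 1 then Ter X m else if m = n - 2 then dom (cycles_arr X (n - 1)) else zero_object C)"
  by (simp add: trunc_ge_def Let_def)

lemma trunc_ge_Dif: "Dif (trunc_ge C n X) m =
    (if m \<ge> n - 1 then Dif X m else if m = n - 2 then cycles_arr X (n - 1)
     else Zero C (Ter (trunc_ge C n X) m) (Ter (trunc_ge C n X) (m + 1)))"
  by (simp add: trunc_ge_def Let_def)

lemma trunc_ge_Ter_Obj: "complex X \<Longrightarrow> Ter (trunc_ge C n X) m \<in> Obj C"
  by (simp add: trunc_ge_Ter)

lemma is_complex_trunc_ge:
  assumes X: "complex X"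
  shows "complex (trunc_ge C n X)"
proof (rule is_complexI)
  fix m
  show *: "arr (Dif (trunc_ge C n X) m)" "dom (Dif (trunc_ge C n X) m) = Ter (trunc_ge C n X) m"
    "cod (Dif (trunc_ge C n X) m) = Ter (trunc_ge C n X) (m + 1)" for m
  proof -
    consider "m \<ge> n - 1" | "m = n - 2" | "m < n - 2" by linarith
    then have "arr (Dif (trunc_ge C n X) m) \<and> dom (Dif (trunc_ge C n X) m) = Ter (trunc_ge C n X) m \<and>
      cod (Dif (trunc_ge C n X) m) = Ter (trunc_ge C n X) (m + 1)"
      by cases (use X trunc_ge_Ter_Obj[OF X] in \<open>simp_all add: trunc_ge_Dif\<close>, simp_all add: trunc_ge_Ter X)
    then show "arr (Dif (trunc_ge C n X) m)" "dom (Dif (trunc_ge C n X) m) = Ter (trunc_ge C n X) m"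
      "cod (Dif (trunc_ge C n X) m) = Ter (trunc_ge C n X) (m + 1)" by auto
  qed
  consider "m \<ge> n - 1" | "m = n - 2" | "m < n - 2" by linarith
  then show "Dif (trunc_ge C n X) (m + 1) \<star> Dif (trunc_ge C n X) m =
      Zero C (Ter (trunc_ge C n X) m) (Ter (trunc_ge C n X) (m + 2))"
  proof cases
    case 1
    then show ?thesis using X by (simp add: trunc_ge_Dif trunc_ge_Ter)
  next
    case 2
    then show ?thesis using X cycles_arr(3)[OF X, of "n - 1"] by (simp add: trunc_ge_Dif trunc_ge_Ter)
  next
    case 3
    then have "Dif (trunc_ge C n X) m =
      Zero C (Ter (trunc_ge C n X) m) (Ter (trunc_ge C n X) (m + 1))"
      by (simp add: trunc_ge_Dif)
    then show ?thesis using *[of "m + 1"] trunc_ge_Ter_Obj[OF X] by simp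
  qed
qed

text \<open>The kernel placed in degree \<open>n - 2\<close> removes the cohomology below
  \<open>n\<close>: its lifting property gives exactness at \<open>n - 1\<close> and its monicity
  gives exactness at \<open>n - 2\<close>, both with the identity as cover. No cokernel has to be
  formed.\<close>

lemma exact_at_trunc_ge:
  assumes X: "complex X"
  shows "exact_at (trunc_ge C n X) m \<longleftrightarrow> (m \<ge> n \<longrightarrow> exact_at X m)"
proof -
  let ?T = "trunc_ge C n X"
  consider "m \<ge> n" | "m = n - 1" | "m = n - 2" | "m < n - 2" by linarith
  then show ?thesis
  proof cases
    case 1
    then have "exact_at ?T m \<longleftrightarrow> exact_at X m"
      by (intro exact_at_cong) (simp_all add: trunc_ge_Ter trunc_ge_Dif)
    then show ?thesis using 1 by simp
  next
    case 4
    then have "exact_at ?T m"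
      by (intro exact_at_zero_object is_complex_trunc_ge X) (simp add: trunc_ge_Ter)
    then show ?thesis using 4 by simp
  next
    case 2
    have "exact_at ?T (n - 1)"
    proof (rule exact_atI)
      fix x assume x: "arr x" "cod x = Ter ?T (n - 1)" "cocycle ?T (n - 1) x"
      obtain h where h: "arr h" "dom h = dom x" "cod h = dom (cycles_arr X (n - 1))" "cycles_arr X (n - 1) \<star> h = x"
        using cycles_arr_lift[OF X x(1), of "n - 1"] x by (auto simp: trunc_ge_Ter trunc_ge_Dif)
      then show "locally_boundary ?T (n - 1) x"
        using X x by (intro exI[of _ "Ide C (dom x)"] exI[of _ h])
          (simp add: deflation_Ide trunc_ge_Ter trunc_ge_Dif)
    qed
    then show ?thesis using 2 by simp
  next
    case 3
    have "exact_at ?T (n - 2)"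
    proof (rule exact_atI)
      fix x assume x: "arr x" "cod x = Ter ?T (n - 2)" "cocycle ?T (n - 2) x"
      have x': "cod x = dom (cycles_arr X (n - 1))" "cycles_arr X (n - 1) \<star> x = Zero C (dom x) (Ter X (n - 1))"
        using x(2,3) by (simp_all add: trunc_ge_Ter trunc_ge_Dif)
      have xz: "x = Zero C (dom x) (dom (cycles_arr X (n - 1)))"
        by (rule cycles_arr_mono[OF X, of _ _ "n - 1"]) (use X x(1) x' in simp_all)
      have "Dif ?T (n - 2 - 1) \<star> Zero C (dom x) (Ter ?T (n - 2 - 1)) = Zero C (dom x) (dom (cycles_arr X (n - 1)))"
        using complexD[OF is_complex_trunc_ge[OF X, of n], of "n - 2 - 1"] x(1) by (simp add: trunc_ge_Ter)
      then show "locally_boundary ?T (n - 2) x"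
        using X x(1) xz trunc_ge_Ter_Obj[OF X, of n "n - 2 - 1"]
        by (intro exI[of _ "Ide C (dom x)"] exI[of _ "Zero C (dom x) (Ter ?T (n - 2 - 1))"])
          (simp add: deflation_Ide)
    qed
    then show ?thesis using 3 by simp
  qed
qed

section \<open>The inclusion of the lower truncation\<close>

definition trunc_le_incl :: "int \<Rightarrow> ('a, 'b) cpx \<Rightarrow> int \<Rightarrow> 'b" where
  "trunc_le_incl n X m = (if m < n then Ide C (Ter X m) else if m = n then cycles_arr X n
     else Zero C (zero_object C) (Ter X m))"

lemma chain_maps_trunc_le_incl:
  assumes X: "complex X"
  shows "trunc_le_incl n X \<in> chains (trunc_le C n X) X"
proof (rule chain_mapsI)
  let ?T = "trunc_le C n X"
  note T = is_complex_trunc_le[OF X, of n]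
  fix m
  show *: "arr (trunc_le_incl n X m)" "dom (trunc_le_incl n X m) = Ter ?T m" "cod (trunc_le_incl n X m) = Ter X m" for m
    using X by (auto simp: trunc_le_incl_def trunc_le_Ter)
  consider "m < n - 1" | "m = n - 1" | "m = n" | "m > n" by linarith
  then show "trunc_le_incl n X (m + 1) \<star> Dif ?T m = Dif X m \<star> trunc_le_incl n X m"
  proof cases
    case 1
    then show ?thesis using X by (simp add: trunc_le_incl_def trunc_le_Dif)
  next
    case 2
    then show ?thesis using X by (simp add: trunc_le_incl_def trunc_le_Dif)
  next
    case 3
    then show ?thesis using X by (simp add: trunc_le_incl_def trunc_le_Dif trunc_le_Ter)
  next
    case 4
    then have z: "Ter ?T m = zero_object C" by (simp add: trunc_le_Ter)
    show ?thesis by (rule from_zero_object) (use X T * complexD(2)[OF T] z in simp_all)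
  qed
qed

text \<open>For \<open>m \<le> n\<close> the truncation and \<open>X\<close> have the same term in
  degree \<open>m - 1\<close>, so the given \<open>y\<close> already bounds \<open>x\<close> in the
  truncation. For \<open>m > n\<close> the truncation is exact.\<close>

lemma H_inj_trunc_le_incl:
  assumes X: "complex X"
  shows "H_inj (trunc_le C n X) X (trunc_le_incl n X) m"
proof -
  let ?T = "trunc_le C n X"
  note T = is_complex_trunc_le[OF X, of n]
  show ?thesis
  proof (cases "m \<le> n")
    case False
    then show ?thesis using H_inj_of_exact exact_at_trunc_le[OF X] by simp
  next
    case True
    show ?thesis
    proof (rule H_injI)
      fix x y assume xy: "arr x" "arr y" "dom y = dom x" "cod x = Ter ?T m" "cod y = Ter X (m - 1)"
        "trunc_le_incl n X m \<star> x = Dif X (m - 1) \<star> y"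
      have y: "cod y = Ter ?T (m - 1)" using xy True by (simp add: trunc_le_Ter)
      have "x = Dif ?T (m - 1) \<star> y"
      proof (cases "m = n")
        case True
        show ?thesis
          by (rule cycles_arr_mono[OF X, of _ _ n]) (use True X xy in \<open>simp_all add: trunc_le_incl_def trunc_le_Ter trunc_le_Dif\<close>)
      next
        case False
        then show ?thesis using X xy \<open>m \<le> n\<close> by (simp add: trunc_le_incl_def trunc_le_Ter trunc_le_Dif)
      qed
      then show "locally_boundary ?T m x"
        using xy(1-3) y by (intro exI[of _ "Ide C (dom x)"] exI[of _ y]) (simp add: deflation_Ide)
    qed
  qed
qed

lemma H_surj_trunc_le_incl:
  assumes X: "complex X" and m: "m \<le> n"
  shows "H_surj (trunc_le C n X) X (trunc_le_incl n X) m"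
proof (rule H_surjI)
  let ?T = "trunc_le C n X"
  note T = is_complex_trunc_le[OF X, of n]
  fix y assume y: "arr y" "cod y = Ter X m" "cocycle X m y"
  have "\<exists>x. arr x \<and> dom x = dom y \<and> cod x = Ter ?T m \<and> cocycle ?T m x \<and>
    y = trunc_le_incl n X m \<star> x"
  proof (cases "m = n")
    case True
    obtain h where "arr h" "dom h = dom y" "cod h = dom (cycles_arr X m)" "cycles_arr X m \<star> h = y"
      using cycles_arr_lift[OF X y] by blast
    then show ?thesis using True X by (intro exI[of _ h]) (simp add: trunc_le_Ter trunc_le_Dif trunc_le_incl_def)
  next
    case False
    then show ?thesis using X y m trunc_le_cycle_iff[OF X _ y(1,2), of n]
      by (intro exI[of _ y]) (simp add: trunc_le_incl_def trunc_le_Ter)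
  qed
  then obtain x where x: "arr x" "dom x = dom y" "cod x = Ter ?T m"
    "cocycle ?T m x" "y = trunc_le_incl n X m \<star> x" by blast
  then show "locally_image ?T X (trunc_le_incl n X m) m y"
    using X y(1,2) by (intro exI[of _ "Ide C (dom y)"] exI[of _ x] exI[of _ "Zero C (dom y) (Ter X (m - 1))"])
      (simp add: deflation_Ide)
qed

text \<open>As \<open>X\<close> vanishes above \<open>n\<close>, the map \<open>f n\<close> is
  killed by \<open>Dif Y n\<close> and lifts to the kernel; monicity of the kernel gives
  compatibility with the differentials. The factorization is an equality of chain maps, not just a
  homotopy.\<close>

lemma factor_through_trunc_le:
  assumes X: "complex X" and Y: "complex Y" and f: "f \<in> chains X Y"
    and zero: "\<And>m. m > n \<Longrightarrow> Ter X m = zero_object C"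
  obtains g where "g \<in> chains X (trunc_le C n Y)" "\<And>m. f m = trunc_le_incl n Y m \<star> g m"
proof -
  let ?T = "trunc_le C n Y"
  note T = is_complex_trunc_le[OF Y, of n]
  note fD = chain_mapsD[OF f]
  have "Dif Y n \<star> f n = f (n + 1) \<star> Dif X n" using fD(4)[of "n + 1" n] by simp
  also have "f (n + 1) = Zero C (zero_object C) (Ter Y (n + 1))"
    by (rule from_zero_object) (use zero[of "n + 1"] in \<open>simp_all add: fD Y\<close>)
  also have "Zero C (zero_object C) (Ter Y (n + 1)) \<star> Dif X n = Zero C (dom (f n)) (Ter Y (n + 1))"
    using zero[of "n + 1"] X Y by (simp add: fD)
  finally obtain h where h: "arr h" "dom h = Ter X n" "cod h = dom (cycles_arr Y n)" "cycles_arr Y n \<star> h = f n"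
    using cycles_arr_lift[OF Y, of "f n" n] by (auto simp: fD)
  define g where "g m = (if m < n then f m else if m = n then h else Zero C (Ter X m) (zero_object C))" for m
  have g: "arr (g m)" "dom (g m) = Ter X m" "cod (g m) = Ter ?T m" for m
    using X h by (auto simp: g_def fD trunc_le_Ter)
  have fg: "f m = trunc_le_incl n Y m \<star> g m" for m
  proof (cases "m > n")
    case True
    show ?thesis by (rule from_zero_object) (use True zero[OF True] X Y in \<open>simp_all add: g_def trunc_le_incl_def fD\<close>)
  qed (use X Y h in \<open>auto simp: g_def trunc_le_incl_def fD\<close>)
  have "g (m + 1) \<star> Dif X m = Dif ?T m \<star> g m" for m
  proof -
    consider "m < n - 1" | "m = n - 1" | "m \<ge> n" by linarith
    then show ?thesis
    proof cases
      case 1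
      then show ?thesis by (simp add: g_def trunc_le_Dif fD)
    next
      case 2
      have eq: "cycles_arr Y n \<star> (h \<star> Dif X (n - 1)) = Dif Y (n - 1) \<star> f (n - 1)"
        using precomp_eq[OF h(4), of "Dif X (n - 1)"] X Y h by (simp add: fD)
      have "h \<star> Dif X (n - 1) = trunc_arr C n Y \<star> f (n - 1)"
        by (rule cycles_arr_mono[OF Y, of _ _ n]) (use X Y h eq in \<open>simp_all add: fD\<close>)
      then show ?thesis using 2 by (simp add: g_def trunc_le_Dif)
    next
      case 3
      show ?thesis by (rule to_zero_object) (use 3 X T g in \<open>simp_all add: trunc_le_Ter\<close>)
    qed
  qed
  then have "g \<in> chains X ?T" using g by (intro chain_mapsI)
  then show ?thesis using that fg by blast
qed

end

section \<open>The derived category\<close>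

lemma UN_pair_constant:
  assumes "(a, b) \<in> A" "\<And>x y. (x, y) \<in> A \<Longrightarrow> f x y = K"
  shows "(\<Union>(x, y) \<in> A. f x y) = K"
  using assms by fast

lemma category_with_triangles: "category C \<Longrightarrow> category (with_triangles C S)"
  unfolding category_def Hom_def by simp

context strongly_deflation_exact_category_with_kernels
begin

abbreviation "DC \<equiv> derived_category C"
abbreviation "roof X Y s f \<equiv> fractions.frac X Y (s, f)"

lemma thick_closure_acyclics: "thick_closure K {X. acyclic_complex C X} = acyclics"
proof -
  have "{X. acyclic_complex C X} = acyclics" by (simp add: acyclic_complex_iff acyclics_def)
  then show ?thesis using acyclics_thick hull_same[of "thick K"] by (simp add: thick_closure_def)
qed

lemma DC_eq: "DC = with_triangles (quotient_shiftcat K acyclics)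
   {(quotient_functor K acyclics u, quotient_functor K acyclics v, quotient_functor K acyclics w) | u v w.
        (u, v, w) \<in> Tri K}"
  unfolding derived_category_def verdier_quotient_def thick_closure_acyclics ..

lemma DC_simps [simp]:
  "Obj DC = {X. complex X}" "Arr DC = Arr fractions.D" "Dom DC = Dom fractions.D" "Cod DC = Cod fractions.D"
  "Ide DC = Ide fractions.D" "Comp DC = Comp fractions.D" "Zero DC = Zero fractions.D" "Sh DC = shift_cpx C"
  "ShA DC = ShA fractions.D" "Hom DC = Hom fractions.D"
  unfolding DC_eq by (simp_all add: Hom_def fun_eq_iff)

sublocale DC: category DC
  unfolding DC_eq by (rule category_with_triangles) (rule fractions.quotient.category_axioms)

lemma K_Zero_Hom: "\<lbrakk>complex X; complex Y\<rbrakk> \<Longrightarrow> Zero K X Y \<in> Hom K X Y"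
  using K_HomI chain_maps_Zero by (simp add: K_Zero)

lemma K_Zero_Comp:
  assumes "F \<in> Hom K X Y" "complex Z"
  shows "Zero K Y Z \<odot> F = Zero K X Z"
proof -
  obtain f where f: "complex X" "complex Y" "f \<in> chains X Y" "F = htpy X Y f"
    using assms(1) by (rule K_HomE)
  then show ?thesis using assms(2)
    by (auto simp: K_Zero K_Comp chain_maps_Zero chain_mapsD(1-3)[OF f(3)] intro!: htpy_cong)
qed

lemma K_Comp_Zero:
  assumes "F \<in> Hom K Y Z" "complex X"
  shows "F \<odot> Zero K X Y = Zero K X Z"
proof -
  obtain f where f: "complex Y" "complex Z" "f \<in> chains Y Z" "F = htpy Y Z f"
    using assms(1) by (rule K_HomE)
  then show ?thesis using assms(2)
    by (auto simp: K_Zero K_Comp chain_maps_Zero chain_mapsD(1-3)[OF f(3)] intro!: htpy_cong)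
qed

lemma roofs_iff: "(s, f) \<in> roofs K acyclics X Y \<longleftrightarrow>
    K_qis s \<and> f \<in> Arr K \<and> Dom K s = Dom K f \<and> Cod K s = X \<and> Cod K f = Y"
  by (simp add: fractions.roofs_iff denominators_iff)

lemma DC_HomE:
  assumes "F \<in> Hom DC X Y"
  obtains Z s f where "complex X" "complex Y" "complex Z" "s \<in> chains Z X" "qis Z X s"
    "f \<in> chains Z Y" "F = roof X Y (htpy Z X s) (htpy Z Y f)"
    "(htpy Z X s, htpy Z Y f) \<in> roofs K acyclics X Y"
proof -
  obtain S G where "X \<in> Obj K" "Y \<in> Obj K" and F: "F = roof X Y S G" and r: "(S, G) \<in> roofs K acyclics X Y"
    using assms unfolding DC_simps by (rule fractions.quotient_HomE)
  then have S: "S \<in> Hom K (Dom K S) X" "K_qis S" and G: "G \<in> Hom K (Dom K S) Y"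
    using K_qis_Arr by (auto simp: roofs_iff Hom_def)
  obtain s where s: "complex (Dom K S)" "complex X" "s \<in> chains (Dom K S) X" "S = htpy (Dom K S) X s"
    using S(1) by (rule K_HomE)
  obtain g where g: "complex Y" "g \<in> chains (Dom K S) Y" "G = htpy (Dom K S) Y g"
    using G by (rule K_HomE)
  have "qis (Dom K S) X s" using S(2) s K_qis_htpy by metis
  then show ?thesis using that[OF s(2) g(1) s(1) s(3) _ g(2)] F r s(4) g(3) by metis
qed

lemma Zero_roofs: "\<lbrakk>complex X; complex Y\<rbrakk> \<Longrightarrow> (Ide K X, Zero K X Y) \<in> roofs K acyclics X Y"
  using K_Zero_Hom K_qis_Ide by (simp add: roofs_iff Hom_def)

lemma DC_Zero: "Zero DC X Y = roof X Y (Ide K X) (Zero K X Y)"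
  by (simp add: fractions.quotient_Zero)

lemma DC_Zero_Hom:
  assumes "complex X" "complex Y"
  shows "Zero DC X Y \<in> Hom DC X Y"
  unfolding DC_Zero using fractions.quotient_Hom Zero_roofs[OF assms] assms by auto

text \<open>Refining by \<open>U\<close> replaces the roof by one with numerator zero, which is
  equivalent to the chosen zero roof. All vanishing of arrows in the derived category is proved
  through this criterion.\<close>

lemma roof_eq_Zero:
  assumes r: "(S, F) \<in> roofs K acyclics X Y" and U: "K_qis U" "Cod K U = Dom K S"
    and FU: "F \<odot> U = Zero K (Dom K U) Y"
  shows "roof X Y S F = Zero DC X Y"
proof -
  have S: "S \<in> Hom K (Dom K S) X" "K_qis S" "F \<in> Hom K (Dom K S) Y"
    using r K_qis_Arr by (auto simp: roofs_iff Hom_def)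
  have UH: "U \<in> Hom K (Dom K U) (Dom K S)" using U K_qis_Arr by (simp add: Hom_def)
  have SU: "S \<odot> U \<in> Hom K (Dom K U) X" "K_qis (S \<odot> U)"
    using K.Comp_Hom[OF UH S(1)] K_qis_Comp[OF UH S(1)] S U by auto
  have XY: "complex X" "complex Y" using K.Hom_Obj S by auto
  have "roof_equiv K acyclics (S, F) (Ide K X, Zero K X Y)"
  proof (rule fractions.roof_equivI[of _ _ U "S \<odot> U"])
    show "S \<odot> U = Ide K X \<odot> (S \<odot> U)" using K.Ide_Comp[OF SU(1)] by simp
    show "F \<odot> U = Zero K X Y \<odot> (S \<odot> U)"
      using FU K_Zero_Comp[OF SU(1) XY(2)] by simp
  qed (use S U SU XY UH K_qis_Ide in \<open>auto simp: denominators_iff Hom_def\<close>)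
  then show ?thesis
    unfolding DC_Zero using fractions.frac_eq_iff[OF r Zero_roofs[OF XY]] by simp
qed

text \<open>If \<open>X\<close> vanishes, its identity and zero roofs have a common refinement,
  which forces some quasi-isomorphism \<open>U\<close> into \<open>X\<close> to be zero; then
  \<open>X\<close> has no cohomology. Conversely, roofs into and out of an exact \<open>X\<close>
  have numerators that a quasi-isomorphism annihilates.\<close>

lemma isomorphic_to_zero_iff:
  assumes X: "complex X"
  shows "isomorphic_to_zero DC X \<longleftrightarrow> (\<forall>n. exact_at X n)"
proof
  assume "isomorphic_to_zero DC X"
  moreover have "Ide DC X \<in> Hom DC X X" "Zero DC X X \<in> Hom DC X X"
    using DC.Ide_Hom DC_Zero_Hom X by auto
  ultimately have "Ide DC X = Zero DC X X" by (rule DC.isomorphic_to_zero_endo_unique)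
  then have "roof X X (Ide K X) (Ide K X) = roof X X (Ide K X) (Zero K X X)"
    using DC_Zero by (simp add: fractions.quotient_Ide)
  moreover have "(Ide K X, Ide K X) \<in> roofs K acyclics X X"
    using X K_qis_Ide K.Ide_Hom by (simp add: roofs_iff)
  ultimately have eqv: "roof_equiv K acyclics (Ide K X, Ide K X) (Ide K X, Zero K X X)"
    using fractions.frac_eq_iff Zero_roofs[OF X X] by blast
  have I: "Ide K X \<in> denominators K acyclics" using X K_qis_Ide by (simp add: denominators_iff)
  obtain U V where UV: "U \<in> denominators K acyclics" "V \<in> denominators K acyclics" "Dom K U = Dom K V"
    "Cod K U = Dom K (Ide K X)" "Cod K V = Dom K (Ide K X)" "Ide K X \<odot> U = Ide K X \<odot> V"
    "Ide K X \<odot> U = Zero K X X \<odot> V"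
    using eqv I I by (rule fractions.roof_equivE)
  have UH: "U \<in> Hom K (Dom K U) X" "V \<in> Hom K (Dom K U) X" using UV X by (auto simp: Hom_def)
  then have U: "U = Zero K (Dom K U) X"
    using UV(7) K.Ide_Comp[OF UH(1)] K_Zero_Comp[OF UH(2) X] by simp
  define P where "P = Dom K U"
  have P: "complex P" using K.Hom_Obj UH by (auto simp: P_def)
  have "K_qis U" using UV(1) by (simp add: denominators_iff)
  then have "K_qis (Zero K P X)" using U unfolding P_def by (rule back_subst)
  then have "qis P X (zero_map P X)"
    using P X chain_maps_Zero[OF P X] by (simp add: K_Zero)
  then show "\<forall>n. exact_at X n"
    using exact_at_of_H_surj_Zero[OF P X] by (simp add: qis_def)
next
  assume ex: "\<forall>n. exact_at X n"
  have to: "F = Zero DC Y X" if F: "F \<in> Hom DC Y X" for F Y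
  proof -
    obtain Z s f where *: "complex Y" "complex X" "complex Z" "s \<in> chains Z Y" "qis Z Y s"
      "f \<in> chains Z X" "F = roof Y X (htpy Z Y s) (htpy Z X f)"
      "(htpy Z Y s, htpy Z X f) \<in> roofs K acyclics Y X"
      using F by (rule DC_HomE)
    obtain P u where P: "complex P" and u: "u \<in> chains P Z" "qis P Z u" and
      h: "homotopic C P X (\<lambda>n. f n \<star> u n) (zero_map P X)"
      by (rule ex_qis_annihilating[OF *(3) X *(6)]) (use ex in auto)
    show ?thesis unfolding *(7)
    proof (rule roof_eq_Zero[OF *(8), of "htpy P Z u"])
      show "htpy Z X f \<odot> htpy P Z u = Zero K (Dom K (htpy P Z u)) X"
        using h htpy_eq_iff[OF P X chain_maps_Comp[OF P *(3) X u(1) *(6)] chain_maps_Zero[OF P X]]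
        by (simp add: K_Comp[OF P *(3) X u(1) *(6)] K_Zero)
    qed (use P u * in simp_all)
  qed
  have from_: "F = Zero DC X Y" if F: "F \<in> Hom DC X Y" for F Y
  proof -
    obtain Z s f where *: "complex X" "complex Y" "complex Z" "s \<in> chains Z X" "qis Z X s"
      "f \<in> chains Z Y" "F = roof X Y (htpy Z X s) (htpy Z Y f)"
      "(htpy Z X s, htpy Z Y f) \<in> roofs K acyclics X Y"
      using F by (rule DC_HomE)
    \<comment> \<open>The apex \<open>Z\<close> is quasi-isomorphic to \<open>X\<close>, hence
      exact. So the identity of \<open>Z\<close> is annihilated by a quasi-isomorphism, and with it
      any numerator that starts at \<open>Z\<close>.\<close>
    have exZ: "exact_at Z n" for n
      using exact_at_H_inj[OF *(3,1,4)] *(5) ex by (simp add: qis_def)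
    obtain P u where P: "complex P" and u: "u \<in> chains P Z" "qis P Z u" and
      h: "homotopic C P Z (\<lambda>n. Ide C (Ter Z n) \<star> u n) (zero_map P Z)"
      by (rule ex_qis_annihilating[OF *(3) *(3) chain_maps_Ide[OF *(3)] exZ])
    have "homotopic C P Z u (zero_map P Z)"
      using h by (simp add: chain_mapsD(1-3)[OF u(1)])
    then have "htpy P Z u = Zero K P Z"
      using htpy_eq_iff[OF P *(3) u(1) chain_maps_Zero[OF P *(3)]] by (simp add: K_Zero)
    then have "htpy Z Y f \<odot> htpy P Z u = Zero K P Y"
      using K_Comp_Zero[OF K_HomI[OF *(3,2,6)] P] by simp
    then show ?thesis unfolding *(7) using P u *
      by (intro roof_eq_Zero[OF *(8), of "htpy P Z u"]) simp_all
  qed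
  have "zero_obj DC X"
    unfolding zero_obj_def
  proof (intro conjI ballI)
    show "X \<in> Obj DC" using X by simp
    fix Y assume "Y \<in> Obj DC"
    then have Y: "complex Y" by simp
    show "\<exists>!f. f \<in> Hom DC Y X" by (rule ex1I[where a = "Zero DC Y X"]) (rule DC_Zero_Hom[OF Y X], rule to)
    show "\<exists>!f. f \<in> Hom DC X Y" by (rule ex1I[where a = "Zero DC X Y"]) (rule DC_Zero_Hom[OF X Y], rule from_)
  qed
  moreover have "isomorphic DC X X"
    using DC.iso_arr_Ide[of X] DC.Ide_Hom[of X] X by (auto simp: isomorphic_def)
  ultimately show "isomorphic_to_zero DC X" unfolding isomorphic_to_zero_def by blast
qed

text \<open>Unfolding \<open>F \<cdot> G = 1\<close> as an equivalence of roofs shows that the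
  numerator \<open>f : Z \<rightarrow> Y\<close> of \<open>F\<close> becomes a quasi-isomorphism
  after some \<open>k\<close>, so \<open>f\<close> is surjective on cohomology. The apex
  \<open>Z\<close> inherits exactness from \<open>X\<close> through the denominator of
  \<open>F\<close>.\<close>

lemma exact_at_isomorphic_DC:
  assumes "isomorphic DC X Y" and ex: "exact_at X n"
  shows "exact_at Y n"
proof -
  obtain F G where F: "F \<in> Hom DC X Y" and G: "G \<in> Hom DC Y X" and FG: "F \<cdot>\<^bsub>DC\<^esub> G = Ide DC Y"
    using assms(1) by (rule DC.isomorphicE)
  obtain Z s f where *: "complex X" "complex Y" "complex Z" "s \<in> chains Z X" "qis Z X s"
    "f \<in> chains Z Y" "F = roof X Y (htpy Z X s) (htpy Z Y f)"
    "(htpy Z X s, htpy Z Y f) \<in> roofs K acyclics X Y"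
    using F by (rule DC_HomE)
  obtain W t g where G': "complex W" "t \<in> chains W Y" "qis W Y t"
    "g \<in> chains W X" "G = roof Y X (htpy W Y t) (htpy W X g)"
    "(htpy W Y t, htpy W X g) \<in> roofs K acyclics Y X"
    using G by (rule DC_HomE)
  obtain T H where TH: "T \<in> denominators K acyclics" "H \<in> Arr K" "Dom K T = Dom K H" "Cod K T = W" "Cod K H = Z"
    and comp: "F \<cdot>\<^bsub>DC\<^esub> G = roof Y Y (htpy W Y t \<odot> T) (htpy Z Y f \<odot> H)"
    and r: "(htpy W Y t \<odot> T, htpy Z Y f \<odot> H) \<in> roofs K acyclics Y Y"
    using fractions.quotient_Comp_ex[OF G'(6) *(8)] unfolding *(7) G'(5) DC_simps K_simps by metis
  have IY: "(Ide K Y, Ide K Y) \<in> roofs K acyclics Y Y" "Ide K Y \<in> denominators K acyclics"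
    using *(2) K_qis_Ide by (simp_all add: roofs_iff denominators_iff)
  have "roof_equiv K acyclics (htpy W Y t \<odot> T, htpy Z Y f \<odot> H) (Ide K Y, Ide K Y)"
    using FG comp fractions.frac_eq_iff[OF r IY(1)] by (simp add: fractions.quotient_Ide)
  moreover have "htpy W Y t \<odot> T \<in> denominators K acyclics"
    using r by (simp add: fractions.roofs_iff)
  ultimately obtain U V where UV: "U \<in> denominators K acyclics" "V \<in> denominators K acyclics" "Dom K U = Dom K V"
    "Cod K U = Dom K (htpy W Y t \<odot> T)" "Cod K V = Dom K (Ide K Y)"
    "(htpy Z Y f \<odot> H) \<odot> U = Ide K Y \<odot> V"
    using IY(2) by (rule fractions.roof_equivE)
  have HH: "H \<in> Hom K (Dom K T) Z" "T \<in> Hom K (Dom K T) W" using TH by (auto simp: Hom_def)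
  have "Dom K (htpy W Y t \<odot> T) = Dom K T"
    using K.Comp_Hom[OF HH(2) K_HomI[OF G'(1) *(2) G'(2)]] by (simp add: Hom_def)
  then have UH: "U \<in> Hom K (Dom K U) (Dom K T)" using UV by (simp add: Hom_def)
  have VH: "V \<in> Hom K (Dom K U) Y" using UV *(2) by (simp add: Hom_def)
  have "htpy Z Y f \<odot> (H \<odot> U) = V"
    using K.Comp_assoc[OF UH HH(1) K_HomI[OF *(3,2,6)]] UV(6) K.Ide_Comp[OF VH] by simp
  moreover obtain k where k: "complex (Dom K U)" "k \<in> chains (Dom K U) Z" "H \<odot> U = htpy (Dom K U) Z k"
    using K.Comp_Hom[OF UH HH(1)] by (rule K_HomE)
  ultimately have "K_qis (htpy (Dom K U) Y (\<lambda>n. f n \<star> k n))"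
    using UV(2) K_Comp[OF k(1) *(3,2) k(2) *(6)] by (simp add: denominators_iff)
  then have "qis (Dom K U) Y (\<lambda>n. f n \<star> k n)"
    using k *(2) chain_maps_Comp[OF k(1) *(3,2) k(2) *(6)] by simp
  then have "H_surj Z Y f n"
    using H_surj_of_Comp[OF k(1) *(3,2) k(2) *(6)] by (simp add: qis_def)
  moreover have "exact_at Z n"
    using exact_at_H_inj[OF *(3,1,4)] *(5) ex by (simp add: qis_def)
  ultimately show ?thesis using exact_at_H_surj[OF *(3,2,6)] by blast
qed

lemma quotient_functor_eq:
  "quotient_functor K acyclics F = roof (Dom K F) (Cod K F) (Ide K (Dom K F)) F"
  by (simp add: quotient_functor_def fractions.frac_def)

lemma quotient_functor_Hom:
  assumes F: "F \<in> Hom K X Y"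
  shows "quotient_functor K acyclics F \<in> Hom DC X Y"
proof -
  have XY: "X \<in> Obj K" "Y \<in> Obj K" using K.Hom_Obj[OF F] by auto
  then have "(Ide K X, F) \<in> roofs K acyclics X Y"
    using F K_qis_Ide by (auto simp: roofs_iff Hom_def)
  then have "roof X Y (Ide K X) F \<in> Hom fractions.D X Y"
    unfolding fractions.quotient_Hom[OF XY] by (rule imageI)
  then show ?thesis using F unfolding quotient_functor_eq DC_simps by (simp add: Hom_def)
qed

text \<open>Prepares \<open>triangle_iso_refl\<close> for the derived category. The shift of a class
  is a union over its representatives, so each representative of the identity must be seen to shift
  to a roof equivalent to the identity.\<close>

lemma DC_ShA_Ide:
  assumes X: "complex X"
  shows "ShA DC (Ide DC X) = Ide DC (shift_cpx C X)"
proof -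
  let ?X = "shift_cpx C X"
  have IX: "(Ide K X, Ide K X) \<in> roofs K acyclics X X" "Ide K X \<in> denominators K acyclics"
    "(Ide K ?X, Ide K ?X) \<in> roofs K acyclics ?X ?X" "Ide K ?X \<in> denominators K acyclics"
    using X K_qis_Ide by (simp_all add: roofs_iff denominators_iff)
  have ShA_den: "ShA K F \<in> denominators K acyclics" if F: "F \<in> denominators K acyclics" for F
  proof -
    obtain A B f where "complex A" "complex B" "f \<in> chains A B" "F = htpy A B f" "qis A B f"
      using F by (auto simp: denominators_iff K_qis_def)
    then show ?thesis by (simp add: denominators_iff K_ShA chain_maps_shift qis_shift)
  qed
  have "roof_class K acyclics ?X ?X (ShA K S, ShA K F) = roof_class K acyclics ?X ?X (Ide K ?X, Ide K ?X)"
    if SF: "(S, F) \<in> roof_class K acyclics X X (Ide K X, Ide K X)" for S F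
  proof -
    have r: "(S, F) \<in> roofs K acyclics X X" and e: "roof_equiv K acyclics (Ide K X, Ide K X) (S, F)"
      using fractions.roof_classD[OF SF] by auto
    have SF: "S \<in> denominators K acyclics" "S \<in> Hom K (Dom K S) X" "F \<in> Hom K (Dom K S) X"
      using r by (auto simp: fractions.roofs_iff Hom_def)
    obtain U V where UV: "U \<in> denominators K acyclics" "V \<in> denominators K acyclics" "Dom K U = Dom K V"
      "Cod K U = Dom K (Ide K X)" "Cod K V = Dom K S" "Ide K X \<odot> U = S \<odot> V" "Ide K X \<odot> U = F \<odot> V"
      using e IX(2) SF(1) by (rule fractions.roof_equivE)
    have H: "U \<in> Hom K (Dom K U) X" "V \<in> Hom K (Dom K U) (Dom K S)" using UV X by (auto simp: Hom_def)
    have eqs: "ShA K S \<odot> ShA K V = ShA K U" "ShA K F \<odot> ShA K V = ShA K U"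
      using K_ShA_Comp[OF H(2) SF(2)] K_ShA_Comp[OF H(2) SF(3)] UV(6,7) K.Ide_Comp[OF H(1)] by auto
    note Sh = K_ShA_Hom[OF H(1)] K_ShA_Hom[OF H(2)] K_ShA_Hom[OF SF(2)] K_ShA_Hom[OF SF(3)]
    have "(ShA K S, ShA K F) \<in> roofs K acyclics ?X ?X"
      using Sh ShA_den[OF SF(1)] by (auto simp: fractions.roofs_iff Hom_def)
    moreover have "roof_equiv K acyclics (ShA K S, ShA K F) (Ide K ?X, Ide K ?X)"
    proof (rule fractions.roof_equivI[of _ _ "ShA K V" "ShA K U"])
      show "ShA K S \<odot> ShA K V = Ide K ?X \<odot> ShA K U" "ShA K F \<odot> ShA K V = Ide K ?X \<odot> ShA K U"
        using eqs K.Ide_Comp[OF Sh(1)] by simp_all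
    qed (use Sh UV SF IX X ShA_den in \<open>auto simp: Hom_def\<close>)
    ultimately show ?thesis using fractions.roof_class_eq_iff IX(3) by blast
  qed
  then have "(\<Union>(S, F) \<in> roof_class K acyclics X X (Ide K X, Ide K X).
      roof_class K acyclics ?X ?X (ShA K S, ShA K F)) = roof_class K acyclics ?X ?X (Ide K ?X, Ide K ?X)"
    by (rule UN_pair_constant[OF fractions.roof_class_self[OF IX(1)]])
  then show ?thesis
    by (simp add: quotient_shiftcat_def)
qed

lemma quotient_functor_Tri:
  assumes t: "(u, v, w) \<in> Tri K"
  shows "(quotient_functor K acyclics u, quotient_functor K acyclics v, quotient_functor K acyclics w) \<in> Tri DC"
proof -
  let ?Q = "quotient_functor K acyclics"
  have cand: "candidate_triangle K (u, v, w)" using t unfolding K_Tri by blast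
  have H: "u \<in> Hom K (Dom K u) (Cod K u)" "v \<in> Hom K (Cod K u) (Cod K v)" "w \<in> Hom K (Cod K v) (shift_cpx C (Dom K u))"
    using cand by (auto simp: candidate_triangle_def Hom_def)
  have Q: "?Q u \<in> Hom DC (Dom K u) (Cod K u)" "?Q v \<in> Hom DC (Cod K u) (Cod K v)"
    "?Q w \<in> Hom DC (Cod K v) (shift_cpx C (Dom K u))"
    using H quotient_functor_Hom by auto
  then have cQ: "candidate_triangle DC (?Q u, ?Q v, ?Q w)"
    by (auto simp: candidate_triangle_def Hom_def)
  have "triangle_iso DC (?Q u, ?Q v, ?Q w) (?Q u, ?Q v, ?Q w)"
  proof (rule triangle_iso_refl[OF DC.category_axioms cQ])
    show "ShA DC (Ide DC (Dom DC (?Q u))) = Ide DC (Sh DC (Dom DC (?Q u)))"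
      using Q(1) DC_ShA_Ide K.Hom_Obj[OF H(1)] by (simp add: Hom_def)
  qed
  then show ?thesis
    using cQ t unfolding DC_eq with_triangles_simps triangle_iso_with_triangles candidate_triangle_with_triangles
    by blast
qed

section \<open>The t-structure\<close>

lemma D_le0_eq: "D_le0 C = {X. complex X \<and> (\<forall>n \<ge> 1. exact_at X n)}"
proof -
  have "isomorphic_to_zero DC (trunc_ge C 1 X) \<longleftrightarrow> (\<forall>n \<ge> 1. exact_at X n)" if "complex X" for X
    using isomorphic_to_zero_iff[OF is_complex_trunc_ge[OF that]] exact_at_trunc_ge[OF that] by simp
  then show ?thesis by (auto simp: D_le0_def)
qed

lemma D_ge0_eq: "D_ge0 C = {X. complex X \<and> (\<forall>n \<le> -1. exact_at X n)}"
proof -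
  have "isomorphic_to_zero DC (trunc_le C (-1) X) \<longleftrightarrow> (\<forall>n \<le> -1. exact_at X n)" if "complex X" for X
    using isomorphic_to_zero_iff[OF is_complex_trunc_le[OF that]] exact_at_trunc_le[OF that] by simp
  then show ?thesis by (auto simp: D_ge0_def)
qed

lemma Sh_D_ge0_iff:
  assumes Y: "complex Y"
  shows "shift_cpx C Y \<in> D_ge0 C \<longleftrightarrow> (\<forall>n \<le> 0. exact_at Y n)"
proof -
  have "(\<forall>n \<le> -1. exact_at Y (n + 1)) \<longleftrightarrow> (\<forall>n \<le> 0. exact_at Y n)"
  proof (intro iffI allI impI)
    fix n :: int
    assume *: "\<forall>n \<le> -1. exact_at Y (n + 1)" and "n \<le> 0"
    then have "exact_at Y (n - 1 + 1)" by (intro *[rule_format]) simp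
    then show "exact_at Y n" by simp
  qed auto
  then show ?thesis using Y exact_at_shift[OF Y] by (simp add: D_ge0_eq)
qed

text \<open>The complex that gets truncated is the apex \<open>Z\<close> of the roof: it is
  quasi-isomorphic to \<open>X\<close>, hence exact in degrees \<open>\<ge> 1\<close>. The inclusion
  of its truncation, followed further back by the map annihilating \<open>g\<close>, is a
  denominator that kills the numerator.\<close>

lemma Hom_D_le0_D_ge1:
  assumes "X \<in> D_le0 C" "complex Y" "shift_cpx C Y \<in> D_ge0 C"
  shows "Hom DC X Y = {Zero DC X Y}"
proof -
  have X: "complex X" and exX: "exact_at X n" if "n \<ge> 1" for n
    using assms(1) that by (auto simp: D_le0_eq)
  have Xc: "complex X" using assms(1) by (auto simp: D_le0_eq)
  note Y = assms(2)
  have exY: "exact_at Y n" if "n \<le> 0" for n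
    using assms(3) that Sh_D_ge0_iff[OF Y] by blast
  have "F = Zero DC X Y" if F: "F \<in> Hom DC X Y" for F
  proof -
    obtain Z s f where *: "complex X" "complex Y" "complex Z" "s \<in> chains Z X" "qis Z X s"
      "f \<in> chains Z Y" "F = roof X Y (htpy Z X s) (htpy Z Y f)"
      "(htpy Z X s, htpy Z Y f) \<in> roofs K acyclics X Y"
      using F by (rule DC_HomE)
    note Z = *(3)
    have exZ: "exact_at Z n" if "n \<ge> 1" for n
      using exact_at_H_inj[OF *(3,1,4)] *(5) exX[OF that] by (simp add: qis_def)
    let ?T = "trunc_le C 0 Z" and ?i = "trunc_le_incl 0 Z"
    let ?A = "trunc_le C 0 Y" and ?j = "trunc_le_incl 0 Y"
    note T = is_complex_trunc_le[OF Z, of 0] and A = is_complex_trunc_le[OF Y, of 0]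
    note i = chain_maps_trunc_le_incl[OF Z, of 0] and j = chain_maps_trunc_le_incl[OF Y, of 0]
    \<comment> \<open>Surjectivity is split at the cut: up to degree 0 it holds for any truncation,
      and above it because \<open>Z\<close> is exact there.\<close>
    have qi: "qis ?T Z ?i"
      unfolding qis_def
    proof (intro allI conjI)
      fix n :: int
      show "H_inj ?T Z ?i n" by (rule H_inj_trunc_le_incl[OF Z])
      show "H_surj ?T Z ?i n"
        using H_surj_trunc_le_incl[OF Z, of n 0] H_surj_of_exact[OF T Z i exZ, of n] by (cases "n \<le> 0") auto
    qed
    have fi: "(\<lambda>n. f n \<star> ?i n) \<in> chains ?T Y" by (rule chain_maps_Comp[OF T Z Y i *(6)])
    obtain g where g: "g \<in> chains ?T ?A" and fg: "\<And>m. f m \<star> ?i m = ?j m \<star> g m"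
      by (rule factor_through_trunc_le[OF T Y fi, of 0]) (auto simp: trunc_le_Ter)
    have "exact_at ?A n" for n using exact_at_trunc_le[OF Y] exY by simp
    then obtain P u where P: "complex P" and u: "u \<in> chains P ?T" "qis P ?T u" and
      h: "homotopic C P ?A (\<lambda>n. g n \<star> u n) (zero_map P ?A)"
      by (rule ex_qis_annihilating[OF T A g])
    have gu: "htpy ?T ?A g \<odot> htpy P ?T u = Zero K P ?A"
      using h htpy_eq_iff[OF P A chain_maps_Comp[OF P T A u(1) g] chain_maps_Zero[OF P A]]
      by (simp add: K_Comp[OF P T A u(1) g] K_Zero)
    have "htpy Z Y f \<odot> (htpy ?T Z ?i \<odot> htpy P ?T u) = (htpy Z Y f \<odot> htpy ?T Z ?i) \<odot> htpy P ?T u"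
      using K.Comp_assoc[OF K_HomI[OF P T u(1)] K_HomI[OF T Z i] K_HomI[OF Z Y *(6)]] by simp
    also have "htpy Z Y f \<odot> htpy ?T Z ?i = htpy ?A Y ?j \<odot> htpy ?T ?A g"
      using K_Comp[OF T Z Y i *(6)] K_Comp[OF T A Y g j] fg by simp
    also have "(htpy ?A Y ?j \<odot> htpy ?T ?A g) \<odot> htpy P ?T u = htpy ?A Y ?j \<odot> Zero K P ?A"
      using K.Comp_assoc[OF K_HomI[OF P T u(1)] K_HomI[OF T A g] K_HomI[OF A Y j]] gu by simp
    also have "\<dots> = Zero K P Y" by (rule K_Comp_Zero[OF K_HomI[OF A Y j] P])
    finally have z: "htpy Z Y f \<odot> (htpy ?T Z ?i \<odot> htpy P ?T u) = Zero K P Y" .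
    have iu: "htpy ?T Z ?i \<odot> htpy P ?T u \<in> Hom K P Z"
      by (rule K.Comp_Hom[OF K_HomI[OF P T u(1)] K_HomI[OF T Z i]])
    have "K_qis (htpy ?T Z ?i \<odot> htpy P ?T u)"
      by (rule K_qis_Comp[OF K_HomI[OF P T u(1)] K_HomI[OF T Z i]]) (use P T Z u i qi in simp_all)
    then show ?thesis unfolding *(7)
      using roof_eq_Zero[OF *(8), of "htpy ?T Z ?i \<odot> htpy P ?T u"] z iu by (simp add: Hom_def)
  qed
  then show ?thesis using DC_Zero_Hom[OF Xc Y] by blast
qed

lemma truncation_triangle:
  assumes X: "complex X"
  shows "\<exists>u v w. (u, v, w) \<in> Tri DC \<and> Dom DC u \<in> D_le0 C \<and> Cod DC u = X \<and>
    Cod DC v \<in> Obj DC \<and> Sh DC (Cod DC v) \<in> D_ge0 C"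
proof -
  let ?T = "trunc_le C 0 X" and ?i = "trunc_le_incl 0 X"
  let ?Q = "quotient_functor K acyclics"
  note T = is_complex_trunc_le[OF X, of 0] and i = chain_maps_trunc_le_incl[OF X, of 0]
  let ?Y = "cone C ?T X ?i"
  note Y = is_complex_cone[OF T X i]
  have "(htpy ?T X ?i, htpy X ?Y (cone_in C ?T X), htpy ?Y (shift_cpx C ?T) (cone_out C ?T X)) \<in> Tri K"
    using standard_triangle_Tri[OF T X i] by (simp add: standard_triangle_eq)
  then have "(?Q (htpy ?T X ?i), ?Q (htpy X ?Y (cone_in C ?T X)), ?Q (htpy ?Y (shift_cpx C ?T) (cone_out C ?T X))) \<in> Tri DC"
    by (rule quotient_functor_Tri)
  moreover have "Dom DC (?Q (htpy ?T X ?i)) = ?T" "Cod DC (?Q (htpy ?T X ?i)) = X"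
    "Cod DC (?Q (htpy X ?Y (cone_in C ?T X))) = ?Y"
    by (simp_all add: quotient_functor_eq)
  moreover have "?T \<in> D_le0 C"
    using T exact_at_trunc_le[OF X] by (simp add: D_le0_eq)
  \<comment> \<open>For \<open>n = 0\<close> the cone also involves injectivity in degree 1, just
    beyond the cut; \<open>H_inj_trunc_le_incl\<close> holds in every degree and covers this
    case.\<close>
  moreover have "exact_at ?Y n" if "n \<le> 0" for n
    using exact_at_cone[OF T X i H_surj_trunc_le_incl[OF X that] H_inj_trunc_le_incl[OF X]] .
  then have "shift_cpx C ?Y \<in> D_ge0 C" using Sh_D_ge0_iff[OF Y] by blast
  ultimately show ?thesis using Y by (metis DC_simps(1,8) mem_Collect_eq)
qed

lemma t_structure_DC: "t_structure DC (D_le0 C) (D_ge0 C)"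
proof
  show "iso_closed DC (D_le0 C)" "iso_closed DC (D_ge0 C)"
    unfolding iso_closed_def D_le0_eq D_ge0_eq using exact_at_isomorphic_DC by auto
next
  fix X assume "X \<in> D_le0 C"
  then show "Sh DC X \<in> D_le0 C" by (auto simp: D_le0_eq exact_at_shift)
next
  fix Y assume "Y \<in> Obj DC" "Sh DC Y \<in> D_ge0 C"
  then show "Y \<in> D_ge0 C" using Sh_D_ge0_iff by (auto simp: D_ge0_eq)
next
  fix X Y assume "X \<in> D_le0 C" "Y \<in> Obj DC" "Sh DC Y \<in> D_ge0 C"
  then show "Hom DC X Y = {Zero DC X Y}" using Hom_D_le0_D_ge1 by simp
next
  fix X assume "X \<in> Obj DC"
  then show "\<exists>u v w. (u, v, w) \<in> Tri DC \<and> Dom DC u \<in> D_le0 C \<and> Cod DC u = X \<and>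
    Cod DC v \<in> Obj DC \<and> Sh DC (Cod DC v) \<in> D_ge0 C"
    using truncation_triangle by simp
qed

end

theorem proposition3p5:
  fixes E :: "('o, 'a) conflcat"
  assumes "strongly_deflation_exact_category E"
    and "has_kernels E"
  shows "t_structure (derived_category E) (D_le0 E) (D_ge0 E)"
proof -
  interpret strongly_deflation_exact_category E by (rule assms(1))
  interpret strongly_deflation_exact_category_with_kernels E
    by unfold_locales (rule assms(2))
  show ?thesis by (rule t_structure_DC)
qed

end
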